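(* Let $\Phi,\Psi$ be quantum channels from $\mathcal{H}$ to $\mathcal{K}$. If $S_{\min}(\Phi'_d\otimes\Psi)=S_{\min}(\Phi'_d)+S_{\min}(\Psi)$ for all sufficiently large $d$, then $S_{\min}(\Phi\otimes\Psi)=S_{\min}(\Phi)+S_{\min}(\Psi)$, where $\Phi'_d$ denotes the mixed-unitary approximation of $\Phi$ obtained by applying the construction below to a Stinespring dilation of $\Phi$ using an ancillary space $\mathcal{A}$ of dimension $d$.
   Context: $S(\rho)=-\operatorname{tr}\rho\log\rho$ (log base 2) is the von Neumann entropy and $S_{\min}(\Phi)=\min_\rho S(\Phi(\rho))$ over density operators $\rho$ on the input space. Construction: write $\Phi(X)=\operatorname{tr}_{\mathcal{B}} U(|0\rangle\langle0|\otimes X)U^*$ with $|0\rangle\in\mathcal{A}$ and $U$ unitary from $\mathcal{A}\otimes\mathcal{H}$ to $\mathcal{K}\otimes\mathcal{B}$. Let $S_0=|0\rangle\otimes\mathcal{H}\subseteq\mathcal{A}\otimes\mathcal{H}$ and $S_0^\perp$ its orthogonal complement. Let $D_{S_0}(\rho)=\tfrac12(V\rho V^*+\rho)$ where $V$ acts as the identity on $S_0$ and as $-1$ on $S_0^\perp$. Let $M(\rho)=\frac1{e^2}\sum_{a,b=0}^{e-1}(\mathbb{1}_{S_0}\oplus W_{a,b})\rho(\mathbb{1}_{S_0}\oplus W_{a,b})^*$ where $e=\dim S_0^\perp$ and $W_{a,b}=X^aZ^b$ are the discrete Weyl operators on $S_0^\perp$ (with respect to an orthonormal basis $|j\rangle$,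 $X|j\rangle=|j+1\bmod e\rangle$, $Z|j\rangle=\omega^j|j\rangle$, $\omega=e^{2\pi i/e}$). Let $N_{\mathcal{B}}(Y)=\operatorname{tr}_{\mathcal{B}}(Y)\otimes \mathbb{1}_{\mathcal{B}}/\dim\mathcal{B}$ (completely depolarizing channel on $\mathcal{B}$). Then $\Phi'(\rho)=N_{\mathcal{B}}\big(U[(M\circ D_{S_0})(\rho)]U^*\big)$, a mixed-unitary channel from $\mathcal{A}\otimes\mathcal{H}$ to $\mathcal{K}\otimes\mathcal{B}$. *)

theory Defs
  imports "Jordan_Normal_Form.Schur_Decomposition"
begin

definition mtensor :: "complex mat \<Rightarrow> complex mat \<Rightarrow> complex mat" where
  "mtensor A B = mat (dim_row A * dim_row B) (dim_col A * dim_col B)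
     (\<lambda>(i,j). A $$ (i div dim_row B, j div dim_col B) * B $$ (i mod dim_row B, j mod dim_col B))"

definition mtrace :: "complex mat \<Rightarrow> complex" where
  "mtrace A = (\<Sum>i<dim_row A. A $$ (i,i))"

definition unit_mat :: "nat \<Rightarrow> nat \<Rightarrow> nat \<Rightarrow> complex mat" where
  "unit_mat n a b = mat n n (\<lambda>(i,j). if i = a \<and> j = b then 1 else 0)"

definition unitary_mat :: "nat \<Rightarrow> complex mat \<Rightarrow> bool" where
  "unitary_mat n U \<longleftrightarrow> U \<in> carrier_mat n n \<and> U * mat_adjoint U = 1\<^sub>m n \<and> mat_adjoint U * U = 1\<^sub>m n"

definition psd :: "nat \<Rightarrow> complex mat \<Rightarrow> bool" where
  "psd n A \<longleftrightarrow> A \<in> carrier_mat n n \<and>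
     (\<forall>v \<in> carrier_vec n. let q = (\<Sum>i<n. cnj (v $ i) * (A *\<^sub>v v) $ i) in Im q = 0 \<and> Re q \<ge> 0)"

definition density :: "nat \<Rightarrow> complex mat \<Rightarrow> bool" where
  "density n \<rho> \<longleftrightarrow> psd n \<rho> \<and> mtrace \<rho> = 1"

text \<open>Tensor product of two linear maps (Phi: n1 -> m1, Psi: n2 -> m2), defined as the unique
  linear map with (Phi (x) Psi)(A (x) B) = Phi A (x) Psi B, written out via matrix units.\<close>
definition chan_tensor :: "nat \<Rightarrow> nat \<Rightarrow> nat \<Rightarrow> nat \<Rightarrow> (complex mat \<Rightarrow> complex mat)
    \<Rightarrow> (complex mat \<Rightarrow> complex mat) \<Rightarrow> complex mat \<Rightarrow> complex mat" where
  "chan_tensor n1 m1 n2 m2 \<Phi> \<Psi> X = mat (m1 * m2) (m1 * m2) (\<lambda>(p,q).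
     \<Sum>i<n1 * n2. \<Sum>j<n1 * n2. X $$ (i,j)
        * \<Phi> (unit_mat n1 (i div n2) (j div n2)) $$ (p div m2, q div m2)
        * \<Psi> (unit_mat n2 (i mod n2) (j mod n2)) $$ (p mod m2, q mod m2))"

definition is_channel :: "nat \<Rightarrow> nat \<Rightarrow> (complex mat \<Rightarrow> complex mat) \<Rightarrow> bool" where
  "is_channel n m \<Phi> \<longleftrightarrow>
     (\<forall>X \<in> carrier_mat n n. \<Phi> X \<in> carrier_mat m m) \<and>
     (\<forall>X \<in> carrier_mat n n. \<forall>Y \<in> carrier_mat n n. \<Phi> (X + Y) = \<Phi> X + \<Phi> Y) \<and>
     (\<forall>c. \<forall>X \<in> carrier_mat n n. \<Phi> (c \<cdot>\<^sub>m X) = c \<cdot>\<^sub>m \<Phi> X) \<and>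
     (\<forall>X \<in> carrier_mat n n. mtrace (\<Phi> X) = mtrace X) \<and>
     (\<forall>k Y. psd (k * n) Y \<longrightarrow> psd (k * m) (chan_tensor k k n m (\<lambda>Z. Z) \<Phi> Y))"

definition eta :: "real \<Rightarrow> real" where
  "eta x = (if x \<le> 0 then 0 else - x * log 2 x)"

definition vn_entropy :: "complex mat \<Rightarrow> real" where
  "vn_entropy \<rho> = (THE s. \<exists>U D. unitary_mat (dim_row \<rho>) U \<and> D \<in> carrier_mat (dim_row \<rho>) (dim_row \<rho>)
      \<and> diagonal_mat D \<and> \<rho> = U * D * mat_adjoint U
      \<and> s = (\<Sum>i<dim_row \<rho>. eta (Re (D $$ (i,i)))))"

definition S_min :: "nat \<Rightarrow> (complex mat \<Rightarrow> complex mat) \<Rightarrow> real" where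
  "S_min n \<Phi> = Inf {vn_entropy (\<Phi> \<rho>) | \<rho>. density n \<rho>}"

definition proj_vec :: "complex vec \<Rightarrow> complex mat" where
  "proj_vec v = mat (dim_vec v) (dim_vec v) (\<lambda>(i,j). v $ i * cnj (v $ j))"

definition ptrace_B :: "nat \<Rightarrow> nat \<Rightarrow> complex mat \<Rightarrow> complex mat" where
  "ptrace_B m b Y = mat m m (\<lambda>(k,l). \<Sum>\<beta><b. Y $$ (k * b + \<beta>, l * b + \<beta>))"

text \<open>Dilation data (b, v0, U, Q): dim B = b, |0> = v0 in A = C^d, U unitary A(x)H -> K(x)B,
  and Q an (dn) x e matrix whose columns are an orthonormal basis of the complement of S_0 = |0>(x)H
  (used to define the Weyl operators on S_0^perp), e = dn - n.\<close>
type_synonym dil_data = "nat \<times> complex vec \<times> complex mat \<times> complex mat"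

definition S0_proj :: "nat \<Rightarrow> complex vec \<Rightarrow> complex mat" where
  "S0_proj n v0 = mtensor (proj_vec v0) (1\<^sub>m n)"

definition is_dilation :: "nat \<Rightarrow> nat \<Rightarrow> (complex mat \<Rightarrow> complex mat) \<Rightarrow> nat \<Rightarrow> dil_data \<Rightarrow> bool" where
  "is_dilation n m \<Phi> d D \<longleftrightarrow> (case D of (b, v0, U, Q) \<Rightarrow>
      d * n = m * b \<and>
      v0 \<in> carrier_vec d \<and> (\<Sum>i<d. cnj (v0 $ i) * v0 $ i) = 1 \<and>
      unitary_mat (d * n) U \<and>
      (\<forall>X \<in> carrier_mat n n. \<Phi> X = ptrace_B m b (U * mtensor (proj_vec v0) X * mat_adjoint U)) \<and>
      Q \<in> carrier_mat (d * n) (d * n - n) \<and>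
      mat_adjoint Q * Q = 1\<^sub>m (d * n - n) \<and>
      Q * mat_adjoint Q = 1\<^sub>m (d * n) - S0_proj n v0)"

definition shiftX :: "nat \<Rightarrow> complex mat" where
  "shiftX e = mat e e (\<lambda>(i,j). if i = (j + 1) mod e then 1 else 0)"

definition clockZ :: "nat \<Rightarrow> complex mat" where
  "clockZ e = mat e e (\<lambda>(i,j). if i = j then cis (2 * pi / real e) ^ j else 0)"

definition weyl :: "nat \<Rightarrow> nat \<Rightarrow> nat \<Rightarrow> complex mat" where
  "weyl e a b = (shiftX e ^\<^sub>m a) * (clockZ e ^\<^sub>m b)"

definition mixed_unitary_approx :: "nat \<Rightarrow> nat \<Rightarrow> nat \<Rightarrow> dil_data \<Rightarrow> complex mat \<Rightarrow> complex mat" where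
  "mixed_unitary_approx n m d D \<rho> = (case D of (b, v0, U, Q) \<Rightarrow>
     let N = d * n; e = N - n; P0 = S0_proj n v0;
         V = P0 - (1\<^sub>m N - P0);
         D\<rho> = (1 / 2 :: complex) \<cdot>\<^sub>m (V * \<rho> * mat_adjoint V + \<rho>);
         G = (\<lambda>a c. P0 + Q * weyl e a c * mat_adjoint Q);
         M\<rho> = mat N N (\<lambda>(i,j). (1 / (of_nat e)^2) *
                 (\<Sum>a<e. \<Sum>c<e. (G a c * D\<rho> * mat_adjoint (G a c)) $$ (i,j)));
         Y = U * M\<rho> * mat_adjoint U
     in mtensor (ptrace_B m b Y) ((1 / of_nat b) \<cdot>\<^sub>m 1\<^sub>m b))"

end

theory Submission
  imports Defs "Jordan_Normal_Form.Spectral_Radius"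
begin

text \<open>Let \<open>e = d n - n\<close> and let \<open>X\<close> be the \<open>S\<^sub>0\<close>-block of \<open>\<rho>\<close>. The dephasing and the Weyl twirl reduce
  the approximation to \<open>\<Phi>'(\<rho>) = (\<Phi>(X) + (tr \<rho> - tr X) \<sigma>) \<otimes> 1/b\<close> with the fixed state
  \<open>\<sigma> = (b 1 - \<Phi>(1)) / e\<close>. Feeding in \<open>|0\<rangle>\<langle>0| \<otimes> \<rho>\<close> gives
  \<open>S_min(\<Phi>' \<otimes> \<Psi>) \<le> S_min(\<Phi> \<otimes> \<Psi>) + log b\<close>, while concavity of the entropy gives
  \<open>S_min(\<Phi>') \<ge> min (S_min(\<Phi>)) (S(\<sigma>)) + log b\<close>. Additivity for \<open>\<Phi>'\<close> thus yields
  \<open>S_min(\<Phi> \<otimes> \<Psi>) \<ge> min (S_min(\<Phi>)) (S(\<sigma>)) + S_min(\<Psi>)\<close>, and \<open>S(\<sigma>) \<rightarrow> log m \<ge> S_min(\<Phi>)\<close> as the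
  dilation grows. Dilations exist for all \<open>d = m k\<close> with \<open>k \<ge> m\<close>, so the limit may be taken.\<close>

section \<open>Unitary diagonalisation of Hermitian matrices\<close>

text \<open>Two features of the setting shape the argument. The approximation is never shown to be a
  channel; all that is known of it comes from its closed form. As \<open>S_min\<close> is an
  infimum, bounding it from above by the value at one chosen input needs output entropies that are
  bounded below, and for \<Phi>' \<otimes> \<Psi> this comes from a crude estimate valid for
  arbitrary maps. For \<Phi>' alone only a lower bound is used, and no minimum has to be attained.
  Moreover \<open>dil\<close> may pick any dilation. Since d n = m b, the dimension b is fixed by d,
  and \<sigma> involves only b, e and \<Phi>(1), so its spectrum does not depend on the choice. The
  same equation suggests the family d = m k, b = n k. The term log b grows with the dilation but
  stands on both sides at the same d and cancels there, so only S(\<sigma>) has to converge: its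
  eigenvalues are (n k - \<mu>) / (m k n - n), with \<mu> the fixed eigenvalues of \<Phi>(1), and
  tend to 1/m. The opposite inequality comes from product inputs.\<close>

lemma index_mult_sum:
  fixes A B :: "complex mat"
  assumes "A \<in> carrier_mat n m" "B \<in> carrier_mat m p" "i < n" "j < p"
  shows "(A * B) $$ (i,j) = (\<Sum>k<m. A $$ (i,k) * B $$ (k,j))"
  using assms by (simp add: scalar_prod_def atLeast0LessThan)

lemma index_mult3_sum:
  fixes A B C :: "complex mat"
  assumes A: "A \<in> carrier_mat n m" and B: "B \<in> carrier_mat m p" and C: "C \<in> carrier_mat p q"
    and ij: "i < n" "j < q"
  shows "(A * B * C) $$ (i,j) = (\<Sum>k<m. \<Sum>l<p. A $$ (i,k) * B $$ (k,l) * C $$ (l,j))"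
proof -
  have "(A * B * C) $$ (i,j) = (\<Sum>l<p. (\<Sum>k<m. A $$ (i,k) * B $$ (k,l)) * C $$ (l,j))"
    using ij by (subst index_mult_sum[OF mult_carrier_mat[OF A B] C])
      (auto simp: index_mult_sum[OF A B] intro!: sum.cong simp del: index_mult_mat)
  also have "\<dots> = (\<Sum>k<m. \<Sum>l<p. A $$ (i,k) * B $$ (k,l) * C $$ (l,j))"
    by (simp add: sum_distrib_right, rule sum.swap)
  finally show ?thesis .
qed

section \<open>Adjoints and unitary matrices\<close>

lemma dim_mat_adjoint [simp]:
  "dim_row (mat_adjoint A) = dim_col A" "dim_col (mat_adjoint A) = dim_row A"
  unfolding mat_adjoint_def by (simp_all add: mat_of_rows_def)

lemma mat_adjoint_carrier [simp]:
  "A \<in> carrier_mat n m \<Longrightarrow> mat_adjoint A \<in> carrier_mat m n"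
  by (intro carrier_matI) (simp_all add: carrier_matD)

lemma index_mat_adjoint [simp]:
  fixes A :: "complex mat"
  assumes "i < dim_col A" "j < dim_row A"
  shows "mat_adjoint A $$ (i,j) = cnj (A $$ (j,i))"
  using assms unfolding mat_adjoint_def by (simp add: mat_of_rows_index cols_def)

lemma mat_adjoint_mult:
  fixes A B :: "complex mat"
  assumes "A \<in> carrier_mat n m" "B \<in> carrier_mat m p"
  shows "mat_adjoint (A * B) = mat_adjoint B * mat_adjoint A"
  by (rule eq_matI, insert assms) (auto simp: scalar_prod_def ac_simps intro!: sum.cong)

lemma mat_adjoint_adjoint [simp]:
  fixes A :: "complex mat"
  shows "mat_adjoint (mat_adjoint A) = A"
  by (rule eq_matI) auto

lemma unitary_matD:
  assumes "unitary_mat n U"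
  shows "U \<in> carrier_mat n n"
    and "U * mat_adjoint U = 1\<^sub>m n"
    and "mat_adjoint U * U = 1\<^sub>m n"
  using assms unfolding unitary_mat_def by auto

lemma unitary_mat_cols:
  assumes "unitary_mat n U" "i < n" "j < n"
  shows "(\<Sum>k<n. cnj (U $$ (k,i)) * U $$ (k,j)) = (if i = j then 1 else 0)"
proof -
  note U = unitary_matD[OF assms(1)]
  have "(mat_adjoint U * U) $$ (i,j) = (\<Sum>k<n. mat_adjoint U $$ (i,k) * U $$ (k,j))"
    using U assms by (intro index_mult_sum) auto
  also have "\<dots> = (\<Sum>k<n. cnj (U $$ (k,i)) * U $$ (k,j))"
    using U assms by (intro sum.cong) auto
  finally show ?thesis using U assms by simp
qed

lemma unitary_mat_rows:
  assumes "unitary_mat n U" "i < n" "j < n"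
  shows "(\<Sum>k<n. U $$ (i,k) * cnj (U $$ (j,k))) = (if i = j then 1 else 0)"
proof -
  note U = unitary_matD[OF assms(1)]
  have "(U * mat_adjoint U) $$ (i,j) = (\<Sum>k<n. U $$ (i,k) * mat_adjoint U $$ (k,j))"
    using U assms by (intro index_mult_sum) auto
  also have "\<dots> = (\<Sum>k<n. U $$ (i,k) * cnj (U $$ (j,k)))"
    using U assms by (intro sum.cong) auto
  finally show ?thesis using U assms by simp
qed

text \<open>A left inverse of a square matrix is also a right inverse, so orthonormal columns
  suffice. Most unitaries below are constructed column by column.\<close>

lemma unitary_matI:
  assumes U: "U \<in> carrier_mat n n"
    and orth: "\<And>i j. i < n \<Longrightarrow> j < n \<Longrightarrow>
      (\<Sum>k<n. cnj (U $$ (k,i)) * U $$ (k,j)) = (if i = j then 1 else 0)"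
  shows "unitary_mat n U"
proof -
  have "mat_adjoint U * U = 1\<^sub>m n"
  proof (rule eq_matI)
    fix i j assume "i < dim_row (1\<^sub>m n :: complex mat)" "j < dim_col (1\<^sub>m n :: complex mat)"
    hence ij: "i < n" "j < n" by auto
    have "(mat_adjoint U * U) $$ (i,j) = (\<Sum>k<n. mat_adjoint U $$ (i,k) * U $$ (k,j))"
      using U ij by (intro index_mult_sum) auto
    also have "\<dots> = (\<Sum>k<n. cnj (U $$ (k,i)) * U $$ (k,j))"
      using U ij by (intro sum.cong) auto
    finally show "(mat_adjoint U * U) $$ (i,j) = 1\<^sub>m n $$ (i,j)"
      using orth ij by simp
  qed (use U in auto)
  thus ?thesis unfolding unitary_mat_def
    using mat_mult_left_right_inverse[of "mat_adjoint U" n U] U by auto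
qed

lemma unitary_mat_adjoint: "unitary_mat n U \<Longrightarrow> unitary_mat n (mat_adjoint U)"
  unfolding unitary_mat_def by auto

lemma unitary_mat_mult:
  assumes "unitary_mat n U" "unitary_mat n V"
  shows "unitary_mat n (U * V)"
proof -
  note U = unitary_matD[OF assms(1)] and V = unitary_matD[OF assms(2)]
  have aU: "mat_adjoint U \<in> carrier_mat n n" and aV: "mat_adjoint V \<in> carrier_mat n n"
    using U V by auto
  have "U * V * (mat_adjoint V * mat_adjoint U) = U * (V * mat_adjoint V) * mat_adjoint U"
    by (simp only: assoc_mult_mat[of _ n n _ n _ n] mult_carrier_mat[of _ n n _ n] U(1) V(1) aU aV)
  moreover have "mat_adjoint V * mat_adjoint U * (U * V) = mat_adjoint V * (mat_adjoint U * U) * V"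
    by (simp only: assoc_mult_mat[of _ n n _ n _ n] mult_carrier_mat[of _ n n _ n] U(1) V(1) aU aV)
  ultimately show ?thesis
    unfolding unitary_mat_def mat_adjoint_mult[OF U(1) V(1)] using U V aU aV by auto
qed

text \<open>The factorisation A = U diag(f) U^* with real eigenvalues, which makes A Hermitian. It
  is spelled out in entries because tensor products, permutations and quadratic forms are treated
  below by rearranging sums.\<close>

definition spectral :: "nat \<Rightarrow> complex mat \<Rightarrow> complex mat \<Rightarrow> (nat \<Rightarrow> real) \<Rightarrow> bool" where
  "spectral n A U f \<longleftrightarrow> unitary_mat n U \<and> A \<in> carrier_mat n n \<and>
     (\<forall>i<n. \<forall>j<n. A $$ (i,j) = (\<Sum>k<n. U $$ (i,k) * of_real (f k) * cnj (U $$ (j,k))))"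

lemma spectralD:
  assumes "spectral n A U f"
  shows "unitary_mat n U" "A \<in> carrier_mat n n"
    "\<And>i j. i < n \<Longrightarrow> j < n \<Longrightarrow> A $$ (i,j) = (\<Sum>k<n. U $$ (i,k) * of_real (f k) * cnj (U $$ (j,k)))"
  using assms unfolding spectral_def by auto

lemma index_diag_conj:
  assumes U: "U \<in> carrier_mat n n" and ij: "i < n" "j < n"
  shows "(U * mat_diag n g * mat_adjoint U) $$ (i,j) = (\<Sum>k<n. U $$ (i,k) * g k * cnj (U $$ (j,k)))"
proof -
  have "(U * mat_diag n g * mat_adjoint U) $$ (i,j)
      = (\<Sum>k<n. (U * mat_diag n g) $$ (i,k) * mat_adjoint U $$ (k,j))"
    using U ij by (intro index_mult_sum[OF mult_carrier_mat[OF U]]) auto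
  also have "\<dots> = (\<Sum>k<n. U $$ (i,k) * g k * cnj (U $$ (j,k)))"
    using U ij by (intro sum.cong) (auto simp: mat_diag_mult_right[OF U])
  finally show ?thesis .
qed

text \<open>Links the entrywise form to the product form that \<open>vn_entropy\<close> uses and in
  which conjugation by a unitary is mere associativity.\<close>

lemma spectral_iff_mat_diag:
  "spectral n A U f \<longleftrightarrow>
     unitary_mat n U \<and> A = U * mat_diag n (\<lambda>k. of_real (f k)) * mat_adjoint U"
proof (cases "unitary_mat n U")
  case True
  hence U: "U \<in> carrier_mat n n" by (rule unitary_matD)
  let ?M = "U * mat_diag n (\<lambda>k. of_real (f k)) * mat_adjoint U"
  have D: "?M \<in> carrier_mat n n"
    by (rule mult_carrier_mat[OF mult_carrier_mat[OF U mat_diag_dim] mat_adjoint_carrier[OF U]])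
  have "A = ?M \<longleftrightarrow> A \<in> carrier_mat n n \<and> (\<forall>i<n. \<forall>j<n. A $$ (i,j) = ?M $$ (i,j))"
    using D by (metis carrier_matD eq_matI)
  thus ?thesis unfolding spectral_def using True by (simp add: index_diag_conj[OF U] del: index_mult_mat)
qed (simp add: spectral_def)

lemma spectral_unitary_conj:
  assumes W: "unitary_mat n W" and B: "spectral n B V f"
  shows "spectral n (W * B * mat_adjoint W) (W * V) f"
proof -
  let ?D = "mat_diag n (\<lambda>k. complex_of_real (f k))"
  have V: "unitary_mat n V" "B = V * ?D * mat_adjoint V"
    using B unfolding spectral_iff_mat_diag by blast+
  have c: "W \<in> carrier_mat n n" "V \<in> carrier_mat n n" "mat_adjoint W \<in> carrier_mat n n"
      "mat_adjoint V \<in> carrier_mat n n" "?D \<in> carrier_mat n n"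
    using unitary_matD[OF W] unitary_matD[OF V(1)] by auto
  have "W * B * mat_adjoint W = W * V * ?D * mat_adjoint (W * V)"
    unfolding V(2) mat_adjoint_mult[OF c(1,2)]
    by (simp only: assoc_mult_mat[of _ n n _ n _ n] mult_carrier_mat[of _ n n _ n] c)
  thus ?thesis unfolding spectral_iff_mat_diag using unitary_mat_mult[OF W V(1)] by blast
qed

text \<open>Complete v to a basis and orthogonalise. Gram-Schmidt keeps the leading vector v but
  does not normalise, so each column is divided by its length; this is where the factor c comes
  from.\<close>

lemma exists_unitary_first_column:
  fixes v :: "complex vec"
  assumes v: "v \<in> carrier_vec n" and v0: "v \<noteq> 0\<^sub>v n"
  shows "\<exists>W c. unitary_mat n W \<and> (\<forall>i<n. W $$ (i,0) = c * v $ i)"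
proof -
  interpret cof_vec_space n "TYPE(complex)" .
  note bc = basis_completion[OF v v0]
  define ws where "ws = gram_schmidt n (basis_completion v)"
  note gs = gram_schmidt_result[OF bc(2) bc(4) bc(5) ws_def]
  have n: "n > 0" using v v0 by (cases n) auto
  have len: "length ws = n" using gs(4) bc(6) by simp
  have wsc: "\<And>k. k < n \<Longrightarrow> ws ! k \<in> carrier_vec n" using gs(3) len by (metis nth_mem subsetD)
  have hd: "ws ! 0 = v"
    using bc(7) bc(6) n v len unfolding ws_def
    by (metis gram_schmidt_hd hd_conv_nth hd_Cons_tl length_greater_0_conv)
  have ip: "(ws ! i \<bullet>c ws ! j) = (\<Sum>k<n. ws ! i $ k * cnj (ws ! j $ k))" if "i < n" "j < n" for i j
    using wsc[OF that(1)] wsc[OF that(2)] by (auto simp: scalar_prod_def atLeast0LessThan intro!: sum.cong)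
  define r where "r k = (\<Sum>a<n. (cmod (ws ! k $ a))\<^sup>2)" for k
  have rr: "(ws ! k \<bullet>c ws ! k) = of_real (r k)" if "k < n" for k
    unfolding ip[OF that that] r_def of_real_sum by (intro sum.cong refl) (simp only: complex_norm_square)
  have rpos: "r k > 0" if "k < n" for k
  proof -
    have "ws ! k \<bullet>c ws ! k \<noteq> 0" using corthogonalD[OF gs(2), of k k] that len by auto
    hence "r k \<noteq> 0" unfolding rr[OF that] by simp
    moreover have "r k \<ge> 0" unfolding r_def by (intro sum_nonneg) auto
    ultimately show ?thesis by simp
  qed
  define W where "W = mat n n (\<lambda>(i,k). ws ! k $ i / of_real (sqrt (r k)))"
  have "unitary_mat n W"
  proof (rule unitary_matI)
    fix i j assume ij: "i < n" "j < n"
    have "(\<Sum>k<n. cnj (W $$ (k,i)) * W $$ (k,j))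
        = (\<Sum>k<n. ws ! j $ k * cnj (ws ! i $ k) / of_real (sqrt (r i) * sqrt (r j)))"
      using ij by (intro sum.cong) (auto simp: W_def)
    also have "\<dots> = (ws ! j \<bullet>c ws ! i) / of_real (sqrt (r i) * sqrt (r j))"
      unfolding ip[OF ij(2,1)] by (simp add: sum_divide_distrib)
    also have "\<dots> = (if i = j then 1 else 0)"
      using corthogonalD[OF gs(2), of j i] ij len rr[OF ij(1)] rpos[OF ij(1)]
      by (auto simp flip: of_real_mult)
    finally show "(\<Sum>k<n. cnj (W $$ (k,i)) * W $$ (k,j)) = (if i = j then 1 else 0)" .
  qed (simp add: W_def)
  moreover have "\<forall>i<n. W $$ (i,0) = (1 / of_real (sqrt (r 0))) * v $ i"
    using n hd by (auto simp: W_def)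
  ultimately show ?thesis by blast
qed

text \<open>Inductive step of the spectral theorem: B is the direct sum of the scalar c and a
  diagonalised block, so U is the direct sum of 1 and V.\<close>

lemma spectral_extend:
  assumes B: "B \<in> carrier_mat (Suc m) (Suc m)"
    and B00: "B $$ (0,0) = of_real c"
    and B0: "\<And>i. i < m \<Longrightarrow> B $$ (Suc i, 0) = 0" "\<And>i. i < m \<Longrightarrow> B $$ (0, Suc i) = 0"
    and V: "spectral m (mat m m (\<lambda>(i,j). B $$ (Suc i, Suc j))) V g"
  shows "\<exists>U f. spectral (Suc m) B U f"
proof -
  define U where "U = mat (Suc m) (Suc m) (\<lambda>(i,j).
    case (i,j) of (0,0) \<Rightarrow> 1 | (Suc i, Suc j) \<Rightarrow> V $$ (i,j) | _ \<Rightarrow> 0)"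
  define f where "f k = (case k of 0 \<Rightarrow> c | Suc k \<Rightarrow> g k)" for k
  have U: "U $$ (0,0) = 1" "\<And>i. i < m \<Longrightarrow> U $$ (Suc i,0) = 0" "\<And>i. i < m \<Longrightarrow> U $$ (0,Suc i) = 0"
      "\<And>i j. i < m \<Longrightarrow> j < m \<Longrightarrow> U $$ (Suc i,Suc j) = V $$ (i,j)"
    by (auto simp: U_def)
  note V' = spectralD[OF V]
  have "unitary_mat (Suc m) U"
  proof (rule unitary_matI)
    fix i j assume "i < Suc m" "j < Suc m"
    thus "(\<Sum>k<Suc m. cnj (U $$ (k,i)) * U $$ (k,j)) = (if i = j then 1 else 0)"
      unfolding sum.lessThan_Suc_shift
      by (cases i; cases j) (auto simp: U unitary_mat_cols[OF V'(1)])
  qed (simp add: U_def)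
  moreover have "B $$ (i,j) = (\<Sum>k<Suc m. U $$ (i,k) * of_real (f k) * cnj (U $$ (j,k)))"
    if "i < Suc m" "j < Suc m" for i j
  proof -
    have BV: "B $$ (Suc a, Suc b) = (\<Sum>k<m. V $$ (a,k) * of_real (g k) * cnj (V $$ (b,k)))"
      if "a < m" "b < m" for a b
      using V'(3)[of a b] that by simp
    show ?thesis using that unfolding sum.lessThan_Suc_shift
      by (cases i; cases j) (auto simp: U f_def B00 B0 BV)
  qed
  ultimately show ?thesis unfolding spectral_def using B by auto
qed

text \<open>Deflation: rotate an eigenvector onto the first basis vector. Being Hermitian, the
  rotated matrix B then has a vanishing first row as well as a vanishing first column off the
  diagonal, and the remaining block is Hermitian of size m.\<close>

theorem hermitian_spectral:
  assumes "A \<in> carrier_mat n n"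
    and "\<And>i j. i < n \<Longrightarrow> j < n \<Longrightarrow> A $$ (j,i) = cnj (A $$ (i,j))"
  shows "\<exists>U f. spectral n A U f"
  using assms
proof (induction n arbitrary: A)
  case 0
  thus ?case by (intro exI[of _ "1\<^sub>m 0"]) (auto simp: spectral_def unitary_mat_def)
next
  case (Suc m)
  let ?n = "Suc m"
  note A = Suc.prems(1) and herm = Suc.prems(2)
  obtain c where "c \<in> spectrum A" using spectrum_non_empty[OF A] by auto
  then obtain v where v: "v \<in> carrier_vec ?n" "v \<noteq> 0\<^sub>v ?n" "A *\<^sub>v v = c \<cdot>\<^sub>v v"
    using A unfolding spectrum_def eigenvalue_def eigenvector_def by auto
  obtain W d where W: "unitary_mat ?n W" and Wv: "\<And>i. i < ?n \<Longrightarrow> W $$ (i,0) = d * v $ i"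
    using exists_unitary_first_column[OF v(1,2)] by blast
  note Wc = unitary_matD[OF W]
  have ev: "(\<Sum>j<?n. A $$ (i,j) * W $$ (j,0)) = c * W $$ (i,0)" if i: "i < ?n" for i
  proof -
    have "(A *\<^sub>v v) $ i = (\<Sum>j<?n. A $$ (i,j) * v $ j)"
      using A v(1) i by (auto simp: scalar_prod_def atLeast0LessThan intro!: sum.cong)
    hence e: "(\<Sum>j<?n. A $$ (i,j) * v $ j) = c * v $ i" using v i by simp
    have "(\<Sum>j<?n. A $$ (i,j) * W $$ (j,0)) = d * (\<Sum>j<?n. A $$ (i,j) * v $ j)"
      unfolding sum_distrib_left by (intro sum.cong) (auto simp: Wv)
    thus ?thesis using e i by (simp add: Wv)
  qed
  define B where "B = mat_adjoint W * A * W"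
  have Bc: "B \<in> carrier_mat ?n ?n" unfolding B_def using Wc A by auto
  have Bij: "B $$ (i,j) = (\<Sum>a<?n. \<Sum>b<?n. cnj (W $$ (a,i)) * A $$ (a,b) * W $$ (b,j))"
    if "i < ?n" "j < ?n" for i j
  proof -
    have "B $$ (i,j) = (\<Sum>a<?n. \<Sum>b<?n. mat_adjoint W $$ (i,a) * A $$ (a,b) * W $$ (b,j))"
      unfolding B_def using that Wc A by (intro index_mult3_sum) auto
    also have "\<dots> = (\<Sum>a<?n. \<Sum>b<?n. cnj (W $$ (a,i)) * A $$ (a,b) * W $$ (b,j))"
      using that Wc A by (intro sum.cong refl) auto
    finally show ?thesis .
  qed
  have Bh: "B $$ (j,i) = cnj (B $$ (i,j))" if ij: "i < ?n" "j < ?n" for i j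
  proof -
    have "cnj (B $$ (i,j)) = (\<Sum>a<?n. \<Sum>b<?n. cnj (W $$ (b,j)) * A $$ (b,a) * W $$ (a,i))"
      unfolding Bij[OF ij] cnj_sum by (intro sum.cong refl) (simp add: herm[symmetric] mult_ac)
    also have "\<dots> = B $$ (j,i)" unfolding Bij[OF ij(2,1)] by (rule sum.swap)
    finally show ?thesis by simp
  qed
  \<comment> \<open>The first column of W is an eigenvector, so A maps it to c times itself, and
    applying the adjoint of W leaves c times the first basis vector.\<close>
  have B0: "B $$ (i,0) = (if i = 0 then c else 0)" if i: "i < ?n" for i
  proof -
    have "B $$ (i,0) = (\<Sum>a<?n. cnj (W $$ (a,i)) * (\<Sum>b<?n. A $$ (a,b) * W $$ (b,0)))"
      using Bij[OF i, of 0] by (simp add: sum_distrib_left mult.assoc del: sum.lessThan_Suc)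
    also have "\<dots> = c * (\<Sum>a<?n. cnj (W $$ (a,i)) * W $$ (a,0))"
      unfolding sum_distrib_left[of c] by (intro sum.cong refl) (simp add: ev del: sum.lessThan_Suc)
    also have "\<dots> = (if i = 0 then c else 0)"
      using unitary_mat_cols[OF W i, of 0] by (simp del: sum.lessThan_Suc)
    finally show ?thesis .
  qed
  \<comment> \<open>The eigenvalue is real because it is a diagonal entry of the Hermitian matrix
    B.\<close>
  have "c = cnj c" using Bh[of 0 0] B0[of 0] by (metis zero_less_Suc)
  hence c: "c = of_real (Re c)" by (metis Reals_cnj_iff of_real_Re)
  have "\<exists>V g. spectral m (mat m m (\<lambda>(i,j). B $$ (Suc i, Suc j))) V g"
    by (rule Suc.IH) (simp_all add: Bh[symmetric])
  then obtain V g where V: "spectral m (mat m m (\<lambda>(i,j). B $$ (Suc i, Suc j))) V g" by auto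
  have "\<exists>U f. spectral ?n B U f"
  proof (rule spectral_extend[OF Bc _ _ _ V])
    show "B $$ (0,0) = of_real (Re c)" using B0[of 0] c by simp
    show "B $$ (Suc i, 0) = 0" if "i < m" for i using B0[of "Suc i"] that by simp
    show "B $$ (0, Suc i) = 0" if "i < m" for i
      using B0[of "Suc i"] Bh[of "Suc i" 0] that by (metis Suc_mono complex_cnj_zero nat.distinct(1) zero_less_Suc)
  qed
  then obtain U f where U: "spectral ?n B U f" by auto
  have aW: "mat_adjoint W \<in> carrier_mat ?n ?n" using Wc by auto
  have "W * B * mat_adjoint W = (W * mat_adjoint W) * A * (W * mat_adjoint W)"
    unfolding B_def by (simp only: assoc_mult_mat[of _ ?n ?n _ ?n _ ?n] mult_carrier_mat[of _ ?n ?n _ ?n] Wc(1) aW A)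
  also have "\<dots> = A" using Wc A by simp
  finally show ?case using spectral_unitary_conj[OF W U] by auto
qed

section \<open>Positive semidefinite matrices and concavity of the entropy\<close>

lemma sum_lessThan_add:
  fixes F :: "nat \<Rightarrow> 'a::comm_monoid_add"
  shows "(\<Sum>k<a + m. F k) = (\<Sum>k<a. F k) + (\<Sum>j<m. F (a + j))"
  by (induction m) (auto simp: add.assoc)

lemma sum_mult_split:
  fixes F :: "nat \<Rightarrow> 'a::comm_monoid_add"
  shows "(\<Sum>k<n * m. F k) = (\<Sum>i<n. \<Sum>j<m. F (i * m + j))"
proof (induction n)
  case (Suc n)
  have "(\<Sum>k<Suc n * m. F k) = (\<Sum>k<n * m + m. F k)" by (simp add: add.commute)
  thus ?case by (simp add: sum_lessThan_add Suc.IH)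
qed simp

lemma index_pair_less: "i < n \<Longrightarrow> j < m \<Longrightarrow> i * m + j < n * (m::nat)"
proof -
  assume "i < n" "j < m"
  hence "i * m + j < Suc i * m" by simp
  also have "\<dots> \<le> n * m" using \<open>i < n\<close> by (intro mult_le_mono1) auto
  finally show ?thesis .
qed

lemma index_pair_div_mod:
  assumes "k < n * (m::nat)"
  shows "k div m < n" "k mod m < m" "0 < m"
  using assms by (auto simp: less_mult_imp_div_less intro!: mod_less_divisor) (cases m; simp)+

text \<open>The form v^* A v, with v a function instead of a vector: only its values below n count,
  and test vectors can be written down without dimension conditions.\<close>

definition qform :: "nat \<Rightarrow> complex mat \<Rightarrow> (nat \<Rightarrow> complex) \<Rightarrow> complex" where
  "qform n A v = (\<Sum>i<n. \<Sum>j<n. cnj (v i) * A $$ (i,j) * v j)"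

text \<open>In the order on the complex numbers, 0 \<le> z says that z is real and nonnegative,
  which merges the two conditions inside \<open>psd\<close> into one.\<close>

lemma psd_qform_iff:
  "psd n A \<longleftrightarrow> A \<in> carrier_mat n n \<and> (\<forall>v. 0 \<le> qform n A v)"
proof (cases "A \<in> carrier_mat n n")
  case True
  have eq: "(\<Sum>i<n. cnj (v $ i) * (A *\<^sub>v v) $ i) = qform n A (($) v)" if "v \<in> carrier_vec n" for v
  proof -
    have "(A *\<^sub>v v) $ i = (\<Sum>j<n. A $$ (i,j) * v $ j)" if "i < n" for i
      using True that \<open>v \<in> carrier_vec n\<close>
      by (auto simp: scalar_prod_def atLeast0LessThan intro!: sum.cong)
    thus ?thesis unfolding qform_def by (simp add: sum_distrib_left mult.assoc)
  qed
  have "(\<forall>v\<in>carrier_vec n. 0 \<le> qform n A (($) v)) \<longleftrightarrow> (\<forall>v. 0 \<le> qform n A v)"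
  proof safe
    fix v assume *: "\<forall>v\<in>carrier_vec n. 0 \<le> qform n A (($) v)"
    have "qform n A (($) (vec n v)) = qform n A v"
      unfolding qform_def by (intro sum.cong refl) auto
    moreover have "0 \<le> qform n A (($) (vec n v))" using * by auto
    ultimately show "0 \<le> qform n A v" by simp
  qed auto
  moreover have "psd n A \<longleftrightarrow> (\<forall>v\<in>carrier_vec n. 0 \<le> qform n A (($) v))"
    unfolding psd_def Let_def using True eq by (auto simp: less_eq_complex_def)
  ultimately show ?thesis using True by simp
qed (simp add: psd_def)

lemma psdD:
  assumes "psd n A"
  shows "A \<in> carrier_mat n n" "0 \<le> qform n A v"
  using assms psd_qform_iff by auto

lemma qform_two_point:
  assumes ij: "i < n" "j < n" "i \<noteq> j"
  shows "qform n A (\<lambda>k. if k = i then a else if k = j then b else 0)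
    = cnj a * A $$ (i,i) * a + cnj a * A $$ (i,j) * b + cnj b * A $$ (j,i) * a + cnj b * A $$ (j,j) * b"
proof -
  have *: "(\<Sum>l<n. g l * (if l = i then a else if l = j then b else 0)) = g i * a + g j * b"
    for g :: "nat \<Rightarrow> complex"
  proof -
    have "(\<Sum>l<n. g l * (if l = i then a else if l = j then b else 0))
        = (\<Sum>l<n. (if l = i then g l * a else 0) + (if l = j then g l * b else 0))"
      using ij by (intro sum.cong) auto
    thus ?thesis using ij by (simp add: sum.distrib)
  qed
  have **: "(\<Sum>l<n. cnj (if l = i then a else if l = j then b else 0) * h l) = cnj a * h i + cnj b * h j"
    for h :: "nat \<Rightarrow> complex"
  proof -
    have "(\<Sum>l<n. cnj (if l = i then a else if l = j then b else 0) * h l)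
        = (\<Sum>l<n. (if l = i then cnj a * h l else 0) + (if l = j then cnj b * h l else 0))"
      using ij by (intro sum.cong) auto
    thus ?thesis using ij by (simp add: sum.distrib)
  qed
  show ?thesis
    unfolding qform_def * mult.assoc[of "cnj _"] sum_distrib_left[symmetric] **
    by (simp add: algebra_simps)
qed

lemma qform_one_point:
  assumes i: "i < n"
  shows "qform n A (\<lambda>k. if k = i then 1 else 0) = A $$ (i,i)"
proof -
  have "qform n A (\<lambda>k. if k = i then 1 else 0)
      = (\<Sum>a<n. if a = i then (\<Sum>b<n. if b = i then A $$ (a,b) else 0) else 0)"
    unfolding qform_def by (intro sum.cong) (auto simp: if_distrib[of "\<lambda>x. _ * x"] cong: if_cong)
  thus ?thesis using i by simp
qed

text \<open>Polarisation: the form is real on e_i, on e_i + e_j and on e_i + \<i> e_j. The second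
  vector gives opposite imaginary parts of the two mirrored entries, the third gives equal real
  parts.\<close>

lemma psd_hermitian:
  assumes A: "psd n A" and ij: "i < n" "j < n"
  shows "A $$ (j,i) = cnj (A $$ (i,j))"
proof -
  have diag: "Im (A $$ (k,k)) = 0" if "k < n" for k
    using psdD(2)[OF A, of "\<lambda>l. if l = k then 1 else 0"] qform_one_point[OF that, of A]
    by (simp add: less_eq_complex_def)
  show ?thesis
  proof (cases "i = j")
    case True
    thus ?thesis using diag[OF ij(1)] by (simp add: complex_eq_iff)
  next
    case False
    have "Im (A $$ (i,j)) + Im (A $$ (j,i)) = 0"
      using psdD(2)[OF A, of "\<lambda>k. if k = i then 1 else if k = j then 1 else 0"]
      unfolding qform_two_point[OF ij False] using diag ij by (simp add: less_eq_complex_def)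
    moreover have "Re (A $$ (i,j)) - Re (A $$ (j,i)) = 0"
      using psdD(2)[OF A, of "\<lambda>k. if k = i then 1 else if k = j then \<i> else 0"]
      unfolding qform_two_point[OF ij False] using diag ij by (simp add: less_eq_complex_def)
    ultimately show ?thesis by (simp add: complex_eq_iff)
  qed
qed

text \<open>In the coordinates z = U^* v of the eigenbasis the form is diagonal. Positivity, the
  recovery of eigenvalues and the overlap argument for the entropy all rest on this formula.\<close>

lemma qform_spectral:
  assumes "spectral n A U f"
  shows "qform n A v = of_real (\<Sum>l<n. f l * (cmod (\<Sum>j<n. cnj (U $$ (j,l)) * v j))\<^sup>2)"
proof -
  define z where "z l = (\<Sum>j<n. cnj (U $$ (j,l)) * v j)" for l
  have zc: "cnj (z l) = (\<Sum>i<n. cnj (v i) * U $$ (i,l))" for l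
    unfolding z_def cnj_sum by (intro sum.cong) auto
  have "qform n A v
      = (\<Sum>i<n. \<Sum>j<n. \<Sum>l<n. of_real (f l) * ((cnj (v i) * U $$ (i,l)) * (cnj (U $$ (j,l)) * v j)))"
    unfolding qform_def
  proof (intro sum.cong refl)
    fix i j assume "i \<in> {..<n}" "j \<in> {..<n}"
    thus "cnj (v i) * A $$ (i,j) * v j
        = (\<Sum>l<n. of_real (f l) * ((cnj (v i) * U $$ (i,l)) * (cnj (U $$ (j,l)) * v j)))"
      by (simp add: spectralD(3)[OF assms] sum_distrib_left sum_distrib_right mult_ac)
  qed
  also have "\<dots> = (\<Sum>i<n. \<Sum>l<n. \<Sum>j<n. of_real (f l) * ((cnj (v i) * U $$ (i,l)) * (cnj (U $$ (j,l)) * v j)))"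
    by (intro sum.cong refl sum.swap)
  also have "\<dots> = (\<Sum>l<n. \<Sum>i<n. \<Sum>j<n. of_real (f l) * ((cnj (v i) * U $$ (i,l)) * (cnj (U $$ (j,l)) * v j)))"
    by (rule sum.swap)
  also have "\<dots> = (\<Sum>l<n. of_real (f l) * (cnj (z l) * z l))"
    unfolding zc unfolding z_def sum_product by (simp add: sum_distrib_left)
  also have "\<dots> = (\<Sum>l<n. of_real (f l * (cmod (z l))\<^sup>2))"
    by (intro sum.cong refl) (simp only: of_real_mult complex_norm_square mult.commute)
  finally show ?thesis unfolding z_def by simp
qed

lemma spectral_psd:
  assumes "spectral n A U f" "\<And>k. k < n \<Longrightarrow> 0 \<le> f k"
  shows "psd n A"
  unfolding psd_qform_iff qform_spectral[OF assms(1)] using spectralD(2)[OF assms(1)] assms(2)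
  by (auto simp: less_eq_complex_def intro!: sum_nonneg)

lemma qform_spectral_column:
  assumes S: "spectral n A U f" and k: "k < n"
  shows "qform n A (\<lambda>i. U $$ (i,k)) = of_real (f k)"
proof -
  have "(\<Sum>l<n. f l * (cmod (\<Sum>j<n. cnj (U $$ (j,l)) * U $$ (j,k)))\<^sup>2)
      = (\<Sum>l<n. if l = k then f l else 0)"
    using unitary_mat_cols[OF spectralD(1)[OF S]] k by (intro sum.cong) auto
  thus ?thesis unfolding qform_spectral[OF S] using k by simp
qed

lemma psd_spectral_nonneg:
  assumes "spectral n A U f" "psd n A" "k < n"
  shows "0 \<le> f k"
  using psdD(2)[OF assms(2), of "\<lambda>i. U $$ (i,k)"] qform_spectral_column[OF assms(1,3)]
  by (simp add: less_eq_complex_def)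

lemma psd_spectral:
  assumes "psd n A"
  shows "\<exists>U f. spectral n A U f \<and> (\<forall>k<n. 0 \<le> f k)"
  using hermitian_spectral[OF psdD(1)[OF assms] psd_hermitian[OF assms]]
    psd_spectral_nonneg[OF _ assms] by blast

lemma spectral_trace:
  assumes S: "spectral n A U f"
  shows "mtrace A = of_real (\<Sum>k<n. f k)"
proof -
  have "mtrace A = (\<Sum>i<n. \<Sum>k<n. U $$ (i,k) * of_real (f k) * cnj (U $$ (i,k)))"
    unfolding mtrace_def using spectralD(2,3)[OF S] by simp
  also have "\<dots> = (\<Sum>k<n. \<Sum>i<n. U $$ (i,k) * of_real (f k) * cnj (U $$ (i,k)))"
    by (rule sum.swap)
  also have "\<dots> = (\<Sum>k<n. of_real (f k) * (\<Sum>i<n. cnj (U $$ (i,k)) * U $$ (i,k)))"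
    by (simp add: sum_distrib_left mult_ac)
  also have "\<dots> = (\<Sum>k<n. of_real (f k))"
    using unitary_mat_cols[OF spectralD(1)[OF S]] by (intro sum.cong) auto
  finally show ?thesis by simp
qed

lemma unitary_mat_cmod_rows_cols:
  assumes M: "unitary_mat n M" and i: "i < n"
  shows "(\<Sum>k<n. (cmod (M $$ (k,i)))\<^sup>2) = 1" "(\<Sum>k<n. (cmod (M $$ (i,k)))\<^sup>2) = 1"
proof -
  have "complex_of_real (\<Sum>k<n. (cmod (M $$ (k,i)))\<^sup>2) = (\<Sum>k<n. cnj (M $$ (k,i)) * M $$ (k,i))"
    unfolding of_real_sum by (intro sum.cong refl) (simp only: complex_norm_square mult.commute)
  also have "\<dots> = of_real 1" using unitary_mat_cols[OF M i i] by simp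
  finally show "(\<Sum>k<n. (cmod (M $$ (k,i)))\<^sup>2) = 1" by (simp only: of_real_eq_iff)
  have "complex_of_real (\<Sum>k<n. (cmod (M $$ (i,k)))\<^sup>2) = (\<Sum>k<n. M $$ (i,k) * cnj (M $$ (i,k)))"
    unfolding of_real_sum by (intro sum.cong refl) (simp only: complex_norm_square)
  also have "\<dots> = of_real 1" using unitary_mat_rows[OF M i i] by simp
  finally show "(\<Sum>k<n. (cmod (M $$ (i,k)))\<^sup>2) = 1" by (simp only: of_real_eq_iff)
qed

text \<open>The squared moduli of the entries of the unitary U^* W form a doubly stochastic matrix;
  these are its column sums and row sums.\<close>

lemma unitary_overlap_sums:
  assumes U: "unitary_mat n U" and W: "unitary_mat n W" and i: "i < n"
  shows "(\<Sum>l<n. (cmod (\<Sum>j<n. cnj (U $$ (j,l)) * W $$ (j,i)))\<^sup>2) = 1"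
    and "(\<Sum>l<n. (cmod (\<Sum>j<n. cnj (U $$ (j,i)) * W $$ (j,l)))\<^sup>2) = 1"
proof -
  have M: "unitary_mat n (mat_adjoint U * W)"
    using unitary_mat_mult[OF unitary_mat_adjoint[OF U] W] .
  have c: "U \<in> carrier_mat n n" "W \<in> carrier_mat n n" using U W unitary_matD by auto
  have e: "(mat_adjoint U * W) $$ (a,b) = (\<Sum>j<n. cnj (U $$ (j,a)) * W $$ (j,b))" if "a < n" "b < n" for a b
    unfolding index_mult_sum[OF mat_adjoint_carrier[OF c(1)] c(2) that]
    using c that by (intro sum.cong) auto
  show "(\<Sum>l<n. (cmod (\<Sum>j<n. cnj (U $$ (j,l)) * W $$ (j,i)))\<^sup>2) = 1"
    using unitary_mat_cmod_rows_cols(1)[OF M i] i by (simp add: e del: index_mult_mat)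
  show "(\<Sum>l<n. (cmod (\<Sum>j<n. cnj (U $$ (j,i)) * W $$ (j,l)))\<^sup>2) = 1"
    using unitary_mat_cmod_rows_cols(2)[OF M i] i by (simp add: e del: index_mult_mat)
qed

section \<open>Independence of the entropy from the chosen diagonalisation\<close>

lemma char_poly_unitary_diag:
  assumes U: "unitary_mat n U" and D: "D \<in> carrier_mat n n" "diagonal_mat D"
    and A: "A = U * D * mat_adjoint U"
  shows "proots (char_poly A) = mset (diag_mat D)"
proof -
  have "similar_mat A D"
    using unitary_matD[OF U] D A by (intro similar_matI[of _ _ U "mat_adjoint U" n]) auto
  moreover have "upper_triangular D"
    using D unfolding diagonal_mat_def by (intro upper_triangularI) auto
  ultimately have "char_poly A = (\<Prod>a\<leftarrow>diag_mat D. [:- a, 1:])"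
    using char_poly_upper_triangular[OF D(1)] char_poly_similar by metis
  moreover have "proots (\<Prod>a\<leftarrow>as. [:- a, 1:]) = mset as" for as :: "complex list"
  proof (induction as)
    case (Cons a as)
    have "(\<Prod>a\<leftarrow>as. [:- a, 1:]) \<noteq> 0" by (auto simp: prod_list_zero_iff)
    hence "proots ([:- a, 1:] * (\<Prod>a\<leftarrow>as. [:- a, 1:])) = {#a#} + proots (\<Prod>a\<leftarrow>as. [:- a, 1:])"
      by (subst proots_mult) auto
    thus ?case using Cons.IH by simp
  qed simp
  ultimately show ?thesis by simp
qed

lemma sum_diag_mset:
  fixes D :: "complex mat" and g :: "complex \<Rightarrow> real"
  assumes "D \<in> carrier_mat n n"
  shows "(\<Sum>i<n. g (D $$ (i,i))) = (\<Sum>x\<in>#mset (diag_mat D). g x)"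
proof -
  have "(\<Sum>x\<in>#mset (diag_mat D). g x) = sum_list (map g (diag_mat D))"
    by (metis mset_map sum_mset_sum_list)
  also have "map g (diag_mat D) = map (\<lambda>i. g (D $$ (i,i))) [0..<n]"
    using assms unfolding diag_mat_def by auto
  also have "sum_list \<dots> = (\<Sum>i<n. g (D $$ (i,i)))"
    by (simp add: sum_list_distinct_conv_sum_set atLeast0LessThan)
  finally show ?thesis by simp
qed

text \<open>Uniqueness for the definite description in \<open>vn_entropy\<close>: diagonalisation is
  a similarity, so the characteristic polynomial determines the multiset of diagonal entries, and
  the sum of \<open>eta\<close> depends on that multiset alone.\<close>

lemma vn_entropy_unitary_diag:
  assumes U: "unitary_mat n U" and D: "D \<in> carrier_mat n n" "diagonal_mat D"
    and A: "A = U * D * mat_adjoint U"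
  shows "vn_entropy A = (\<Sum>i<n. eta (Re (D $$ (i,i))))"
proof -
  have n: "dim_row A = n" using unitary_matD(1)[OF U] A by simp
  show ?thesis unfolding vn_entropy_def n
  proof (rule the_equality)
    show "\<exists>U D'. unitary_mat n U \<and> D' \<in> carrier_mat n n \<and> diagonal_mat D' \<and> A = U * D' * mat_adjoint U
      \<and> (\<Sum>i<n. eta (Re (D $$ (i,i)))) = (\<Sum>i<n. eta (Re (D' $$ (i,i))))"
      using assms by blast
  next
    fix s assume "\<exists>U D'. unitary_mat n U \<and> D' \<in> carrier_mat n n \<and> diagonal_mat D' \<and> A = U * D' * mat_adjoint U
      \<and> s = (\<Sum>i<n. eta (Re (D' $$ (i,i))))"
    then obtain V D' where V: "unitary_mat n V" "D' \<in> carrier_mat n n" "diagonal_mat D'"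
        "A = V * D' * mat_adjoint V" and s: "s = (\<Sum>i<n. eta (Re (D' $$ (i,i))))"
      by blast
    have "mset (diag_mat D) = mset (diag_mat D')"
      using char_poly_unitary_diag[OF assms] char_poly_unitary_diag[OF V] by simp
    thus "s = (\<Sum>i<n. eta (Re (D $$ (i,i))))"
      unfolding s sum_diag_mset[OF V(2), of "\<lambda>x. eta (Re x)"] sum_diag_mset[OF D(1), of "\<lambda>x. eta (Re x)"]
      by simp
  qed
qed

lemma vn_entropy_spectral:
  assumes "spectral n A U f"
  shows "vn_entropy A = (\<Sum>k<n. eta (f k))"
proof -
  have "vn_entropy A = (\<Sum>i<n. eta (Re (mat_diag n (\<lambda>k. complex_of_real (f k)) $$ (i,i))))"
    using assms unfolding spectral_iff_mat_diag
    by (intro vn_entropy_unitary_diag[of n U]) (auto simp: diagonal_mat_def mat_diag_def)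
  thus ?thesis by (simp add: mat_diag_def)
qed

section \<open>Concavity, for the scalar function \<open>eta\<close> and then for the
  entropy\<close>

lemma eta_nonneg: "x \<le> 1 \<Longrightarrow> 0 \<le> eta x"
  unfolding eta_def by (auto intro!: mult_nonneg_nonpos simp: log_le_zero_cancel_iff)

lemma eta_zero [simp]: "eta 0 = 0"
  unfolding eta_def by auto

lemma eta_mult:
  assumes "0 \<le> x" "0 \<le> y"
  shows "eta (x * y) = y * eta x + x * eta y"
proof (cases "x = 0 \<or> y = 0")
  case False
  hence "x > 0" "y > 0" using assms by auto
  thus ?thesis by (auto simp: eta_def log_mult algebra_simps mult_le_0_iff)
qed auto

text \<open>The graph of the concave function \<open>eta\<close> lies below its tangent at y, whose
  slope is -(log 2 y + 1 / ln 2). For x > 0 this is ln t \<le> t - 1 at t = y / x.\<close>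

lemma eta_tangent:
  assumes "0 \<le> x" "0 < y"
  shows "eta x \<le> eta y - (log 2 y + 1 / ln 2) * (x - y)"
proof (cases "x = 0")
  case True
  thus ?thesis using assms by (simp add: eta_def algebra_simps)
next
  case False
  hence x: "x > 0" using assms by simp
  have "ln (y / x) \<le> y / x - 1" using assms x by (intro ln_le_minus_one) auto
  hence "x * ln (y / x) \<le> x * (y / x - 1)" using x by (intro mult_left_mono) auto
  hence "x * (ln y - ln x) \<le> y - x" using x assms by (simp add: ln_div algebra_simps)
  hence "x * (ln y - ln x) / ln 2 \<le> (y - x) / ln 2" by (intro divide_right_mono) auto
  thus ?thesis using x assms
    by (simp add: eta_def log_def algebra_simps diff_divide_distrib add_divide_distrib)
qed

text \<open>Average the tangent inequalities taken at the weighted mean y. At y = 0 there is no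
  tangent, but there every product w k * x k vanishes and both sides are 0.\<close>

lemma eta_jensen:
  assumes fin: "finite S" and w: "\<And>k. k \<in> S \<Longrightarrow> 0 \<le> w k" "(\<Sum>k\<in>S. w k) = 1"
    and x: "\<And>k. k \<in> S \<Longrightarrow> 0 \<le> x k"
  shows "(\<Sum>k\<in>S. w k * eta (x k)) \<le> eta (\<Sum>k\<in>S. w k * x k)"
proof -
  define y where "y = (\<Sum>k\<in>S. w k * x k)"
  have y0: "y \<ge> 0" unfolding y_def using w x by (intro sum_nonneg) auto
  show ?thesis
  proof (cases "y = 0")
    case True
    hence "\<forall>k\<in>S. w k * x k = 0"
      unfolding y_def using fin w x by (subst (asm) sum_nonneg_eq_0_iff) auto
    hence "(\<Sum>k\<in>S. w k * eta (x k)) = 0" by (intro sum.neutral) auto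
    thus ?thesis using True unfolding y_def by simp
  next
    case False
    hence y: "y > 0" using y0 by simp
    define c where "c = log 2 y + 1 / ln 2"
    have "(\<Sum>k\<in>S. w k * eta (x k)) \<le> (\<Sum>k\<in>S. w k * (eta y - c * (x k - y)))"
      unfolding c_def using w x y by (intro sum_mono mult_left_mono eta_tangent) auto
    also have "\<dots> = (eta y + c * y) * (\<Sum>k\<in>S. w k) - c * (\<Sum>k\<in>S. w k * x k)"
      unfolding sum_distrib_left sum_subtractf[symmetric]
      by (intro sum.cong refl) (simp add: algebra_simps)
    also have "\<dots> = eta y" unfolding w(2) y_def[symmetric] by simp
    finally show ?thesis unfolding y_def .
  qed
qed

text \<open>The diagonal of A in the basis W is the spectrum averaged by the doubly stochastic
  overlaps p. One family of sums spreads each \<open>eta (f l)\<close> over i, the other supplies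
  the weights for Jensen.\<close>

lemma vn_entropy_le_diagonal:
  assumes A: "psd n A" and W: "unitary_mat n W"
  shows "vn_entropy A \<le> (\<Sum>i<n. eta (Re (qform n A (\<lambda>j. W $$ (j,i)))))"
proof -
  obtain U f where S: "spectral n A U f" and f: "\<And>k. k < n \<Longrightarrow> 0 \<le> f k" using psd_spectral[OF A] by blast
  define p where "p l i = (cmod (\<Sum>j<n. cnj (U $$ (j,l)) * W $$ (j,i)))\<^sup>2" for l i
  note ov = unitary_overlap_sums[OF spectralD(1)[OF S] W, folded p_def]
  have "vn_entropy A = (\<Sum>l<n. (\<Sum>i<n. p l i) * eta (f l))"
    unfolding vn_entropy_spectral[OF S] using ov(2) by simp
  also have "\<dots> = (\<Sum>i<n. \<Sum>l<n. p l i * eta (f l))"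
    unfolding sum_distrib_right by (rule sum.swap)
  also have "\<dots> \<le> (\<Sum>i<n. eta (\<Sum>l<n. p l i * f l))"
    using ov(1) f by (intro sum_mono eta_jensen) (auto simp: p_def)
  also have "\<dots> = (\<Sum>i<n. eta (Re (qform n A (\<lambda>j. W $$ (j,i)))))"
    unfolding qform_spectral[OF S] p_def by (simp add: mult.commute)
  finally show ?thesis .
qed

lemma qform_combination:
  assumes "A \<in> carrier_mat n n" "B \<in> carrier_mat n n"
  shows "qform n (of_real s \<cdot>\<^sub>m A + of_real t \<cdot>\<^sub>m B) v = of_real s * qform n A v + of_real t * qform n B v"
proof -
  have "(of_real s \<cdot>\<^sub>m A + of_real t \<cdot>\<^sub>m B) $$ (i,j) = of_real s * A $$ (i,j) + of_real t * B $$ (i,j)"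
    if "i < n" "j < n" for i j
    using assms that by auto
  thus ?thesis unfolding qform_def sum_distrib_left sum.distrib[symmetric]
    by (intro sum.cong refl) (simp add: ring_distribs mult.left_commute)
qed

lemma psd_combination:
  assumes "psd n A" "psd n B" "0 \<le> s" "0 \<le> t"
  shows "psd n (of_real s \<cdot>\<^sub>m A + of_real t \<cdot>\<^sub>m B)"
proof -
  have "0 \<le> complex_of_real s * qform n A v + of_real t * qform n B v" for v
    using psdD(2)[OF assms(1), of v] psdD(2)[OF assms(2), of v] assms(3,4)
    by (intro add_nonneg_nonneg mult_nonneg_nonneg) (auto simp: less_eq_complex_def)
  thus ?thesis unfolding psd_qform_iff
    using psdD(1)[OF assms(1)] psdD(1)[OF assms(2)] by (auto simp: qform_combination)
qed

text \<open>Measure both A and B in an eigenbasis W of the mixture. This cannot lower their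
  entropies, and the two diagonals mix exactly to the spectrum of the mixture, so scalar concavity
  finishes.\<close>

theorem vn_entropy_concave:
  assumes A: "psd n A" and B: "psd n B" and st: "0 \<le> s" "0 \<le> t" "s + t = 1"
  shows "s * vn_entropy A + t * vn_entropy B \<le> vn_entropy (of_real s \<cdot>\<^sub>m A + of_real t \<cdot>\<^sub>m B)"
proof -
  let ?C = "of_real s \<cdot>\<^sub>m A + of_real t \<cdot>\<^sub>m B"
  note c = psdD(1)[OF A] psdD(1)[OF B]
  obtain W h where S: "spectral n ?C W h" using psd_spectral[OF psd_combination[OF A B st(1,2)]] by metis
  note W = spectralD(1)[OF S]
  define a where "a i = Re (qform n A (\<lambda>j. W $$ (j,i)))" for i
  define b where "b i = Re (qform n B (\<lambda>j. W $$ (j,i)))" for i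
  have ab: "0 \<le> a i" "0 \<le> b i" for i
    using psdD(2)[OF A] psdD(2)[OF B] unfolding a_def b_def by (auto simp: less_eq_complex_def)
  have h: "h i = s * a i + t * b i" if "i < n" for i
    using arg_cong[OF qform_spectral_column[OF S that], of Re]
    unfolding qform_combination[OF c] a_def b_def by simp
  \<comment> \<open>Two-point Jensen, with the Booleans as index set.\<close>
  have j: "s * eta x + t * eta y \<le> eta (s * x + t * y)" if "0 \<le> x" "0 \<le> y" for x y
    using eta_jensen[of "{False, True}" "\<lambda>q. if q then t else s" "\<lambda>q. if q then y else x"] st that by simp
  have "s * vn_entropy A + t * vn_entropy B \<le> s * (\<Sum>i<n. eta (a i)) + t * (\<Sum>i<n. eta (b i))"
    using vn_entropy_le_diagonal[OF A W] vn_entropy_le_diagonal[OF B W] st unfolding a_def b_def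
    by (intro add_mono mult_left_mono) auto
  also have "\<dots> = (\<Sum>i<n. s * eta (a i) + t * eta (b i))"
    by (simp add: sum.distrib sum_distrib_left)
  also have "\<dots> \<le> (\<Sum>i<n. eta (s * a i + t * b i))"
    by (intro sum_mono j ab)
  also have "\<dots> = vn_entropy ?C" unfolding vn_entropy_spectral[OF S] using h by simp
  finally show ?thesis .
qed

section \<open>Tensor products and entropy bounds\<close>

lemma sum_index_pair:
  fixes F :: "nat \<Rightarrow> nat \<Rightarrow> 'a::comm_monoid_add"
  shows "(\<Sum>k<n * m. F (k div m) (k mod m)) = (\<Sum>i<n. \<Sum>j<m. F i j)"
  unfolding sum_mult_split by (intro sum.cong refl) auto

lemma mtensor_carrier [simp]:
  "A \<in> carrier_mat a b \<Longrightarrow> B \<in> carrier_mat c d \<Longrightarrow> mtensor A B \<in> carrier_mat (a * c) (b * d)"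
  by (intro carrier_matI) (simp_all add: mtensor_def carrier_matD)

lemma index_mtensor:
  assumes "A \<in> carrier_mat a b" "B \<in> carrier_mat c d" "i < a * c" "j < b * d"
  shows "mtensor A B $$ (i,j) = A $$ (i div c, j div d) * B $$ (i mod c, j mod d)"
proof -
  have "dim_row A = a" "dim_col A = b" "dim_row B = c" "dim_col B = d" using assms by auto
  thus ?thesis using assms(3,4) unfolding mtensor_def by simp
qed

text \<open>Products of eigenvectors are eigenvectors of the tensor product; each sum over composite
  indices factors into a sum over quotients times a sum over remainders.\<close>

lemma spectral_mtensor:
  assumes A: "spectral n A U f" and B: "spectral m B V g"
  shows "spectral (n * m) (mtensor A B) (mtensor U V) (\<lambda>k. f (k div m) * g (k mod m))"
proof -
  note A' = spectralD[OF A] and B' = spectralD[OF B]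
  have c: "U \<in> carrier_mat n n" "V \<in> carrier_mat m m" using A' B' unitary_matD by auto
  note ixU = index_mtensor[OF c] and ixA = index_mtensor[OF A'(2) B'(2)]
  have "unitary_mat (n * m) (mtensor U V)"
  proof (rule unitary_matI)
    fix x y assume xy: "x < n * m" "y < n * m"
    note x = index_pair_div_mod[OF xy(1)] and y = index_pair_div_mod[OF xy(2)]
    have "(\<Sum>k<n * m. cnj (mtensor U V $$ (k,x)) * mtensor U V $$ (k,y))
        = (\<Sum>k<n * m. (cnj (U $$ (k div m, x div m)) * U $$ (k div m, y div m)) *
            (cnj (V $$ (k mod m, x mod m)) * V $$ (k mod m, y mod m)))"
      using xy by (intro sum.cong refl) (simp add: ixU)
    also have "\<dots> = (\<Sum>i<n. cnj (U $$ (i, x div m)) * U $$ (i, y div m)) *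
        (\<Sum>j<m. cnj (V $$ (j, x mod m)) * V $$ (j, y mod m))"
      unfolding sum_product by (rule sum_index_pair)
    also have "\<dots> = (if x = y then 1 else 0)"
      unfolding unitary_mat_cols[OF A'(1) x(1) y(1)] unitary_mat_cols[OF B'(1) x(2) y(2)]
      by (auto, metis div_mult_mod_eq)
    finally show "(\<Sum>k<n * m. cnj (mtensor U V $$ (k,x)) * mtensor U V $$ (k,y)) = (if x = y then 1 else 0)" .
  qed (use c in simp)
  moreover have "mtensor A B $$ (x,y) = (\<Sum>k<n * m. mtensor U V $$ (x,k) *
      of_real (f (k div m) * g (k mod m)) * cnj (mtensor U V $$ (y,k)))"
    if xy: "x < n * m" "y < n * m" for x y
  proof -
    note x = index_pair_div_mod[OF xy(1)] and y = index_pair_div_mod[OF xy(2)]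
    have "(\<Sum>k<n * m. mtensor U V $$ (x,k) * of_real (f (k div m) * g (k mod m)) * cnj (mtensor U V $$ (y,k)))
        = (\<Sum>k<n * m. (U $$ (x div m, k div m) * of_real (f (k div m)) * cnj (U $$ (y div m, k div m))) *
           (V $$ (x mod m, k mod m) * of_real (g (k mod m)) * cnj (V $$ (y mod m, k mod m))))"
      using xy by (intro sum.cong refl) (simp add: ixU)
    also have "\<dots> = (\<Sum>i<n. U $$ (x div m, i) * of_real (f i) * cnj (U $$ (y div m, i))) *
       (\<Sum>j<m. V $$ (x mod m, j) * of_real (g j) * cnj (V $$ (y mod m, j)))"
      unfolding sum_product by (rule sum_index_pair)
    also have "\<dots> = mtensor A B $$ (x,y)"
      unfolding ixA[OF xy] A'(3)[OF x(1) y(1)] B'(3)[OF x(2) y(2)] ..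
    finally show ?thesis by simp
  qed
  ultimately show ?thesis unfolding spectral_def using A' B' by simp
qed

lemma psd_mtensor:
  assumes "psd n A" "psd m B"
  shows "psd (n * m) (mtensor A B)"
proof -
  obtain U f where S: "spectral n A U f" and f: "\<forall>k<n. 0 \<le> f k" using psd_spectral[OF assms(1)] by blast
  obtain V g where T: "spectral m B V g" and g: "\<forall>k<m. 0 \<le> g k" using psd_spectral[OF assms(2)] by blast
  show ?thesis
    by (rule spectral_psd[OF spectral_mtensor[OF S T]]) (use f g index_pair_div_mod in auto)
qed

lemma mtrace_mtensor:
  assumes "A \<in> carrier_mat n n" "B \<in> carrier_mat m m"
  shows "mtrace (mtensor A B) = mtrace A * mtrace B"
proof -
  have "mtrace (mtensor A B) = (\<Sum>k<n * m. A $$ (k div m, k div m) * B $$ (k mod m, k mod m))"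
    unfolding mtrace_def using mtensor_carrier[OF assms] by (simp add: index_mtensor[OF assms])
  also have "\<dots> = (\<Sum>i<n. \<Sum>j<m. A $$ (i,i) * B $$ (j,j))" by (rule sum_index_pair)
  finally show ?thesis using assms by (simp add: mtrace_def sum_product)
qed

lemma density_psd: "density n A \<Longrightarrow> psd n A"
  and density_carrier: "density n A \<Longrightarrow> A \<in> carrier_mat n n"
  unfolding density_def psd_def by auto

lemma density_mtensor:
  assumes "density n A" "density m B"
  shows "density (n * m) (mtensor A B)"
  using psd_mtensor[OF density_psd[OF assms(1)] density_psd[OF assms(2)]]
    mtrace_mtensor[OF density_carrier[OF assms(1)] density_carrier[OF assms(2)]] assms
  unfolding density_def by simp

lemma density_spectral:
  assumes "density n A"
  shows "\<exists>U f. spectral n A U f \<and> (\<forall>k<n. 0 \<le> f k) \<and> (\<Sum>k<n. f k) = 1"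
proof -
  obtain U f where S: "spectral n A U f" "\<forall>k<n. 0 \<le> f k"
    using psd_spectral[OF density_psd[OF assms]] by blast
  have "complex_of_real (\<Sum>k<n. f k) = of_real 1"
    using spectral_trace[OF S(1)] assms by (simp add: density_def)
  hence "(\<Sum>k<n. f k) = 1" by (simp only: of_real_eq_iff)
  thus ?thesis using S by blast
qed

text \<open>By the Leibniz rule \<open>eta_mult\<close>, each entropy appears multiplied by the
  trace of the other state, which is 1.\<close>

theorem vn_entropy_mtensor:
  assumes "density n A" "density m B"
  shows "vn_entropy (mtensor A B) = vn_entropy A + vn_entropy B"
proof -
  obtain U f where S: "spectral n A U f" and f: "\<forall>k<n. 0 \<le> f k" "(\<Sum>k<n. f k) = 1"
    using density_spectral[OF assms(1)] by blast
  obtain V g where T: "spectral m B V g" and g: "\<forall>k<m. 0 \<le> g k" "(\<Sum>k<m. g k) = 1"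
    using density_spectral[OF assms(2)] by blast
  have "vn_entropy (mtensor A B) = (\<Sum>i<n. \<Sum>j<m. eta (f i * g j))"
    unfolding vn_entropy_spectral[OF spectral_mtensor[OF S T]] by (rule sum_index_pair)
  also have "\<dots> = (\<Sum>i<n. \<Sum>j<m. g j * eta (f i) + f i * eta (g j))"
    using f g by (intro sum.cong refl eta_mult) auto
  also have "\<dots> = (\<Sum>j<m. g j) * (\<Sum>i<n. eta (f i)) + (\<Sum>i<n. f i) * (\<Sum>j<m. eta (g j))"
    by (simp add: sum.distrib sum_product sum.swap[of _ "{..<n}" "{..<m}"])
  finally show ?thesis using f g vn_entropy_spectral[OF S] vn_entropy_spectral[OF T] by simp
qed

lemma vn_entropy_density_nonneg:
  assumes "density n A"
  shows "0 \<le> vn_entropy A"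
proof -
  obtain U f where S: "spectral n A U f" and f: "\<forall>k<n. 0 \<le> f k" "(\<Sum>k<n. f k) = 1"
    using density_spectral[OF assms(1)] by blast
  have "f k \<le> 1" if "k < n" for k
    using member_le_sum[of k "{..<n}" f] f that by simp
  thus ?thesis unfolding vn_entropy_spectral[OF S] by (intro sum_nonneg eta_nonneg) auto
qed

text \<open>Jensen with uniform weights: the eigenvalues have mean 1/n, and \<open>eta (1/n)\<close>
  equals log 2 n / n.\<close>

lemma vn_entropy_density_le:
  assumes "density n A"
  shows "vn_entropy A \<le> log 2 n"
proof -
  obtain U f where S: "spectral n A U f" and f: "\<forall>k<n. 0 \<le> f k" "(\<Sum>k<n. f k) = 1"
    using density_spectral[OF assms(1)] by blast
  have n: "n > 0" using f(2) by (cases n) auto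
  have "(\<Sum>k<n. 1 / n * eta (f k)) \<le> eta (\<Sum>k<n. 1 / n * f k)"
    using f n by (intro eta_jensen) auto
  also have "\<dots> = log 2 n / n"
    using f n by (simp add: sum_divide_distrib[symmetric] eta_def log_divide)
  finally show ?thesis using n
    by (simp add: vn_entropy_spectral[OF S] sum_divide_distrib[symmetric] divide_le_cancel)
qed

lemma spectral_smult_one: "spectral n (of_real c \<cdot>\<^sub>m 1\<^sub>m n) (1\<^sub>m n) (\<lambda>_. c)"
  unfolding spectral_def
proof (intro conjI allI impI)
  have "mat_adjoint (1\<^sub>m n) = (1\<^sub>m n :: complex mat)"
    by (rule eq_matI) auto
  thus "unitary_mat n (1\<^sub>m n)" unfolding unitary_mat_def by simp
  fix i j assume ij: "i < n" "j < n"
  have "(\<Sum>k<n. 1\<^sub>m n $$ (i,k) * complex_of_real c * cnj (1\<^sub>m n $$ (j,k)))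
      = (\<Sum>k<n. if k = i then (if i = j then of_real c else 0) else 0)"
    using ij by (intro sum.cong refl) auto
  thus "(complex_of_real c \<cdot>\<^sub>m 1\<^sub>m n) $$ (i,j)
      = (\<Sum>k<n. 1\<^sub>m n $$ (i,k) * complex_of_real c * cnj (1\<^sub>m n $$ (j,k)))"
    using ij by simp
qed simp

lemma maximally_mixed:
  assumes "0 < b"
  shows "density b (of_real (1 / real b) \<cdot>\<^sub>m 1\<^sub>m b)"
    and "vn_entropy (of_real (1 / real b) \<cdot>\<^sub>m 1\<^sub>m b) = log 2 b"
proof -
  note S = spectral_smult_one[of b "1 / real b"]
  show "density b (of_real (1 / real b) \<cdot>\<^sub>m 1\<^sub>m b)"
    unfolding density_def using spectral_psd[OF S] spectral_trace[OF S] assms by simp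
  show "vn_entropy (of_real (1 / real b) \<cdot>\<^sub>m 1\<^sub>m b) = log 2 b"
    unfolding vn_entropy_spectral[OF S] using assms by (simp add: eta_def log_divide)
qed

text \<open>Conjugation by a permutation matrix permutes the rows of U and keeps the eigenvalues. It
  serves to reorder tensor factors without changing the entropy.\<close>

lemma spectral_reindex:
  assumes S: "spectral N A U f" and \<pi>: "bij_betw \<pi> {..<N} {..<N}"
  shows "spectral N (mat N N (\<lambda>(i,j). A $$ (\<pi> i, \<pi> j))) (mat N N (\<lambda>(i,k). U $$ (\<pi> i, k))) f"
proof -
  have lt: "\<pi> i < N" if "i < N" for i using bij_betwE[OF \<pi>] that by auto
  have "unitary_mat N (mat N N (\<lambda>(i,k). U $$ (\<pi> i, k)))"
  proof (rule unitary_matI)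
    fix i j assume ij: "i < N" "j < N"
    have "(\<Sum>k<N. cnj (mat N N (\<lambda>(i,k). U $$ (\<pi> i, k)) $$ (k,i)) * mat N N (\<lambda>(i,k). U $$ (\<pi> i, k)) $$ (k,j))
        = (\<Sum>k<N. cnj (U $$ (\<pi> k,i)) * U $$ (\<pi> k,j))"
      using ij by (intro sum.cong) auto
    also have "\<dots> = (\<Sum>k<N. cnj (U $$ (k,i)) * U $$ (k,j))"
      by (rule sum.reindex_bij_betw[OF \<pi>])
    finally show "(\<Sum>k<N. cnj (mat N N (\<lambda>(i,k). U $$ (\<pi> i, k)) $$ (k,i)) *
        mat N N (\<lambda>(i,k). U $$ (\<pi> i, k)) $$ (k,j)) = (if i = j then 1 else 0)"
      using unitary_mat_cols[OF spectralD(1)[OF S] ij] by simp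
  qed simp
  thus ?thesis unfolding spectral_def using spectralD(3)[OF S] lt by auto
qed

section \<open>A lower bound on output entropies that is uniform over all input states\<close>

lemma unitary_mat_entry_le:
  assumes U: "unitary_mat n U" and ij: "i < n" "j < n"
  shows "cmod (U $$ (i,j)) \<le> 1"
proof -
  have "(cmod (U $$ (i,j)))\<^sup>2 \<le> (\<Sum>k<n. (cmod (U $$ (i,k)))\<^sup>2)"
    using ij by (intro member_le_sum) auto
  thus ?thesis using unitary_mat_cmod_rows_cols(2)[OF U ij(1)] by (simp add: power_le_one_iff)
qed

text \<open>Each entry is a combination of products of unitary entries, of modulus at most 1, with
  the eigenvalues as weights, and these sum to 1.\<close>

lemma density_entry_le:
  assumes A: "density n A" and ij: "i < n" "j < n"
  shows "cmod (A $$ (i,j)) \<le> 1"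
proof -
  obtain U f where S: "spectral n A U f" and f: "\<forall>k<n. 0 \<le> f k" "(\<Sum>k<n. f k) = 1"
    using density_spectral[OF A] by blast
  note U = unitary_mat_entry_le[OF spectralD(1)[OF S]]
  have "cmod (A $$ (i,j)) \<le> (\<Sum>k<n. cmod (U $$ (i,k) * of_real (f k) * cnj (U $$ (j,k))))"
    unfolding spectralD(3)[OF S ij] by (rule norm_sum)
  also have "\<dots> \<le> (\<Sum>k<n. f k)"
  proof (rule sum_mono)
    fix k assume "k \<in> {..<n}"
    hence k: "k < n" by simp
    have "cmod (U $$ (i,k)) * f k * cmod (U $$ (j,k)) \<le> 1 * f k * 1"
      using U[OF ij(1) k] U[OF ij(2) k] f k by (intro mult_mono) auto
    thus "cmod (U $$ (i,k) * of_real (f k) * cnj (U $$ (j,k))) \<le> f k"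
      using f k by (simp add: norm_mult)
  qed
  finally show ?thesis using f by simp
qed

text \<open>For x > 0 this follows from ln x \<le> x. Unlike \<open>eta_nonneg\<close> it allows x >
  1, so it fits spectra that are not known to be probability vectors.\<close>

lemma eta_lower_bound: "- (x\<^sup>2 / ln 2) \<le> eta x"
proof (cases "x \<le> 0")
  case True
  thus ?thesis by (simp add: eta_def)
next
  case False
  hence "x * ln x \<le> x * x" using ln_le_minus_one[of x] by (intro mult_left_mono) auto
  thus ?thesis using False by (simp add: eta_def log_def power2_eq_square divide_right_mono)
qed

text \<open>On a matrix without a unitary diagonalisation, \<^const>\<open>vn_entropy\<close> is the constant
  junk value \<open>THE s. False\<close>; hence the bound holds without any normality assumption.\<close>

lemma vn_entropy_lower_bound:
  assumes A: "A \<in> carrier_mat n n"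
    and C: "(\<Sum>i<n. \<Sum>j<n. cmod (A $$ (i,j))) \<le> C"
  shows "min (THE s. False) (- (real n * (C\<^sup>2 / ln 2))) \<le> vn_entropy A"
proof (cases "\<exists>U D. unitary_mat n U \<and> D \<in> carrier_mat n n \<and> diagonal_mat D \<and> A = U * D * mat_adjoint U")
  case False
  hence "vn_entropy A = (THE s. False)" unfolding vn_entropy_def using A by (intro arg_cong[of _ _ The]) auto
  thus ?thesis by simp
next
  case True
  then obtain U D where U: "unitary_mat n U" and D: "D \<in> carrier_mat n n" "diagonal_mat D"
      and AD: "A = U * D * mat_adjoint U" by blast
  note Uc = unitary_matD[OF U]
  have aU: "mat_adjoint U \<in> carrier_mat n n" using Uc by simp
  have "mat_adjoint U * A * U = (mat_adjoint U * U) * D * (mat_adjoint U * U)"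
    unfolding AD
    by (simp only: assoc_mult_mat[of _ n n _ n _ n] mult_carrier_mat[of _ n n _ n] Uc(1) aU D(1))
  \<comment> \<open>Solving for D expresses each eigenvalue through the entries of A with
    coefficients of modulus at most 1, hence bounds it by C.\<close>
  hence DA: "D = mat_adjoint U * A * U" using Uc D by simp
  have "cmod (D $$ (k,k)) \<le> C" if k: "k < n" for k
  proof -
    have "D $$ (k,k) = (\<Sum>i<n. \<Sum>j<n. mat_adjoint U $$ (k,i) * A $$ (i,j) * U $$ (j,k))"
      by (subst DA, rule index_mult3_sum[OF aU A Uc(1) k k])
    also have "cmod \<dots> \<le> (\<Sum>i<n. \<Sum>j<n. cmod (mat_adjoint U $$ (k,i) * A $$ (i,j) * U $$ (j,k)))"
      by (intro order.trans[OF norm_sum] sum_mono norm_sum)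
    also have "\<dots> \<le> (\<Sum>i<n. \<Sum>j<n. cmod (A $$ (i,j)))"
    proof (intro sum_mono)
      fix i j assume "i \<in> {..<n}" "j \<in> {..<n}"
      hence ij: "i < n" "j < n" by auto
      have "cmod (U $$ (i,k)) * cmod (A $$ (i,j)) * cmod (U $$ (j,k)) \<le> 1 * cmod (A $$ (i,j)) * 1"
        using unitary_mat_entry_le[OF U] ij k by (intro mult_mono) auto
      thus "cmod (mat_adjoint U $$ (k,i) * A $$ (i,j) * U $$ (j,k)) \<le> cmod (A $$ (i,j))"
        using Uc ij k by (simp add: norm_mult)
    qed
    finally show ?thesis using C by simp
  qed
  hence Re: "\<bar>Re (D $$ (k,k))\<bar> \<le> C" if "k < n" for k
    using that abs_Re_le_cmod[of "D $$ (k,k)"] by (meson order.trans)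
  have "(\<Sum>k<n. - (C\<^sup>2 / ln 2)) \<le> (\<Sum>k<n. eta (Re (D $$ (k,k))))"
  proof (rule sum_mono)
    fix k assume "k \<in> {..<n}"
    hence "(Re (D $$ (k,k)))\<^sup>2 \<le> C\<^sup>2" using Re[of k] power_mono[of "\<bar>Re (D $$ (k,k))\<bar>" C 2] by simp
    hence "(Re (D $$ (k,k)))\<^sup>2 / ln 2 \<le> C\<^sup>2 / ln 2" by (intro divide_right_mono) auto
    thus "- (C\<^sup>2 / ln 2) \<le> eta (Re (D $$ (k,k)))"
      using eta_lower_bound[of "Re (D $$ (k,k))"] by simp
  qed
  thus ?thesis using vn_entropy_unitary_diag[OF U D AD] by simp
qed

lemma chan_tensor_carrier [simp]: "chan_tensor n1 m1 n2 m2 \<Phi> \<Psi> X \<in> carrier_mat (m1 * m2) (m1 * m2)"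
  unfolding chan_tensor_def by simp

text \<open>The output entries are linear in \<rho> with fixed coefficients G, and the entries of a
  state are bounded by 1, so the outputs are uniformly bounded. The maps are arbitrary here, so that
  the lemma applies directly to the approximation tensored with \<Psi>.\<close>

lemma bdd_below_vn_entropy_chan_tensor:
  "bdd_below {vn_entropy (chan_tensor n1 m1 n2 m2 \<Phi> \<Psi> \<rho>) | \<rho>. density (n1 * n2) \<rho>}"
proof -
  define G where "G i j p q = \<Phi> (unit_mat n1 (i div n2) (j div n2)) $$ (p div m2, q div m2)
        * \<Psi> (unit_mat n2 (i mod n2) (j mod n2)) $$ (p mod m2, q mod m2)" for i j p q
  define C where "C = (\<Sum>p<m1 * m2. \<Sum>q<m1 * m2. \<Sum>i<n1 * n2. \<Sum>j<n1 * n2. cmod (G i j p q))"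
  have "(\<Sum>p<m1 * m2. \<Sum>q<m1 * m2. cmod (chan_tensor n1 m1 n2 m2 \<Phi> \<Psi> \<rho> $$ (p,q))) \<le> C"
    if \<rho>: "density (n1 * n2) \<rho>" for \<rho>
    unfolding C_def
  proof (intro sum_mono)
    fix p q assume "p \<in> {..<m1 * m2}" "q \<in> {..<m1 * m2}"
    hence "chan_tensor n1 m1 n2 m2 \<Phi> \<Psi> \<rho> $$ (p,q) = (\<Sum>i<n1 * n2. \<Sum>j<n1 * n2. \<rho> $$ (i,j) * G i j p q)"
      unfolding chan_tensor_def G_def by (simp add: mult.assoc)
    also have "cmod \<dots> \<le> (\<Sum>i<n1 * n2. \<Sum>j<n1 * n2. cmod (\<rho> $$ (i,j) * G i j p q))"
      by (intro order.trans[OF norm_sum] sum_mono norm_sum)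
    also have "\<dots> \<le> (\<Sum>i<n1 * n2. \<Sum>j<n1 * n2. cmod (G i j p q))"
      using density_entry_le[OF \<rho>] by (intro sum_mono) (auto simp: norm_mult intro!: mult_left_le_one_le)
    finally show "cmod (chan_tensor n1 m1 n2 m2 \<Phi> \<Psi> \<rho> $$ (p,q)) \<le> (\<Sum>i<n1 * n2. \<Sum>j<n1 * n2. cmod (G i j p q))" .
  qed
  thus ?thesis using vn_entropy_lower_bound[OF chan_tensor_carrier] by (intro bdd_belowI) blast
qed

section \<open>Channels and Kraus operators\<close>

lemma sum_sum_delta:
  fixes F :: "nat \<Rightarrow> nat \<Rightarrow> 'a::comm_monoid_add"
  assumes "a < n" "c < m"
  shows "(\<Sum>i<n. \<Sum>j<m. if i = a \<and> j = c then F i j else 0) = F a c"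
proof -
  have "(\<Sum>j<m. if i = a \<and> j = c then F i j else 0) = (if i = a then F i c else 0)" for i
    using assms(2) by (cases "i = a") auto
  thus ?thesis using assms(1) by simp
qed

lemma unit_mat_carrier [simp]: "unit_mat n a b \<in> carrier_mat n n"
  unfolding unit_mat_def by simp

lemma index_unit_mat [simp]:
  "i < n \<Longrightarrow> j < n \<Longrightarrow> unit_mat n a b $$ (i,j) = (if i = a \<and> j = b then 1 else 0)"
  unfolding unit_mat_def by simp

lemma mtrace_unit_mat:
  assumes "a < n" "c < n"
  shows "mtrace (unit_mat n a c) = (if a = c then 1 else 0)"
proof -
  have "mtrace (unit_mat n a c) = (\<Sum>i<n. if i = a then (if a = c then 1 else 0) else 0)"
    unfolding mtrace_def by (intro sum.cong) (auto simp: unit_mat_def)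
  thus ?thesis using assms by simp
qed

lemma channelD:
  assumes "is_channel n m \<Phi>"
  shows "X \<in> carrier_mat n n \<Longrightarrow> \<Phi> X \<in> carrier_mat m m"
    and "X \<in> carrier_mat n n \<Longrightarrow> Y \<in> carrier_mat n n \<Longrightarrow> \<Phi> (X + Y) = \<Phi> X + \<Phi> Y"
    and "X \<in> carrier_mat n n \<Longrightarrow> \<Phi> (c \<cdot>\<^sub>m X) = c \<cdot>\<^sub>m \<Phi> X"
    and "X \<in> carrier_mat n n \<Longrightarrow> mtrace (\<Phi> X) = mtrace X"
    and "psd (k * n) Z \<Longrightarrow> psd (k * m) (chan_tensor k k n m (\<lambda>Z. Z) \<Phi> Z)"
  using assms unfolding is_channel_def by blast+

text \<open>Only binary additivity and homogeneity are given, so the matrix is built up one entry at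
  a time: \<open>M S\<close> keeps the entries of X at the positions in S.\<close>

lemma channel_expand:
  assumes \<Phi>: "is_channel n m \<Phi>" and X: "X \<in> carrier_mat n n" and pq: "p < m" "q < m"
  shows "\<Phi> X $$ (p,q) = (\<Sum>a<n. \<Sum>c<n. X $$ (a,c) * \<Phi> (unit_mat n a c) $$ (p,q))"
proof -
  note ch = channelD[OF \<Phi>]
  define M where "M S = mat n n (\<lambda>ij. if ij \<in> S then X $$ ij else 0)" for S
  have Mc: "M S \<in> carrier_mat n n" for S unfolding M_def by simp
  have "\<Phi> (M S) $$ (p,q) = (\<Sum>(a,c)\<in>S. X $$ (a,c) * \<Phi> (unit_mat n a c) $$ (p,q))"
    if "finite S" "S \<subseteq> {..<n} \<times> {..<n}" for S
    using that
  proof (induction S)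
    case empty
    \<comment> \<open>The zero matrix is 0 times itself, so homogeneity sends it to zero.\<close>
    have "M {} = 0 \<cdot>\<^sub>m M {}" by (rule eq_matI) (auto simp: M_def)
    hence "\<Phi> (M {}) = 0 \<cdot>\<^sub>m \<Phi> (M {})" using ch(3)[OF Mc, of 0 "{}"] by simp
    hence "\<Phi> (M {}) $$ (p,q) = (0 \<cdot>\<^sub>m \<Phi> (M {})) $$ (p,q)" by simp
    thus ?case using ch(1)[OF Mc[of "{}"]] pq by simp
  next
    case (insert ac S)
    obtain a c where ac: "ac = (a,c)" by (cases ac)
    have lt: "a < n" "c < n" using insert.prems ac by auto
    let ?E = "X $$ (a,c) \<cdot>\<^sub>m unit_mat n a c"
    have "M (insert ac S) = ?E + M S"
      using insert.hyps(2) unfolding ac by (intro eq_matI) (auto simp: M_def unit_mat_def)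
    moreover have "?E \<in> carrier_mat n n" by simp
    ultimately have "\<Phi> (M (insert ac S)) = X $$ (a,c) \<cdot>\<^sub>m \<Phi> (unit_mat n a c) + \<Phi> (M S)"
      using ch(2)[OF _ Mc, of ?E S] ch(3)[of "unit_mat n a c" "X $$ (a,c)"] by simp
    hence "\<Phi> (M (insert ac S)) $$ (p,q) = X $$ (a,c) * \<Phi> (unit_mat n a c) $$ (p,q) + \<Phi> (M S) $$ (p,q)"
      using ch(1)[OF Mc[of S]] ch(1)[of "unit_mat n a c"] pq by simp
    thus ?case using insert unfolding ac by simp
  qed
  from this[of "{..<n} \<times> {..<n}"]
  have "\<Phi> (M ({..<n} \<times> {..<n})) $$ (p,q) = (\<Sum>a<n. \<Sum>c<n. X $$ (a,c) * \<Phi> (unit_mat n a c) $$ (p,q))"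
    by (simp add: sum.cartesian_product)
  moreover have "M ({..<n} \<times> {..<n}) = X"
    using X by (intro eq_matI) (auto simp: M_def)
  ultimately show ?thesis by simp
qed

text \<open>\<open>K \<beta> p a\<close> is the entry (p,a) of the Kraus operator with number
  \<beta>. By linearity it is enough to record the Kraus sum on matrix units.\<close>

definition kraus_form :: "nat \<Rightarrow> nat \<Rightarrow> (complex mat \<Rightarrow> complex mat) \<Rightarrow> nat
    \<Rightarrow> (nat \<Rightarrow> nat \<Rightarrow> nat \<Rightarrow> complex) \<Rightarrow> bool" where
  "kraus_form n m \<Phi> r K \<longleftrightarrow> (\<forall>a<n. \<forall>c<n. \<forall>p<m. \<forall>q<m.
     \<Phi> (unit_mat n a c) $$ (p,q) = (\<Sum>\<beta><r. K \<beta> p a * cnj (K \<beta> q c)))"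

text \<open>C is the Choi matrix. Its positivity is complete positivity of \<Phi> with a reference
  space of dimension n, applied to an unnormalised maximally entangled state.\<close>

lemma choi_psd:
  assumes \<Phi>: "is_channel n m \<Phi>"
  shows "\<exists>C. psd (n * m) C \<and> (\<forall>a<n. \<forall>c<n. \<forall>p<m. \<forall>q<m.
    C $$ (a * m + p, c * m + q) = \<Phi> (unit_mat n a c) $$ (p,q))"
proof -
  \<comment> \<open>\<Omega> has rank one and belongs to the vector summing all e_a \<otimes> e_a; a
    composite index lies in its support exactly when quotient and remainder agree.\<close>
  define \<Omega> where "\<Omega> = mat (n * n) (n * n) (\<lambda>(i,j).
    if i div n = i mod n \<and> j div n = j mod n then 1 else 0 :: complex)"
  have "psd (n * n) \<Omega>" unfolding psd_qform_iff
  proof (intro conjI allI)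
    fix v :: "nat \<Rightarrow> complex"
    define z where "z = (\<Sum>i<n * n. if i div n = i mod n then v i else 0)"
    have "qform (n * n) \<Omega> v = (\<Sum>i<n * n. \<Sum>j<n * n.
        cnj (if i div n = i mod n then v i else 0) * (if j div n = j mod n then v j else 0))"
      unfolding qform_def \<Omega>_def by (intro sum.cong refl) auto
    also have "\<dots> = cnj z * z" unfolding z_def cnj_sum sum_product ..
    finally show "0 \<le> qform (n * n) \<Omega> v" by (simp add: less_eq_complex_def)
  qed (simp add: \<Omega>_def)
  hence "psd (n * m) (chan_tensor n n n m (\<lambda>Z. Z) \<Phi> \<Omega>)" by (rule channelD(5)[OF \<Phi>])
  moreover have "chan_tensor n n n m (\<lambda>Z. Z) \<Phi> \<Omega> $$ (a * m + p, c * m + q) = \<Phi> (unit_mat n a c) $$ (p,q)"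
    if ac: "a < n" "c < n" and pq: "p < m" "q < m" for a c p q
  proof -
    have "chan_tensor n n n m (\<lambda>Z. Z) \<Phi> \<Omega> $$ (a * m + p, c * m + q)
        = (\<Sum>i<n * n. \<Sum>j<n * n. (if i div n = i mod n \<and> j div n = j mod n then 1 else 0)
            * (if i div n = a \<and> j div n = c then 1 else 0) * \<Phi> (unit_mat n (i mod n) (j mod n)) $$ (p,q))"
      unfolding chan_tensor_def \<Omega>_def using index_pair_less[OF ac(1) pq(1)] index_pair_less[OF ac(2) pq(2)] ac pq
      by (auto intro!: sum.cong)
    also have "\<dots> = (\<Sum>i<n * n. \<Sum>j1<n. \<Sum>j2<n. (if i div n = i mod n \<and> j1 = j2 then 1 else 0)
            * (if i div n = a \<and> j1 = c then 1 else 0) * \<Phi> (unit_mat n (i mod n) j2) $$ (p,q))"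
      by (intro sum.cong refl sum_index_pair)
    also have "\<dots> = (\<Sum>i1<n. \<Sum>i2<n. \<Sum>j1<n. \<Sum>j2<n. (if i1 = i2 \<and> j1 = j2 then 1 else 0)
            * (if i1 = a \<and> j1 = c then 1 else 0) * \<Phi> (unit_mat n i2 j2) $$ (p,q))"
      by (rule sum_index_pair)
    also have "\<dots> = (\<Sum>i1<n. \<Sum>i2<n. if i1 = a \<and> i2 = a then \<Phi> (unit_mat n a c) $$ (p,q) else 0)"
    proof (intro sum.cong refl)
      fix i1 i2
      show "(\<Sum>j1<n. \<Sum>j2<n. (if i1 = i2 \<and> j1 = j2 then 1 else 0)
            * (if i1 = a \<and> j1 = c then 1 else 0) * \<Phi> (unit_mat n i2 j2) $$ (p,q))
          = (if i1 = a \<and> i2 = a then \<Phi> (unit_mat n a c) $$ (p,q) else 0)"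
      proof (cases "i1 = a \<and> i2 = a")
        case True
        have "(\<Sum>j1<n. \<Sum>j2<n. (if i1 = i2 \<and> j1 = j2 then 1 else 0)
            * (if i1 = a \<and> j1 = c then 1 else 0) * \<Phi> (unit_mat n i2 j2) $$ (p,q))
          = (\<Sum>j1<n. \<Sum>j2<n. if j1 = c \<and> j2 = c then \<Phi> (unit_mat n a j2) $$ (p,q) else 0)"
          using True by (intro sum.cong refl) auto
        also have "\<dots> = \<Phi> (unit_mat n a c) $$ (p,q)" by (rule sum_sum_delta[OF ac(2) ac(2)])
        finally show ?thesis using True by simp
      qed (auto intro!: sum.neutral)
    qed
    also have "\<dots> = \<Phi> (unit_mat n a c) $$ (p,q)" by (rule sum_sum_delta[OF ac(1) ac(1)])
    finally show ?thesis .
  qed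
  ultimately show ?thesis by blast
qed

text \<open>Eigenvectors of the Choi matrix, scaled by the square roots of their eigenvalues and
  reshaped into m by n arrays, are Kraus operators; there are n * m of them.\<close>

theorem channel_kraus:
  assumes \<Phi>: "is_channel n m \<Phi>"
  shows "\<exists>K. kraus_form n m \<Phi> (n * m) K"
proof -
  obtain C where C: "psd (n * m) C" and \<Phi>C: "\<And>a c p q. a < n \<Longrightarrow> c < n \<Longrightarrow> p < m \<Longrightarrow> q < m \<Longrightarrow>
      C $$ (a * m + p, c * m + q) = \<Phi> (unit_mat n a c) $$ (p,q)"
    using choi_psd[OF \<Phi>] by blast
  obtain U f where S: "spectral (n * m) C U f" and f: "\<forall>k<n * m. 0 \<le> f k"
    using psd_spectral[OF C] by blast
  define K where "K \<beta> p a = of_real (sqrt (f \<beta>)) * U $$ (a * m + p, \<beta>)" for \<beta> p a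
  have "kraus_form n m \<Phi> (n * m) K" unfolding kraus_form_def
  proof (intro allI impI)
    fix a c p q assume lt: "a < n" "c < n" "p < m" "q < m"
    have "\<Phi> (unit_mat n a c) $$ (p,q)
        = (\<Sum>k<n * m. U $$ (a * m + p,k) * of_real (f k) * cnj (U $$ (c * m + q,k)))"
      unfolding \<Phi>C[OF lt, symmetric]
      by (rule spectralD(3)[OF S index_pair_less[OF lt(1,3)] index_pair_less[OF lt(2,4)]])
    also have "\<dots> = (\<Sum>\<beta><n * m. K \<beta> p a * cnj (K \<beta> q c))"
    proof (intro sum.cong refl)
      fix k assume "k \<in> {..<n * m}"
      hence "complex_of_real (f k) = of_real (sqrt (f k)) * of_real (sqrt (f k))"
        using f by (simp flip: of_real_mult)
      thus "U $$ (a * m + p,k) * of_real (f k) * cnj (U $$ (c * m + q,k)) = K k p a * cnj (K k q c)"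
        unfolding K_def by simp
    qed
    finally show "\<Phi> (unit_mat n a c) $$ (p,q) = (\<Sum>\<beta><n * m. K \<beta> p a * cnj (K \<beta> q c))" .
  qed
  thus ?thesis by blast
qed

text \<open>The form of Y at v is the sum over \<gamma> of the forms of X at w = M^* v, with M the
  Kraus operator for \<gamma>. The hypothesis on entries covers single channels and tensor products
  alike.\<close>

lemma psd_kraus_image:
  assumes X: "psd n X" and Y: "Y \<in> carrier_mat m m"
    and YX: "\<And>p q. p < m \<Longrightarrow> q < m \<Longrightarrow>
      Y $$ (p,q) = (\<Sum>a<n. \<Sum>c<n. X $$ (a,c) * (\<Sum>\<gamma><r. M \<gamma> p a * cnj (M \<gamma> q c)))"
  shows "psd m Y"
  unfolding psd_qform_iff
proof (intro conjI allI)
  fix v :: "nat \<Rightarrow> complex"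
  define w where "w \<gamma> c = (\<Sum>q<m. cnj (M \<gamma> q c) * v q)" for \<gamma> c
  have wc: "cnj (w \<gamma> a) = (\<Sum>p<m. cnj (v p) * M \<gamma> p a)" for \<gamma> a
    unfolding w_def cnj_sum by (intro sum.cong) auto
  let ?t = "\<lambda>\<gamma> a c p q. X $$ (a,c) * ((cnj (v p) * M \<gamma> p a) * (cnj (M \<gamma> q c) * v q))"
  have "qform m Y v = (\<Sum>p<m. \<Sum>q<m. \<Sum>a<n. \<Sum>c<n. \<Sum>\<gamma><r. ?t \<gamma> a c p q)"
    unfolding qform_def
  proof (intro sum.cong refl)
    fix p q assume "p \<in> {..<m}" "q \<in> {..<m}"
    thus "cnj (v p) * Y $$ (p,q) * v q = (\<Sum>a<n. \<Sum>c<n. \<Sum>\<gamma><r. ?t \<gamma> a c p q)"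
      by (simp add: YX sum_distrib_left sum_distrib_right mult_ac)
  qed
  also have "\<dots> = (\<Sum>\<gamma><r. \<Sum>a<n. \<Sum>c<n. \<Sum>p<m. \<Sum>q<m. ?t \<gamma> a c p q)"
    unfolding sum.cartesian_product by (rule sum.reindex_bij_witness[where
      i = "\<lambda>(\<gamma>,a,c,p,q). (p,q,a,c,\<gamma>)" and j = "\<lambda>(p,q,a,c,\<gamma>). (\<gamma>,a,c,p,q)"]) auto
  also have "\<dots> = (\<Sum>\<gamma><r. qform n X (w \<gamma>))"
  proof (intro sum.cong refl)
    fix \<gamma>
    have "(\<Sum>p<m. \<Sum>q<m. ?t \<gamma> a c p q) = cnj (w \<gamma> a) * X $$ (a,c) * w \<gamma> c" for a c
    proof -
      have "(\<Sum>p<m. \<Sum>q<m. ?t \<gamma> a c p q) = X $$ (a,c) * (cnj (w \<gamma> a) * w \<gamma> c)"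
        unfolding wc unfolding w_def unfolding sum_product unfolding sum_distrib_left ..
      thus ?thesis by (simp add: mult_ac)
    qed
    thus "(\<Sum>a<n. \<Sum>c<n. \<Sum>p<m. \<Sum>q<m. ?t \<gamma> a c p q) = qform n X (w \<gamma>)"
      unfolding qform_def by simp
  qed
  finally show "0 \<le> qform m Y v" using psdD(2)[OF X] by (simp add: sum_nonneg)
qed (rule Y)

lemma channel_psd:
  assumes \<Phi>: "is_channel n m \<Phi>" and X: "psd n X"
  shows "psd m (\<Phi> X)"
proof -
  obtain K where K: "kraus_form n m \<Phi> (n * m) K" using channel_kraus[OF \<Phi>] by blast
  show ?thesis
  proof (rule psd_kraus_image[OF X channelD(1)[OF \<Phi> psdD(1)[OF X]]])
    fix p q assume "p < m" "q < m"
    thus "\<Phi> X $$ (p,q) = (\<Sum>a<n. \<Sum>c<n. X $$ (a,c) * (\<Sum>\<gamma><n * m. K \<gamma> p a * cnj (K \<gamma> q c)))"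
      unfolding channel_expand[OF \<Phi> psdD(1)[OF X] \<open>p < m\<close> \<open>q < m\<close>]
      using K unfolding kraus_form_def by (intro sum.cong refl) simp
  qed
qed

lemma channel_density:
  assumes \<Phi>: "is_channel n m \<Phi>" and X: "density n X"
  shows "density m (\<Phi> X)"
  using channel_psd[OF \<Phi> density_psd[OF X]] channelD(4)[OF \<Phi> density_carrier[OF X]] X
  unfolding density_def by simp

text \<open>The Kraus operators of the tensor product are the products of those of the factors;
  \<gamma> encodes the pair of their numbers by quotient and remainder modulo R.\<close>

lemma chan_tensor_psd:
  assumes \<Phi>: "is_channel n1 m1 \<Phi>" and \<Psi>: "is_channel n2 m2 \<Psi>" and X: "psd (n1 * n2) X"
  shows "psd (m1 * m2) (chan_tensor n1 m1 n2 m2 \<Phi> \<Psi> X)"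
proof -
  obtain K where K: "kraus_form n1 m1 \<Phi> (n1 * m1) K" using channel_kraus[OF \<Phi>] by blast
  obtain L where L: "kraus_form n2 m2 \<Psi> (n2 * m2) L" using channel_kraus[OF \<Psi>] by blast
  define R where "R = n2 * m2"
  define M where "M \<gamma> p a = K (\<gamma> div R) (p div m2) (a div n2) * L (\<gamma> mod R) (p mod m2) (a mod n2)" for \<gamma> p a
  show ?thesis
  proof (rule psd_kraus_image[OF X chan_tensor_carrier])
    fix p q assume pq: "p < m1 * m2" "q < m1 * m2"
    note p = index_pair_div_mod[OF pq(1)] and q = index_pair_div_mod[OF pq(2)]
    have "\<Phi> (unit_mat n1 (a div n2) (c div n2)) $$ (p div m2, q div m2)
        * \<Psi> (unit_mat n2 (a mod n2) (c mod n2)) $$ (p mod m2, q mod m2)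
        = (\<Sum>\<gamma><n1 * m1 * R. M \<gamma> p a * cnj (M \<gamma> q c))" if ac: "a < n1 * n2" "c < n1 * n2" for a c
    proof -
      note a = index_pair_div_mod[OF ac(1)] and c = index_pair_div_mod[OF ac(2)]
      have "(\<Sum>\<gamma><n1 * m1 * R. M \<gamma> p a * cnj (M \<gamma> q c))
          = (\<Sum>\<gamma><n1 * m1 * R. (K (\<gamma> div R) (p div m2) (a div n2) * cnj (K (\<gamma> div R) (q div m2) (c div n2))) *
             (L (\<gamma> mod R) (p mod m2) (a mod n2) * cnj (L (\<gamma> mod R) (q mod m2) (c mod n2))))"
        unfolding M_def by (intro sum.cong refl) simp
      also have "\<dots> = (\<Sum>\<alpha><n1 * m1. K \<alpha> (p div m2) (a div n2) * cnj (K \<alpha> (q div m2) (c div n2))) *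
          (\<Sum>\<beta><R. L \<beta> (p mod m2) (a mod n2) * cnj (L \<beta> (q mod m2) (c mod n2)))"
        unfolding sum_product by (rule sum_index_pair)
      finally show ?thesis using K L a c p q unfolding kraus_form_def R_def by simp
    qed
    thus "chan_tensor n1 m1 n2 m2 \<Phi> \<Psi> X $$ (p,q)
        = (\<Sum>a<n1 * n2. \<Sum>c<n1 * n2. X $$ (a,c) * (\<Sum>\<gamma><n1 * m1 * R. M \<gamma> p a * cnj (M \<gamma> q c)))"
      unfolding chan_tensor_def using pq by (simp add: mult.assoc)
  qed
qed

lemma mtrace_chan_tensor:
  assumes \<Phi>: "is_channel n1 m1 \<Phi>" and \<Psi>: "is_channel n2 m2 \<Psi>" and X: "X \<in> carrier_mat (n1 * n2) (n1 * n2)"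
  shows "mtrace (chan_tensor n1 m1 n2 m2 \<Phi> \<Psi> X) = mtrace X"
proof -
  let ?N = "n1 * n2"
  let ?F = "\<lambda>a c p. \<Phi> (unit_mat n1 (a div n2) (c div n2)) $$ (p, p)"
  let ?G = "\<lambda>a c p. \<Psi> (unit_mat n2 (a mod n2) (c mod n2)) $$ (p, p)"
  have "mtrace (chan_tensor n1 m1 n2 m2 \<Phi> \<Psi> X)
      = (\<Sum>p<m1 * m2. \<Sum>a<?N. \<Sum>c<?N. X $$ (a,c) * (?F a c (p div m2) * ?G a c (p mod m2)))"
    unfolding mtrace_def by (simp add: chan_tensor_def mult.assoc)
  also have "\<dots> = (\<Sum>a<?N. \<Sum>p<m1 * m2. \<Sum>c<?N. X $$ (a,c) * (?F a c (p div m2) * ?G a c (p mod m2)))"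
    by (rule sum.swap)
  also have "\<dots> = (\<Sum>a<?N. \<Sum>c<?N. X $$ (a,c) * (\<Sum>p<m1 * m2. ?F a c (p div m2) * ?G a c (p mod m2)))"
    unfolding sum_distrib_left by (intro sum.cong refl sum.swap)
  also have "\<dots> = (\<Sum>a<?N. \<Sum>c<?N. if c = a then X $$ (a,c) else 0)"
  proof (intro sum.cong refl)
    fix a c assume "a \<in> {..<?N}" "c \<in> {..<?N}"
    hence ac: "a < ?N" "c < ?N" by auto
    note a = index_pair_div_mod[OF ac(1)] and c = index_pair_div_mod[OF ac(2)]
    have "(\<Sum>p<m1 * m2. ?F a c (p div m2) * ?G a c (p mod m2)) = (\<Sum>p<m1. \<Sum>q<m2. ?F a c p * ?G a c q)"
      by (rule sum_index_pair)
    also have "\<dots> = mtrace (\<Phi> (unit_mat n1 (a div n2) (c div n2))) * mtrace (\<Psi> (unit_mat n2 (a mod n2) (c mod n2)))"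
      unfolding mtrace_def sum_product
      using channelD(1)[OF \<Phi> unit_mat_carrier, of "a div n2" "c div n2"]
        channelD(1)[OF \<Psi> unit_mat_carrier, of "a mod n2" "c mod n2"] by simp
    also have "\<dots> = (if c = a then 1 else 0)"
      using a c by (auto simp: channelD(4)[OF \<Phi>] channelD(4)[OF \<Psi>] mtrace_unit_mat) (metis div_mult_mod_eq)+
    finally show "X $$ (a,c) * (\<Sum>p<m1 * m2. ?F a c (p div m2) * ?G a c (p mod m2)) = (if c = a then X $$ (a,c) else 0)"
      by simp
  qed
  also have "\<dots> = mtrace X" unfolding mtrace_def using X by simp
  finally show ?thesis .
qed

lemma chan_tensor_density:
  assumes "is_channel n1 m1 \<Phi>" "is_channel n2 m2 \<Psi>" "density (n1 * n2) X"
  shows "density (m1 * m2) (chan_tensor n1 m1 n2 m2 \<Phi> \<Psi> X)"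
  using chan_tensor_psd[OF assms(1,2) density_psd[OF assms(3)]]
    mtrace_chan_tensor[OF assms(1,2) density_carrier[OF assms(3)]] assms(3)
  unfolding density_def by simp

lemma chan_tensor_mtensor:
  assumes \<Phi>: "is_channel n1 m1 \<Phi>" and \<Psi>: "is_channel n2 m2 \<Psi>"
    and X: "X \<in> carrier_mat n1 n1" and Y: "Y \<in> carrier_mat n2 n2"
  shows "chan_tensor n1 m1 n2 m2 \<Phi> \<Psi> (mtensor X Y) = mtensor (\<Phi> X) (\<Psi> Y)"
proof (rule eq_matI)
  note c = channelD(1)[OF \<Phi> X] channelD(1)[OF \<Psi> Y]
  fix p q assume "p < dim_row (mtensor (\<Phi> X) (\<Psi> Y))" "q < dim_col (mtensor (\<Phi> X) (\<Psi> Y))"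
  hence pq: "p < m1 * m2" "q < m1 * m2" using mtensor_carrier[OF c] by auto
  note p = index_pair_div_mod[OF pq(1)] and q = index_pair_div_mod[OF pq(2)]
  let ?F = "\<lambda>a c. X $$ (a,c) * \<Phi> (unit_mat n1 a c) $$ (p div m2, q div m2)"
  let ?G = "\<lambda>a c. Y $$ (a,c) * \<Psi> (unit_mat n2 a c) $$ (p mod m2, q mod m2)"
  have "chan_tensor n1 m1 n2 m2 \<Phi> \<Psi> (mtensor X Y) $$ (p,q)
      = (\<Sum>i<n1 * n2. \<Sum>j<n1 * n2. ?F (i div n2) (j div n2) * ?G (i mod n2) (j mod n2))"
    using pq by (simp add: chan_tensor_def index_mtensor[OF X Y] mult_ac)
  also have "\<dots> = (\<Sum>i<n1 * n2. \<Sum>a<n1. \<Sum>b<n2. ?F (i div n2) a * ?G (i mod n2) b)"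
    by (intro sum.cong refl sum_index_pair)
  also have "\<dots> = (\<Sum>a'<n1. \<Sum>b'<n2. \<Sum>a<n1. \<Sum>b<n2. ?F a' a * ?G b' b)"
    by (rule sum_index_pair)
  also have "\<dots> = (\<Sum>a'<n1. \<Sum>a<n1. ?F a' a) * (\<Sum>b'<n2. \<Sum>b<n2. ?G b' b)"
    unfolding sum_product ..
  also have "\<dots> = mtensor (\<Phi> X) (\<Psi> Y) $$ (p,q)"
    unfolding index_mtensor[OF c pq] channel_expand[OF \<Phi> X p(1) q(1)] channel_expand[OF \<Psi> Y p(2) q(2)] ..
  finally show "chan_tensor n1 m1 n2 m2 \<Phi> \<Psi> (mtensor X Y) $$ (p,q) = mtensor (\<Phi> X) (\<Psi> Y) $$ (p,q)" .
qed (use carrier_matD[OF mtensor_carrier[OF channelD(1)[OF \<Phi> X] channelD(1)[OF \<Psi> Y]]]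
    carrier_matD[OF chan_tensor_carrier] in simp_all)

section \<open>Minimum output entropy as an infimum, and subadditivity\<close>

lemma density_unit_mat: "0 < n \<Longrightarrow> density n (unit_mat n 0 0)"
  unfolding density_def psd_qform_iff
proof (intro conjI allI)
  assume n: "0 < n"
  fix v :: "nat \<Rightarrow> complex"
  have "qform n (unit_mat n 0 0) v = (\<Sum>i<n. \<Sum>j<n. if i = 0 \<and> j = 0 then cnj (v i) * v j else 0)"
    unfolding qform_def by (intro sum.cong refl) auto
  also have "\<dots> = cnj (v 0) * v 0" by (rule sum_sum_delta[OF n n])
  finally show "0 \<le> qform n (unit_mat n 0 0) v" by (simp add: less_eq_complex_def)
qed (auto simp: mtrace_unit_mat)

lemma S_min_le:
  assumes "bdd_below {vn_entropy (\<Phi> \<rho>) | \<rho>. density n \<rho>}" "density n \<rho>"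
  shows "S_min n \<Phi> \<le> vn_entropy (\<Phi> \<rho>)"
  unfolding S_min_def using assms by (intro cInf_lower) auto

text \<open>Positive dimension supplies a state, so the infimum runs over a nonempty set.\<close>

lemma S_min_greatest:
  assumes "0 < n" "\<And>\<rho>. density n \<rho> \<Longrightarrow> c \<le> vn_entropy (\<Phi> \<rho>)"
  shows "c \<le> S_min n \<Phi>"
  unfolding S_min_def using assms density_unit_mat by (intro cInf_greatest) auto

lemma S_min_le_channel:
  assumes "is_channel n m \<Phi>" "density n \<rho>"
  shows "S_min n \<Phi> \<le> vn_entropy (\<Phi> \<rho>)"
proof (rule S_min_le[OF _ assms(2)])
  show "bdd_below {vn_entropy (\<Phi> \<rho>) | \<rho>. density n \<rho>}"
    using vn_entropy_density_nonneg channel_density[OF assms(1)] by (intro bdd_belowI[of _ 0]) blast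
qed

text \<open>Product inputs give product outputs, whose entropies add. The two infima are taken one
  after the other, each time with the other entropy moved across the inequality.\<close>

lemma S_min_chan_tensor_le:
  assumes n: "0 < n1" "0 < n2" and \<Phi>: "is_channel n1 m1 \<Phi>" and \<Psi>: "is_channel n2 m2 \<Psi>"
  shows "S_min (n1 * n2) (chan_tensor n1 m1 n2 m2 \<Phi> \<Psi>) \<le> S_min n1 \<Phi> + S_min n2 \<Psi>"
proof -
  let ?T = "chan_tensor n1 m1 n2 m2 \<Phi> \<Psi>"
  have le: "S_min (n1 * n2) ?T \<le> vn_entropy (\<Phi> \<rho>) + vn_entropy (\<Psi> \<sigma>)"
    if "density n1 \<rho>" "density n2 \<sigma>" for \<rho> \<sigma>
    using S_min_le[OF bdd_below_vn_entropy_chan_tensor density_mtensor[OF that], of m1 m2 \<Phi> \<Psi>]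
      chan_tensor_mtensor[OF \<Phi> \<Psi> density_carrier[OF that(1)] density_carrier[OF that(2)]]
      vn_entropy_mtensor[OF channel_density[OF \<Phi> that(1)] channel_density[OF \<Psi> that(2)]] by simp
  have "S_min (n1 * n2) ?T - vn_entropy (\<Phi> \<rho>) \<le> S_min n2 \<Psi>" if "density n1 \<rho>" for \<rho>
    using le[OF that] by (intro S_min_greatest[OF n(2)]) (simp add: algebra_simps)
  hence "S_min (n1 * n2) ?T - S_min n2 \<Psi> \<le> S_min n1 \<Phi>"
    by (intro S_min_greatest[OF n(1)]) (simp add: algebra_simps)
  thus ?thesis by simp
qed

section \<open>Existence of dilations\<close>

text \<open>The eigenvalues of an orthogonal projection are 0 or 1 and its trace counts the ones.
  The columns of Q are the eigenvectors for eigenvalue 1, enumerated by h.\<close>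

lemma projection_factor:
  assumes P: "P \<in> carrier_mat N N" and herm: "mat_adjoint P = P" and idem: "P * P = P"
    and tr: "mtrace P = of_nat r"
  shows "\<exists>Q \<in> carrier_mat N r. mat_adjoint Q * Q = 1\<^sub>m r \<and> Q * mat_adjoint Q = P"
proof -
  have "P $$ (j,i) = cnj (P $$ (i,j))" if "i < N" "j < N" for i j
    using arg_cong[OF herm, of "\<lambda>M. M $$ (j,i)"] P that by simp
  then obtain W f where S: "spectral N P W f" using hermitian_spectral[OF P] by blast
  let ?D = "mat_diag N (\<lambda>k. complex_of_real (f k))"
  have W: "unitary_mat N W" and PD: "P = W * ?D * mat_adjoint W"
    using S unfolding spectral_iff_mat_diag by blast+
  note Wc = unitary_matD[OF W]
  have aW: "mat_adjoint W \<in> carrier_mat N N" using Wc by simp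
  note assoc = assoc_mult_mat[of _ N N _ N _ N] mult_carrier_mat[of _ N N _ N] Wc(1) aW P mat_diag_dim
  have "mat_adjoint W * P * W = (mat_adjoint W * W) * ?D * (mat_adjoint W * W)"
    unfolding PD by (simp only: assoc)
  hence D: "?D = mat_adjoint W * P * W"
    using Wc by (simp add: left_mult_one_mat[OF mat_diag_dim] right_mult_one_mat[OF mat_diag_dim])
  have "?D * ?D = mat_adjoint W * P * (W * mat_adjoint W) * P * W"
    unfolding D by (simp only: assoc)
  also have "\<dots> = mat_adjoint W * (P * P) * W"
    using Wc(2) aW P by (simp add: assoc_mult_mat[OF aW P P] right_mult_one_mat[of _ N N])
  finally have "?D * ?D = ?D" unfolding idem D[symmetric] .
  hence DD: "mat_diag N (\<lambda>k. complex_of_real (f k) * complex_of_real (f k)) = ?D" by simp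
  have f01: "f k = 0 \<or> f k = 1" if "k < N" for k
  proof -
    have "complex_of_real (f k) * complex_of_real (f k) = complex_of_real (f k)"
      using arg_cong[OF DD, of "\<lambda>M. M $$ (k,k)"] that unfolding mat_diag_def by simp
    hence "f k * f k = f k" by (simp only: of_real_eq_iff flip: of_real_mult)
    thus ?thesis by simp
  qed
  define S1 where "S1 = {k. k < N \<and> f k = 1}"
  have fin: "finite S1" unfolding S1_def by simp
  have "of_nat r = complex_of_real (\<Sum>k<N. f k)" using spectral_trace[OF S] tr by simp
  also have "(\<Sum>k<N. f k) = (\<Sum>k\<in>S1. 1)"
    using f01 by (intro sum.mono_neutral_cong_right) (auto simp: S1_def)
  finally have "r = card S1" by (simp flip: of_nat_sum)
  then obtain h where h: "bij_betw h {..<r} S1"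
    using ex_bij_betw_nat_finite[OF fin] by (auto simp: atLeast0LessThan)
  have hN: "h k < N" if "k < r" for k using bij_betwE[OF h] that unfolding S1_def by auto
  define Q where "Q = mat N r (\<lambda>(i,k). W $$ (i, h k))"
  have Q: "Q \<in> carrier_mat N r" unfolding Q_def by simp
  have "mat_adjoint Q * Q = 1\<^sub>m r"
  proof (rule eq_matI)
    fix k l assume "k < dim_row (1\<^sub>m r :: complex mat)" "l < dim_col (1\<^sub>m r :: complex mat)"
    hence kl: "k < r" "l < r" by auto
    have "(mat_adjoint Q * Q) $$ (k,l) = (\<Sum>i<N. mat_adjoint Q $$ (k,i) * Q $$ (i,l))"
      by (rule index_mult_sum[OF mat_adjoint_carrier[OF Q] Q kl])
    also have "\<dots> = (\<Sum>i<N. cnj (W $$ (i, h k)) * W $$ (i, h l))"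
      using kl Q by (intro sum.cong refl) (simp add: Q_def)
    also have "\<dots> = (if h k = h l then 1 else 0)" by (rule unitary_mat_cols[OF W hN[OF kl(1)] hN[OF kl(2)]])
    also have "h k = h l \<longleftrightarrow> k = l"
      using bij_betw_imp_inj_on[OF h] kl by (auto dest: inj_onD)
    finally show "(mat_adjoint Q * Q) $$ (k,l) = 1\<^sub>m r $$ (k,l)" using kl by simp
  qed (use Q in auto)
  moreover have "Q * mat_adjoint Q = P"
  proof (rule eq_matI)
    fix i j assume "i < dim_row P" "j < dim_col P"
    hence ij: "i < N" "j < N" using P by auto
    have "(Q * mat_adjoint Q) $$ (i,j) = (\<Sum>k<r. Q $$ (i,k) * mat_adjoint Q $$ (k,j))"
      by (rule index_mult_sum[OF Q mat_adjoint_carrier[OF Q] ij])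
    also have "\<dots> = (\<Sum>k<r. W $$ (i, h k) * cnj (W $$ (j, h k)))"
      using ij Q by (intro sum.cong refl) (simp add: Q_def)
    also have "\<dots> = (\<Sum>k\<in>S1. W $$ (i,k) * cnj (W $$ (j,k)))"
      by (rule sum.reindex_bij_betw[OF h])
    also have "\<dots> = (\<Sum>k<N. W $$ (i,k) * of_real (f k) * cnj (W $$ (j,k)))"
      using f01 by (intro sum.mono_neutral_cong_left) (auto simp: S1_def)
    also have "\<dots> = P $$ (i,j)" using spectralD(3)[OF S ij] by simp
    finally show "(Q * mat_adjoint Q) $$ (i,j) = P $$ (i,j)" .
  qed (use P Q in auto)
  ultimately show ?thesis using Q by blast
qed

lemma isometry_cols:
  assumes J: "J \<in> carrier_mat N n" "mat_adjoint J * J = 1\<^sub>m n" and ij: "i < n" "j < n"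
  shows "(\<Sum>k<N. cnj (J $$ (k,i)) * J $$ (k,j)) = (if i = j then 1 else 0)"
proof -
  have "(mat_adjoint J * J) $$ (i,j) = (\<Sum>k<N. mat_adjoint J $$ (i,k) * J $$ (k,j))"
    by (rule index_mult_sum[OF mat_adjoint_carrier[OF J(1)] J(1) ij])
  also have "\<dots> = (\<Sum>k<N. cnj (J $$ (k,i)) * J $$ (k,j))"
    using J ij by (intro sum.cong refl) simp
  finally show ?thesis using J(2) ij by simp
qed

text \<open>The complementary projection P = 1 - J J^* has trace N - n, so it factors as Q Q^*, and
  the columns of Q complete those of J to an orthonormal basis.\<close>

lemma isometry_unitary_extension:
  assumes J: "J \<in> carrier_mat N n" "mat_adjoint J * J = 1\<^sub>m n" and nN: "n \<le> N"
  shows "\<exists>U. unitary_mat N U \<and> (\<forall>i<N. \<forall>j<n. U $$ (i,j) = J $$ (i,j))"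
proof -
  let ?A = "mat_adjoint J"
  have A: "?A \<in> carrier_mat n N" using J by simp
  have JA: "J * ?A \<in> carrier_mat N N" using J A by simp
  define P where "P = 1\<^sub>m N - J * ?A"
  have P: "P \<in> carrier_mat N N" unfolding P_def using JA by (rule minus_carrier_mat)
  have JAJA: "J * ?A * (J * ?A) = J * ?A"
  proof -
    have "J * ?A * (J * ?A) = J * (?A * J) * ?A"
      by (simp only: assoc_mult_mat[OF J(1) A JA] assoc_mult_mat[OF A J(1) A, symmetric]
        assoc_mult_mat[OF J(1) mult_carrier_mat[OF A J(1)] A])
    thus ?thesis using J by simp
  qed
  have "mat_adjoint P = P"
  proof (rule eq_matI)
    fix i j assume "i < dim_row P" "j < dim_col P"
    hence ij: "i < N" "j < N" using P by auto
    have "mat_adjoint (J * ?A) = J * ?A" using mat_adjoint_mult[OF J(1) A] by simp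
    hence "cnj ((J * ?A) $$ (j,i)) = (J * ?A) $$ (i,j)"
      using index_mat_adjoint[of i "J * ?A" j] JA ij by (metis carrier_matD)
    thus "mat_adjoint P $$ (i,j) = P $$ (i,j)"
      using ij P JA carrier_matD[OF P] carrier_matD[OF JA]
      by (simp add: P_def del: index_mult_mat)
  qed (use P in auto)
  moreover have "P * P = P"
  proof -
    have "P * P = 1\<^sub>m N * P - J * ?A * P"
      unfolding P_def by (rule minus_mult_distrib_mat[OF one_carrier_mat JA P[unfolded P_def]])
    also have "J * ?A * P = J * ?A * 1\<^sub>m N - J * ?A * (J * ?A)"
      unfolding P_def by (rule mult_minus_distrib_mat[OF JA one_carrier_mat JA])
    also have "\<dots> = 0\<^sub>m N N" unfolding JAJA using right_mult_one_mat[OF JA] JA by (simp del: index_mult_mat)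
    finally show ?thesis using P by (auto simp: left_mult_one_mat[OF P] intro!: eq_matI)
  qed
  moreover have "mtrace P = of_nat (N - n)"
  proof -
    have "mtrace P = (\<Sum>i<N. 1 - (\<Sum>k<n. J $$ (i,k) * cnj (J $$ (i,k))))"
      unfolding mtrace_def carrier_matD(1)[OF P]
    proof (intro sum.cong refl)
      fix i assume "i \<in> {..<N}"
      hence i: "i < N" by simp
      have "(J * ?A) $$ (i,i) = (\<Sum>k<n. J $$ (i,k) * ?A $$ (k,i))"
        by (rule index_mult_sum[OF J(1) A i i])
      also have "\<dots> = (\<Sum>k<n. J $$ (i,k) * cnj (J $$ (i,k)))"
        using J i by (intro sum.cong refl) simp
      finally show "P $$ (i,i) = 1 - (\<Sum>k<n. J $$ (i,k) * cnj (J $$ (i,k)))"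
        using i carrier_matD[OF JA] unfolding P_def by (simp del: index_mult_mat(1))
    qed
    also have "\<dots> = of_nat N - (\<Sum>i<N. \<Sum>k<n. cnj (J $$ (i,k)) * J $$ (i,k))"
      by (simp add: sum_subtractf mult.commute)
    also have "(\<Sum>i<N. \<Sum>k<n. cnj (J $$ (i,k)) * J $$ (i,k)) = (\<Sum>k<n. \<Sum>i<N. cnj (J $$ (i,k)) * J $$ (i,k))"
      by (rule sum.swap)
    also have "\<dots> = of_nat n" using isometry_cols[OF J] by simp
    finally show ?thesis using nN by (simp add: of_nat_diff)
  qed
  ultimately obtain Q where Q: "Q \<in> carrier_mat N (N - n)" "mat_adjoint Q * Q = 1\<^sub>m (N - n)"
      and QQ: "Q * mat_adjoint Q = P"
    using projection_factor[OF P] by blast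
  let ?B = "mat_adjoint Q"
  have B: "?B \<in> carrier_mat (N - n) N" using Q by simp
  have AP: "?A * P = 0\<^sub>m n N"
  proof -
    have "?A * P = ?A * 1\<^sub>m N - ?A * (J * ?A)"
      unfolding P_def by (rule mult_minus_distrib_mat[OF A one_carrier_mat JA])
    also have "?A * (J * ?A) = ?A" using assoc_mult_mat[OF A J(1) A] J(2) left_mult_one_mat[OF A] by simp
    finally have "?A * P = ?A - ?A" using right_mult_one_mat[OF A] by simp
    thus ?thesis using minus_r_inv_mat[OF A] by simp
  qed
  \<comment> \<open>Inserting Q^* Q = 1 exhibits the factor P = Q Q^*, which the adjoint of J
    annihilates; so the columns of Q are orthogonal to those of J.\<close>
  have "?A * Q = ?A * (Q * (?B * Q))" using Q by simp
  also have "\<dots> = ?A * P * Q"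
    using assoc_mult_mat[OF Q(1) B Q(1)] assoc_mult_mat[OF A P Q(1)] QQ by simp
  finally have AQ: "?A * Q = 0\<^sub>m n (N - n)" unfolding AP using Q by simp
  have JQ: "(\<Sum>k<N. cnj (J $$ (k,i)) * Q $$ (k,j)) = 0" if ij: "i < n" "j < N - n" for i j
  proof -
    have "(?A * Q) $$ (i,j) = (\<Sum>k<N. ?A $$ (i,k) * Q $$ (k,j))" by (rule index_mult_sum[OF A Q(1) ij])
    also have "\<dots> = (\<Sum>k<N. cnj (J $$ (k,i)) * Q $$ (k,j))" using J ij by (intro sum.cong refl) simp
    finally show ?thesis unfolding AQ using ij by simp
  qed
  have QJ: "(\<Sum>k<N. cnj (Q $$ (k,j)) * J $$ (k,i)) = 0" if ij: "i < n" "j < N - n" for i j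
    using arg_cong[OF JQ[OF ij], of cnj] by (simp add: mult.commute)
  define U where "U = mat N N (\<lambda>(i,j). if j < n then J $$ (i,j) else Q $$ (i,j - n))"
  have "unitary_mat N U"
  proof (rule unitary_matI)
    fix i j assume ij: "i < N" "j < N"
    have "(\<Sum>k<N. cnj (U $$ (k,i)) * U $$ (k,j))
        = (\<Sum>k<N. cnj (if i < n then J $$ (k,i) else Q $$ (k,i - n)) * (if j < n then J $$ (k,j) else Q $$ (k,j - n)))"
      using ij by (intro sum.cong refl) (simp add: U_def)
    also have "\<dots> = (if i = j then 1 else 0)"
      using isometry_cols[OF J, of i j] isometry_cols[OF Q, of "i - n" "j - n"]
        JQ[of i "j - n"] QJ[of j "i - n"] ij by (cases "i < n"; cases "j < n") auto
    finally show "(\<Sum>k<N. cnj (U $$ (k,i)) * U $$ (k,j)) = (if i = j then 1 else 0)" .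
  qed (simp add: U_def)
  thus ?thesis using nN by (intro exI[of _ U]) (auto simp: U_def)
qed

text \<open>Stack the Kraus operators into an isometry J and extend it to a unitary. With d = m k
  and b = n k the dimensions d n and m b agree, and k \<ge> m makes b large enough for all n m Kraus
  operators.\<close>

theorem dilation_exists:
  assumes n: "0 < n" and m: "0 < m" and \<Phi>: "is_channel n m \<Phi>" and k: "m \<le> k"
  shows "\<exists>D. is_dilation n m \<Phi> (m * k) D"
proof -
  define d where "d = m * k"
  define b where "b = n * k"
  define N where "N = d * n"
  have Nmb: "N = m * b" unfolding N_def d_def b_def by simp
  have d0: "0 < d" using m k unfolding d_def by simp
  have nN: "n \<le> N" using d0 unfolding N_def by simp
  have rb: "n * m \<le> b" using k unfolding b_def by simp
  obtain K0 where K0: "kraus_form n m \<Phi> (n * m) K0" using channel_kraus[OF \<Phi>] by blast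
  \<comment> \<open>Padding by zero operators brings the number of Kraus operators up to b.\<close>
  define K where "K \<beta> p a = (if \<beta> < n * m then K0 \<beta> p a else 0)" for \<beta> p a
  have K: "\<Phi> (unit_mat n a c) $$ (p,q) = (\<Sum>\<beta><b. K \<beta> p a * cnj (K \<beta> q c))"
    if "a < n" "c < n" "p < m" "q < m" for a c p q
  proof -
    have "(\<Sum>\<beta><b. K \<beta> p a * cnj (K \<beta> q c)) = (\<Sum>\<beta><n * m. K0 \<beta> p a * cnj (K0 \<beta> q c))"
      using rb by (intro sum.mono_neutral_cong_right) (auto simp: K_def)
    thus ?thesis using K0 that unfolding kraus_form_def by simp
  qed
  \<comment> \<open>Row p * b + \<beta> of J is row p of the Kraus operator \<beta>, so tracing out
    B sums over \<beta>. Trace preservation on matrix units is what makes J an isometry.\<close>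
  define J where "J = mat N n (\<lambda>(x,i). K (x mod b) (x div b) i)"
  have J: "J \<in> carrier_mat N n" unfolding J_def by simp
  have JJ: "mat_adjoint J * J = 1\<^sub>m n"
  proof (rule eq_matI)
    fix i j assume "i < dim_row (1\<^sub>m n :: complex mat)" "j < dim_col (1\<^sub>m n :: complex mat)"
    hence ij: "i < n" "j < n" by auto
    have "(mat_adjoint J * J) $$ (i,j) = (\<Sum>x<N. mat_adjoint J $$ (i,x) * J $$ (x,j))"
      by (rule index_mult_sum[OF mat_adjoint_carrier[OF J] J ij])
    also have "\<dots> = (\<Sum>x<m * b. K (x mod b) (x div b) j * cnj (K (x mod b) (x div b) i))"
      using ij unfolding J_def Nmb by (intro sum.cong refl) simp
    also have "\<dots> = (\<Sum>p<m. \<Sum>\<beta><b. K \<beta> p j * cnj (K \<beta> p i))" by (rule sum_index_pair)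
    also have "\<dots> = mtrace (\<Phi> (unit_mat n j i))"
      unfolding mtrace_def carrier_matD(1)[OF channelD(1)[OF \<Phi> unit_mat_carrier]]
      using K[OF ij(2,1)] by simp
    also have "\<dots> = (if j = i then 1 else 0)"
      unfolding channelD(4)[OF \<Phi> unit_mat_carrier] by (rule mtrace_unit_mat[OF ij(2,1)])
    finally show "(mat_adjoint J * J) $$ (i,j) = 1\<^sub>m n $$ (i,j)" using ij by auto
  qed (use J in auto)
  obtain U where U: "unitary_mat N U" and UJ: "\<And>i j. i < N \<Longrightarrow> j < n \<Longrightarrow> U $$ (i,j) = J $$ (i,j)"
    using isometry_unitary_extension[OF J JJ nN] by blast
  note Uc = unitary_matD[OF U]
  \<comment> \<open>With the first basis vector as ancilla state, S_0 consists of the first n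
    coordinates, which are the columns on which U agrees with J.\<close>
  define v where "v = (unit_vec d 0 :: complex vec)"
  have v: "v \<in> carrier_vec d" unfolding v_def by simp
  have pv: "proj_vec v \<in> carrier_mat d d" unfolding proj_vec_def using v by simp
  have proj: "mtensor (proj_vec v) X $$ (x,y) = (if x < n \<and> y < n then X $$ (x,y) else 0)"
    if X: "X \<in> carrier_mat n n" and xy: "x < N" "y < N" for X x y
  proof -
    have "x div n < d" "y div n < d" using xy unfolding N_def by (auto simp: less_mult_imp_div_less)
    moreover have "x div n = 0 \<longleftrightarrow> x < n" "y div n = 0 \<longleftrightarrow> y < n"
      using n by (auto simp: div_eq_0_iff)
    ultimately show ?thesis
      using index_mtensor[OF pv X, of x y] xy d0 unfolding N_def
      by (auto simp: proj_vec_def v_def unit_vec_def)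
  qed
  have split: "(\<Sum>x<N. if x < n then F x else 0) = (\<Sum>x<n. F x)" for F :: "nat \<Rightarrow> complex"
    using nN by (intro sum.mono_neutral_cong_right) auto
  have dil: "\<Phi> X = ptrace_B m b (U * mtensor (proj_vec v) X * mat_adjoint U)" if X: "X \<in> carrier_mat n n" for X
  proof (rule eq_matI)
    fix p q assume "p < dim_row (ptrace_B m b (U * mtensor (proj_vec v) X * mat_adjoint U))"
      "q < dim_col (ptrace_B m b (U * mtensor (proj_vec v) X * mat_adjoint U))"
    hence pq: "p < m" "q < m" unfolding ptrace_B_def by auto
    have T: "mtensor (proj_vec v) X \<in> carrier_mat N N" using mtensor_carrier[OF pv X] unfolding N_def .
    have entry: "(U * mtensor (proj_vec v) X * mat_adjoint U) $$ (p * b + \<beta>, q * b + \<beta>)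
        = (\<Sum>x<n. \<Sum>y<n. X $$ (x,y) * (K \<beta> p x * cnj (K \<beta> q y)))" if \<beta>: "\<beta> < b" for \<beta>
    proof -
      have lt: "p * b + \<beta> < N" "q * b + \<beta> < N"
        using index_pair_less[OF pq(1) \<beta>] index_pair_less[OF pq(2) \<beta>] unfolding Nmb by auto
      have JK: "J $$ (p * b + \<beta>, x) = K \<beta> p x" "J $$ (q * b + \<beta>, x) = K \<beta> q x" if "x < n" for x
        using lt that \<beta> unfolding J_def by simp_all
      have "(U * mtensor (proj_vec v) X * mat_adjoint U) $$ (p * b + \<beta>, q * b + \<beta>)
        = (\<Sum>x<N. \<Sum>y<N. U $$ (p * b + \<beta>, x) * mtensor (proj_vec v) X $$ (x,y) * mat_adjoint U $$ (y, q * b + \<beta>))"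
        by (rule index_mult3_sum[OF Uc(1) T mat_adjoint_carrier[OF Uc(1)] lt])
      also have "\<dots> = (\<Sum>x<N. if x < n then (\<Sum>y<N. if y < n then
          U $$ (p * b + \<beta>, x) * X $$ (x,y) * cnj (U $$ (q * b + \<beta>, y)) else 0) else 0)"
        using lt Uc by (intro sum.cong refl) (auto simp: proj[OF X] intro!: sum.cong sum.neutral)
      also have "\<dots> = (\<Sum>x<n. \<Sum>y<n. X $$ (x,y) * (K \<beta> p x * cnj (K \<beta> q y)))"
        unfolding split using lt by (intro sum.cong refl) (simp add: UJ JK)
      finally show ?thesis .
    qed
    have "ptrace_B m b (U * mtensor (proj_vec v) X * mat_adjoint U) $$ (p,q)
        = (\<Sum>\<beta><b. \<Sum>x<n. \<Sum>y<n. X $$ (x,y) * (K \<beta> p x * cnj (K \<beta> q y)))"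
      unfolding ptrace_B_def using pq by (simp add: entry del: index_mult_mat)
    also have "\<dots> = (\<Sum>x<n. \<Sum>\<beta><b. \<Sum>y<n. X $$ (x,y) * (K \<beta> p x * cnj (K \<beta> q y)))"
      by (rule sum.swap)
    also have "\<dots> = (\<Sum>x<n. \<Sum>y<n. \<Sum>\<beta><b. X $$ (x,y) * (K \<beta> p x * cnj (K \<beta> q y)))"
      by (intro sum.cong refl sum.swap)
    also have "\<dots> = (\<Sum>x<n. \<Sum>y<n. X $$ (x,y) * \<Phi> (unit_mat n x y) $$ (p,q))"
      using K pq by (intro sum.cong refl) (simp add: sum_distrib_left)
    also have "\<dots> = \<Phi> X $$ (p,q)" by (rule channel_expand[OF \<Phi> X pq, symmetric])
    finally show "\<Phi> X $$ (p,q) = ptrace_B m b (U * mtensor (proj_vec v) X * mat_adjoint U) $$ (p,q)" by simp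
  qed (use channelD(1)[OF \<Phi> X] in \<open>auto simp: ptrace_B_def\<close>)
  \<comment> \<open>The complement of S_0 is spanned by the coordinates from n on, hence the shift
    by n.\<close>
  define Q where "Q = mat N (N - n) (\<lambda>(x,i). if x = i + n then 1 else 0 :: complex)"
  have Q: "Q \<in> carrier_mat N (N - n)" unfolding Q_def by simp
  have QQ1: "mat_adjoint Q * Q = 1\<^sub>m (N - n)"
  proof (rule eq_matI)
    fix i j assume "i < dim_row (1\<^sub>m (N - n) :: complex mat)" "j < dim_col (1\<^sub>m (N - n) :: complex mat)"
    hence ij: "i < N - n" "j < N - n" by auto
    have "(mat_adjoint Q * Q) $$ (i,j) = (\<Sum>x<N. mat_adjoint Q $$ (i,x) * Q $$ (x,j))"
      by (rule index_mult_sum[OF mat_adjoint_carrier[OF Q] Q ij])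
    also have "\<dots> = (\<Sum>x<N. if x = i + n then (if i = j then 1 else 0) else 0)"
      using ij unfolding Q_def by (intro sum.cong refl) auto
    finally show "(mat_adjoint Q * Q) $$ (i,j) = 1\<^sub>m (N - n) $$ (i,j)" using ij by auto
  qed (use Q in auto)
  have QQ2: "Q * mat_adjoint Q = 1\<^sub>m N - S0_proj n v"
  proof (rule eq_matI)
    have S0c: "S0_proj n v \<in> carrier_mat N N"
      unfolding S0_proj_def N_def by (rule mtensor_carrier[OF pv one_carrier_mat])
    show "dim_row (Q * mat_adjoint Q) = dim_row (1\<^sub>m N - S0_proj n v)"
      "dim_col (Q * mat_adjoint Q) = dim_col (1\<^sub>m N - S0_proj n v)" using Q S0c by auto
    fix x y assume "x < dim_row (1\<^sub>m N - S0_proj n v)" "y < dim_col (1\<^sub>m N - S0_proj n v)"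
    hence xy: "x < N" "y < N" using S0c by auto
    have "(Q * mat_adjoint Q) $$ (x,y) = (\<Sum>i<N - n. Q $$ (x,i) * mat_adjoint Q $$ (i,y))"
      by (rule index_mult_sum[OF Q mat_adjoint_carrier[OF Q] xy])
    also have "\<dots> = (\<Sum>i<N - n. if i = x - n then (if x = y \<and> n \<le> x then 1 else 0) else 0)"
      using xy unfolding Q_def by (intro sum.cong refl) auto
    also have "\<dots> = (if x = y \<and> n \<le> x then 1 else 0)" using xy by auto
    also have "\<dots> = (1\<^sub>m N - S0_proj n v) $$ (x,y)"
      using xy S0c unfolding S0_proj_def by (auto simp: proj)
    finally show "(Q * mat_adjoint Q) $$ (x,y) = (1\<^sub>m N - S0_proj n v) $$ (x,y)" .
  qed
  have norm: "(\<Sum>i<d. cnj (v $ i) * v $ i) = 1"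
  proof -
    have "(\<Sum>i<d. cnj (v $ i) * v $ i) = (\<Sum>i<d. if i = 0 then 1 else 0)"
      unfolding v_def by (intro sum.cong refl) (auto simp: unit_vec_def)
    thus ?thesis using d0 by simp
  qed
  have "is_dilation n m \<Phi> d (b, v, U, Q)"
    unfolding is_dilation_def prod.case N_def[symmetric]
    using Nmb v norm U dil Q QQ1 QQ2 by auto
  thus ?thesis unfolding d_def by blast
qed

section \<open>The Weyl twirl\<close>

lemma weyl_carrier [simp]: "weyl e a b \<in> carrier_mat e e"
proof -
  have "shiftX e \<in> carrier_mat e e" "clockZ e \<in> carrier_mat e e"
    unfolding shiftX_def clockZ_def by auto
  thus ?thesis unfolding weyl_def using mult_carrier_mat pow_carrier_mat by blast
qed

lemma index_shiftX_pow:
  assumes "i < e" "j < e"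
  shows "(shiftX e ^\<^sub>m a) $$ (i,j) = (if i = (j + a) mod e then 1 else 0)"
  using assms
proof (induction a arbitrary: i j)
  case 0
  have "shiftX e \<in> carrier_mat e e" unfolding shiftX_def by simp
  thus ?case using 0 by auto
next
  case (Suc a)
  have c: "shiftX e \<in> carrier_mat e e" unfolding shiftX_def by simp
  have lt: "(j + 1) mod e < e" using Suc.prems by simp
  have "(shiftX e ^\<^sub>m Suc a) $$ (i,j) = (\<Sum>k<e. (shiftX e ^\<^sub>m a) $$ (i,k) * shiftX e $$ (k,j))"
    unfolding pow_mat.simps by (rule index_mult_sum[OF pow_carrier_mat[OF c] c Suc.prems])
  also have "\<dots> = (\<Sum>k<e. if k = (j + 1) mod e then (if i = ((j + 1) mod e + a) mod e then 1 else 0) else 0)"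
  proof (intro sum.cong refl)
    fix k assume "k \<in> {..<e}"
    thus "(shiftX e ^\<^sub>m a) $$ (i,k) * shiftX e $$ (k,j)
        = (if k = (j + 1) mod e then (if i = ((j + 1) mod e + a) mod e then 1 else 0) else 0)"
      using Suc.IH[OF Suc.prems(1), of k] Suc.prems unfolding shiftX_def by simp
  qed
  also have "\<dots> = (if i = ((j + 1) mod e + a) mod e then 1 else 0)" using lt by simp
  also have "((j + 1) mod e + a) mod e = (j + Suc a) mod e" by (simp add: mod_add_left_eq)
  finally show ?case .
qed

lemma index_clockZ_pow:
  assumes "i < e" "j < e"
  shows "(clockZ e ^\<^sub>m b) $$ (i,j) = (if i = j then (cis (2 * pi / real e) ^ j) ^ b else 0)"
  using assms
proof (induction b arbitrary: i j)
  case 0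
  have "clockZ e \<in> carrier_mat e e" unfolding clockZ_def by simp
  thus ?case using 0 by auto
next
  case (Suc b)
  have c: "clockZ e \<in> carrier_mat e e" unfolding clockZ_def by simp
  have "(clockZ e ^\<^sub>m Suc b) $$ (i,j) = (\<Sum>k<e. (clockZ e ^\<^sub>m b) $$ (i,k) * clockZ e $$ (k,j))"
    unfolding pow_mat.simps by (rule index_mult_sum[OF pow_carrier_mat[OF c] c Suc.prems])
  also have "\<dots> = (\<Sum>k<e. if k = j then (if i = j then (cis (2 * pi / real e) ^ j) ^ Suc b else 0) else 0)"
  proof (intro sum.cong refl)
    fix k assume "k \<in> {..<e}"
    thus "(clockZ e ^\<^sub>m b) $$ (i,k) * clockZ e $$ (k,j)
        = (if k = j then (if i = j then (cis (2 * pi / real e) ^ j) ^ Suc b else 0) else 0)"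
      using Suc.IH[OF Suc.prems(1), of k] Suc.prems unfolding clockZ_def by simp
  qed
  finally show ?case using Suc.prems by simp
qed

lemma index_weyl:
  assumes "i < e" "j < e"
  shows "weyl e a b $$ (i,j) = (if i = (j + a) mod e then (cis (2 * pi / real e) ^ j) ^ b else 0)"
proof -
  have c: "shiftX e \<in> carrier_mat e e" "clockZ e \<in> carrier_mat e e"
    unfolding shiftX_def clockZ_def by auto
  have "weyl e a b $$ (i,j) = (\<Sum>k<e. (shiftX e ^\<^sub>m a) $$ (i,k) * (clockZ e ^\<^sub>m b) $$ (k,j))"
    unfolding weyl_def by (rule index_mult_sum[OF pow_carrier_mat[OF c(1)] pow_carrier_mat[OF c(2)] assms])
  also have "\<dots> = (\<Sum>k<e. if k = j then (if i = (j + a) mod e then (cis (2 * pi / real e) ^ j) ^ b else 0) else 0)"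
    using assms by (intro sum.cong refl) (auto simp: index_shiftX_pow index_clockZ_pow)
  finally show ?thesis using assms by simp
qed

text \<open>A geometric sum whose ratio z is an e-th root of unity; as k and l lie below e, the
  ratio is 1 only for k = l.\<close>

lemma root_of_unity_orthogonality:
  assumes kl: "k < e" "l < e"
  defines "\<omega> \<equiv> cis (2 * pi / real e)"
  shows "(\<Sum>c<e. (\<omega> ^ k) ^ c * cnj ((\<omega> ^ l) ^ c)) = (if k = l then of_nat e else 0)"
proof -
  have e: "0 < e" using kl by simp
  have pow: "\<omega> ^ j = cis (2 * pi * real j / real e)" for j
    unfolding \<omega>_def Complex.DeMoivre by (simp add: mult_ac)
  have \<omega>e: "\<omega> ^ e = 1" unfolding pow using e by simp
  have unit: "\<omega> ^ j * cnj (\<omega> ^ j) = 1" for j unfolding pow by (simp add: cis_mult cis_cnj)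
  define z where "z = \<omega> ^ k * cnj (\<omega> ^ l)"
  have "(\<Sum>c<e. (\<omega> ^ k) ^ c * cnj ((\<omega> ^ l) ^ c)) = (\<Sum>c<e. z ^ c)"
    unfolding z_def by (simp add: power_mult_distrib)
  also have "\<dots> = (if k = l then of_nat e else 0)"
  proof (cases "k = l")
    case True
    thus ?thesis unfolding z_def using unit[of l] by simp
  next
    case False
    have "z ^ e = (\<omega> ^ e) ^ k * cnj ((\<omega> ^ e) ^ l)"
      unfolding z_def power_mult_distrib complex_cnj_power power_mult[symmetric] by (simp add: mult.commute)
    hence ze: "z ^ e = 1" unfolding \<omega>e by simp
    have "z \<noteq> 1"
    proof
      assume "z = 1"
      hence "\<omega> ^ k * (\<omega> ^ l * cnj (\<omega> ^ l)) = \<omega> ^ l" unfolding z_def by (simp add: mult_ac)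
      hence "\<omega> ^ k = \<omega> ^ l" unfolding unit by simp
      hence "k = l"
        using inj_onD[OF bij_betw_imp_inj_on[OF bij_betw_roots_unity[OF e]], of k l] kl unfolding pow by simp
      thus False using False by simp
    qed
    hence "(\<Sum>c<e. z ^ c) = 0" using geometric_sum[of z e] ze by simp
    thus ?thesis using False by simp
  qed
  finally show ?thesis .
qed

text \<open>Averaging over the phases \<open>Z\<^sup>c\<close> kills the off-diagonal entries; averaging over the
  shifts \<open>X\<^sup>a\<close> then equalises the diagonal.\<close>

lemma weyl_twirl:
  assumes Y: "Y \<in> carrier_mat e e" and ij: "i < e" "j < e"
  shows "(\<Sum>a<e. \<Sum>c<e. (weyl e a c * Y * mat_adjoint (weyl e a c)) $$ (i,j))
    = (if i = j then of_nat e * mtrace Y else 0)"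
proof -
  define \<omega> where "\<omega> = cis (2 * pi / real e)"
  define s where "s i k a = (if i = (k + a) mod e then 1 else 0 :: complex)" for i k a
  have entry: "(weyl e a c * Y * mat_adjoint (weyl e a c)) $$ (i,j)
      = (\<Sum>k<e. \<Sum>l<e. s i k a * s j l a * Y $$ (k,l) * ((\<omega> ^ k) ^ c * cnj ((\<omega> ^ l) ^ c)))" for a c
  proof -
    have "(weyl e a c * Y * mat_adjoint (weyl e a c)) $$ (i,j)
        = (\<Sum>k<e. \<Sum>l<e. weyl e a c $$ (i,k) * Y $$ (k,l) * mat_adjoint (weyl e a c) $$ (l,j))"
      by (rule index_mult3_sum[OF weyl_carrier Y mat_adjoint_carrier[OF weyl_carrier] ij])
    also have "\<dots> = (\<Sum>k<e. \<Sum>l<e. s i k a * s j l a * Y $$ (k,l) * ((\<omega> ^ k) ^ c * cnj ((\<omega> ^ l) ^ c)))"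
      using ij carrier_matD[OF weyl_carrier[of e a c]]
      by (intro sum.cong refl) (auto simp: index_weyl s_def \<omega>_def)
    finally show ?thesis .
  qed
  \<comment> \<open>For fixed k the map sending a to (k + a) mod e permutes the residues, so exactly
    one shift carries k to i, and it carries k to j only if i = j.\<close>
  have one_shift: "(\<Sum>a<e. s i k a * s j k a) = (if i = j then 1 else 0)" if k: "k < e" for k
  proof -
    have "bij_betw (\<lambda>a. (k + a) mod e) {..<e} {..<e}"
    proof (rule bij_betw_byWitness[where f' = "\<lambda>i. (i + (e - k)) mod e"])
      show "\<forall>a\<in>{..<e}. ((k + a) mod e + (e - k)) mod e = a"
      proof
        fix a assume a: "a \<in> {..<e}"
        have "((k + a) mod e + (e - k)) mod e = (k + a + (e - k)) mod e" by (rule mod_add_left_eq)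
        also have "k + a + (e - k) = a + e" using k by simp
        finally show "((k + a) mod e + (e - k)) mod e = a" using a by simp
      qed
      show "\<forall>a\<in>{..<e}. (k + (a + (e - k)) mod e) mod e = a"
      proof
        fix a assume a: "a \<in> {..<e}"
        have "(k + (a + (e - k)) mod e) mod e = (k + (a + (e - k))) mod e" by (rule mod_add_right_eq)
        also have "k + (a + (e - k)) = a + e" using k by simp
        finally show "(k + (a + (e - k)) mod e) mod e = a" using a by simp
      qed
    qed (use k in auto)
    hence "(\<Sum>a<e. (if i = (k + a) mod e then 1 else 0) * (if j = (k + a) mod e then 1 else 0 :: complex))
        = (\<Sum>x<e. (if i = x then 1 else 0) * (if j = x then 1 else 0))"
      by (rule sum.reindex_bij_betw)
    also have "\<dots> = (\<Sum>x<e. if x = i then (if i = j then 1 else 0) else 0)"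
      by (intro sum.cong refl) auto
    finally show ?thesis unfolding s_def using ij by simp
  qed
  have "(\<Sum>a<e. \<Sum>c<e. (weyl e a c * Y * mat_adjoint (weyl e a c)) $$ (i,j))
      = (\<Sum>a<e. \<Sum>k<e. \<Sum>l<e. s i k a * s j l a * Y $$ (k,l) * (\<Sum>c<e. (\<omega> ^ k) ^ c * cnj ((\<omega> ^ l) ^ c)))"
    unfolding entry sum_distrib_left
    by (rule sum.cong[OF refl], subst sum.swap, rule sum.cong[OF refl], rule sum.swap)
  also have "\<dots> = (\<Sum>a<e. \<Sum>k<e. of_nat e * Y $$ (k,k) * (s i k a * s j k a))"
  proof (intro sum.cong refl)
    fix a k assume "k \<in> {..<e}"
    hence k: "k < e" by simp
    have "(\<Sum>l<e. s i k a * s j l a * Y $$ (k,l) * (\<Sum>c<e. (\<omega> ^ k) ^ c * cnj ((\<omega> ^ l) ^ c)))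
        = (\<Sum>l<e. if l = k then s i k a * s j k a * Y $$ (k,k) * of_nat e else 0)"
    proof (intro sum.cong refl)
      fix l assume "l \<in> {..<e}"
      thus "s i k a * s j l a * Y $$ (k,l) * (\<Sum>c<e. (\<omega> ^ k) ^ c * cnj ((\<omega> ^ l) ^ c))
          = (if l = k then s i k a * s j k a * Y $$ (k,k) * of_nat e else 0)"
        using root_of_unity_orthogonality[OF k, of l] unfolding \<omega>_def by simp
    qed
    thus "(\<Sum>l<e. s i k a * s j l a * Y $$ (k,l) * (\<Sum>c<e. (\<omega> ^ k) ^ c * cnj ((\<omega> ^ l) ^ c)))
        = of_nat e * Y $$ (k,k) * (s i k a * s j k a)" using k by simp
  qed
  also have "\<dots> = (\<Sum>k<e. of_nat e * Y $$ (k,k) * (\<Sum>a<e. s i k a * s j k a))"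
    unfolding sum_distrib_left by (rule sum.swap)
  also have "\<dots> = (if i = j then of_nat e * mtrace Y else 0)"
    using Y by (simp add: one_shift mtrace_def sum_distrib_left)
  finally show ?thesis .
qed

text \<open>Block-diagonal operators with respect to the range of Q and its complement multiply
  blockwise. The one-sided orthogonality conditions remove both cross terms, and Q^* Q = 1 joins the
  two inner blocks.\<close>

lemma block_mult:
  fixes Q :: "complex mat"
  assumes Q: "Q \<in> carrier_mat N e" "mat_adjoint Q * Q = 1\<^sub>m e"
    and R: "R \<in> carrier_mat N N" "R * Q = 0\<^sub>m N e"
    and S: "S \<in> carrier_mat N N" "mat_adjoint Q * S = 0\<^sub>m e N"
    and Z: "Z \<in> carrier_mat e e" and T: "T \<in> carrier_mat e e"
  shows "(R + Q * Z * mat_adjoint Q) * (S + Q * T * mat_adjoint Q) = R * S + Q * (Z * T) * mat_adjoint Q"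
proof -
  let ?B = "mat_adjoint Q"
  have B: "?B \<in> carrier_mat e N" using Q by simp
  have QZ: "Q * Z \<in> carrier_mat N e" and QT: "Q * T \<in> carrier_mat N e" using Q Z T by auto
  have ZB: "Q * Z * ?B \<in> carrier_mat N N" and TB: "Q * T * ?B \<in> carrier_mat N N"
    using mult_carrier_mat[OF QZ B] mult_carrier_mat[OF QT B] by auto
  have ZTB: "Q * (Z * T) * ?B \<in> carrier_mat N N"
    by (rule mult_carrier_mat[OF mult_carrier_mat[OF Q(1) mult_carrier_mat[OF Z T]] B])
  have RS: "R * S \<in> carrier_mat N N" using R S by simp
  have e1: "R * (Q * T * ?B) = 0\<^sub>m N N"
  proof -
    have "R * (Q * T * ?B) = R * Q * (T * ?B)"
      by (simp only: assoc_mult_mat[OF Q(1) T B] assoc_mult_mat[OF R(1) Q(1) mult_carrier_mat[OF T B]])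
    thus ?thesis unfolding R(2) using left_mult_zero_mat[OF mult_carrier_mat[OF T B]] by simp
  qed
  have e2: "Q * Z * ?B * S = 0\<^sub>m N N"
    unfolding assoc_mult_mat[OF QZ B S(1)] S(2) by (rule right_mult_zero_mat[OF QZ])
  have e3: "Q * Z * ?B * (Q * T * ?B) = Q * (Z * T) * ?B"
  proof -
    have "Q * Z * ?B * (Q * T * ?B) = Q * Z * ((?B * Q) * (T * ?B))"
      by (simp only: assoc_mult_mat[OF Q(1) T B] assoc_mult_mat[OF QZ B mult_carrier_mat[OF Q(1) mult_carrier_mat[OF T B]]]
        assoc_mult_mat[OF B Q(1) mult_carrier_mat[OF T B]])
    also have "\<dots> = Q * Z * (T * ?B)" unfolding Q(2) using left_mult_one_mat[OF mult_carrier_mat[OF T B]] by simp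
    also have "\<dots> = Q * (Z * T) * ?B"
      by (simp only: assoc_mult_mat[OF Q(1) Z mult_carrier_mat[OF T B]] assoc_mult_mat[OF Z T B]
        assoc_mult_mat[OF Q(1) mult_carrier_mat[OF Z T] B])
    finally show ?thesis .
  qed
  have "(R + Q * Z * ?B) * (S + Q * T * ?B) = R * S + 0\<^sub>m N N + (0\<^sub>m N N + Q * (Z * T) * ?B)"
    unfolding add_mult_distrib_mat[OF R(1) ZB add_carrier_mat[OF TB]]
      mult_add_distrib_mat[OF R(1) S(1) TB] mult_add_distrib_mat[OF ZB S(1) TB] e1 e2 e3 ..
  thus ?thesis using RS ZTB by simp
qed

section \<open>The mixed-unitary approximation in closed form\<close>

text \<open>This is \<open>(\<langle>v| \<otimes> 1) \<rho> (|v\<rangle> \<otimes> 1)\<close>, the block of \<open>\<rho>\<close> on \<open>S\<^sub>0\<close>.\<close>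

definition compress :: "nat \<Rightarrow> nat \<Rightarrow> complex vec \<Rightarrow> complex mat \<Rightarrow> complex mat" where
  "compress n d v \<rho> = mat n n (\<lambda>(s,t). \<Sum>a<d. \<Sum>a'<d. cnj (v $ a) * \<rho> $$ (a * n + s, a' * n + t) * v $ a')"

lemma compress_carrier [simp]: "compress n d v \<rho> \<in> carrier_mat n n"
  unfolding compress_def by simp

text \<open>An arbitrary dilation is fixed, since the choice of \<open>dil\<close> is arbitrary too;
  nothing here refers to the particular dilation constructed above.\<close>

locale dilated_channel =
  fixes n m d b :: nat and \<Phi> :: "complex mat \<Rightarrow> complex mat"
    and v :: "complex vec" and U Q :: "complex mat"
  assumes npos: "0 < n" and channel: "is_channel n m \<Phi>"
    and dilation: "is_dilation n m \<Phi> d (b, v, U, Q)"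
begin

abbreviation "N \<equiv> d * n"
abbreviation "e \<equiv> d * n - n"
abbreviation "P0 \<equiv> S0_proj n v"
abbreviation "Qa \<equiv> mat_adjoint Q"

lemma N_eq: "N = m * b"
  and v_carrier: "v \<in> carrier_vec d"
  and v_norm: "(\<Sum>i<d. cnj (v $ i) * v $ i) = 1"
  and U_unitary: "unitary_mat N U"
  and \<Phi>_eq: "X \<in> carrier_mat n n \<Longrightarrow> \<Phi> X = ptrace_B m b (U * mtensor (proj_vec v) X * mat_adjoint U)"
  and Q_carrier: "Q \<in> carrier_mat N e"
  and QaQ: "Qa * Q = 1\<^sub>m e"
  and QQa: "Q * Qa = 1\<^sub>m N - P0"
  using dilation unfolding is_dilation_def prod.case by blast+

lemmas U_carrier = unitary_matD(1)[OF U_unitary]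

lemma d_pos: "0 < d"
  using v_norm by (cases d) auto

lemma b_pos: "0 < b"
  using N_eq d_pos npos by (metis mult_is_0 neq0_conv)

lemma Qa_carrier: "Qa \<in> carrier_mat e N"
  using Q_carrier by (rule mat_adjoint_carrier)

lemma proj_carrier: "proj_vec v \<in> carrier_mat d d"
  unfolding proj_vec_def using v_carrier by simp

lemma tensor_carrier: "X \<in> carrier_mat n n \<Longrightarrow> mtensor (proj_vec v) X \<in> carrier_mat N N"
  using mtensor_carrier[OF proj_carrier] .

lemma P0_carrier: "P0 \<in> carrier_mat N N"
  unfolding S0_proj_def by (rule tensor_carrier) simp

lemma index_tensor:
  assumes "X \<in> carrier_mat n n" "i < N" "j < N"
  shows "mtensor (proj_vec v) X $$ (i,j) = v $ (i div n) * cnj (v $ (j div n)) * X $$ (i mod n, j mod n)"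
  unfolding index_mtensor[OF proj_carrier assms]
  using index_pair_div_mod[OF assms(2)] index_pair_div_mod[OF assms(3)] v_carrier
  by (simp add: proj_vec_def)

lemma index_P0:
  assumes "i < N" "j < N"
  shows "P0 $$ (i,j) = (if i mod n = j mod n then v $ (i div n) * cnj (v $ (j div n)) else 0)"
  unfolding S0_proj_def index_tensor[OF one_carrier_mat assms] using npos by simp

lemma P0_adjoint: "mat_adjoint P0 = P0"
  by (rule eq_matI) (use P0_carrier in \<open>auto simp: index_P0\<close>)

lemma P0_eq: "P0 = 1\<^sub>m N - Q * Qa"
  unfolding QQa by (rule eq_matI) (use P0_carrier in auto)

lemma QQa_carrier: "Q * Qa \<in> carrier_mat N N"
  by (rule mult_carrier_mat[OF Q_carrier Qa_carrier])

lemma P0_Q: "P0 * Q = 0\<^sub>m N e"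
proof -
  have "P0 * Q = 1\<^sub>m N * Q - Q * Qa * Q"
    unfolding P0_eq by (rule minus_mult_distrib_mat[OF one_carrier_mat QQa_carrier Q_carrier])
  also have "Q * Qa * Q = Q"
    unfolding assoc_mult_mat[OF Q_carrier Qa_carrier Q_carrier] QaQ
    by (rule right_mult_one_mat[OF Q_carrier])
  also have "1\<^sub>m N * Q = Q" by (rule left_mult_one_mat[OF Q_carrier])
  finally show ?thesis using minus_r_inv_mat[OF Q_carrier] by simp
qed

lemma Qa_P0: "Qa * P0 = 0\<^sub>m e N"
proof -
  have "Qa * P0 = Qa * 1\<^sub>m N - Qa * (Q * Qa)"
    unfolding P0_eq by (rule mult_minus_distrib_mat[OF Qa_carrier one_carrier_mat QQa_carrier])
  also have "Qa * (Q * Qa) = Qa"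
    unfolding assoc_mult_mat[OF Qa_carrier Q_carrier Qa_carrier, symmetric] QaQ
    by (rule left_mult_one_mat[OF Qa_carrier])
  also have "Qa * 1\<^sub>m N = Qa" by (rule right_mult_one_mat[OF Qa_carrier])
  finally show ?thesis using minus_r_inv_mat[OF Qa_carrier] by simp
qed

lemma P0_idem: "P0 * P0 = P0"
proof -
  have "P0 * P0 = P0 * 1\<^sub>m N - P0 * (Q * Qa)"
    by (subst (2) P0_eq, rule mult_minus_distrib_mat[OF P0_carrier one_carrier_mat QQa_carrier])
  also have "P0 * (Q * Qa) = 0\<^sub>m N N"
    unfolding assoc_mult_mat[OF P0_carrier Q_carrier Qa_carrier, symmetric] P0_Q
    by (rule left_mult_zero_mat[OF Qa_carrier])
  also have "P0 * 1\<^sub>m N = P0" by (rule right_mult_one_mat[OF P0_carrier])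
  finally show ?thesis using P0_carrier by (auto intro!: eq_matI)
qed

lemma P0_conj_carrier: "\<rho> \<in> carrier_mat N N \<Longrightarrow> P0 * \<rho> * P0 \<in> carrier_mat N N"
  using mult_carrier_mat[OF mult_carrier_mat[OF P0_carrier] P0_carrier] .

text \<open>P0 is |v><v| \<otimes> 1, so compressing \<rho> by it leaves |v><v| tensored with the
  partial matrix element of \<rho> at v.\<close>

lemma P0_conj:
  assumes \<rho>: "\<rho> \<in> carrier_mat N N"
  shows "P0 * \<rho> * P0 = mtensor (proj_vec v) (compress n d v \<rho>)"
proof (rule eq_matI)
  have T: "mtensor (proj_vec v) (compress n d v \<rho>) \<in> carrier_mat N N" by (rule tensor_carrier) simp
  note P = P0_conj_carrier[OF \<rho>]
  show "dim_row (P0 * \<rho> * P0) = dim_row (mtensor (proj_vec v) (compress n d v \<rho>))"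
    "dim_col (P0 * \<rho> * P0) = dim_col (mtensor (proj_vec v) (compress n d v \<rho>))"
    unfolding carrier_matD[OF T] carrier_matD[OF P] by auto
  fix i j assume "i < dim_row (mtensor (proj_vec v) (compress n d v \<rho>))"
    "j < dim_col (mtensor (proj_vec v) (compress n d v \<rho>))"
  hence ij: "i < N" "j < N" unfolding carrier_matD[OF T] by auto
  note i = index_pair_div_mod[OF ij(1)] and j = index_pair_div_mod[OF ij(2)]
  let ?g = "\<lambda>a s a' t. (if i mod n = s then v $ (i div n) * cnj (v $ a) else 0) * \<rho> $$ (a * n + s, a' * n + t)
     * (if t = j mod n then v $ a' * cnj (v $ (j div n)) else 0)"
  have "(P0 * \<rho> * P0) $$ (i,j) = (\<Sum>k<N. \<Sum>l<N. P0 $$ (i,k) * \<rho> $$ (k,l) * P0 $$ (l,j))"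
    by (rule index_mult3_sum[OF P0_carrier \<rho> P0_carrier ij])
  also have "\<dots> = (\<Sum>k<N. \<Sum>l<N. ?g (k div n) (k mod n) (l div n) (l mod n))"
    using ij by (intro sum.cong refl) (simp add: index_P0)
  also have "\<dots> = (\<Sum>k<N. \<Sum>a'<d. \<Sum>t<n. ?g (k div n) (k mod n) a' t)"
    by (intro sum.cong refl sum_index_pair)
  also have "\<dots> = (\<Sum>a<d. \<Sum>s<n. \<Sum>a'<d. \<Sum>t<n. ?g a s a' t)"
    by (rule sum_index_pair)
  also have "\<dots> = (\<Sum>a<d. \<Sum>a'<d. \<Sum>s<n. \<Sum>t<n. ?g a s a' t)"
    by (intro sum.cong refl sum.swap)
  also have "\<dots> = (\<Sum>a<d. \<Sum>a'<d. v $ (i div n) * cnj (v $ (j div n)) *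
      (cnj (v $ a) * \<rho> $$ (a * n + i mod n, a' * n + j mod n) * v $ a'))"
  proof (intro sum.cong refl)
    fix a a'
    have "(\<Sum>s<n. \<Sum>t<n. ?g a s a' t) = (\<Sum>s<n. \<Sum>t<n. if s = i mod n \<and> t = j mod n
        then v $ (i div n) * cnj (v $ (j div n)) * (cnj (v $ a) * \<rho> $$ (a * n + s, a' * n + t) * v $ a') else 0)"
      by (intro sum.cong refl) auto
    also have "\<dots> = v $ (i div n) * cnj (v $ (j div n)) * (cnj (v $ a) * \<rho> $$ (a * n + i mod n, a' * n + j mod n) * v $ a')"
      by (rule sum_sum_delta[OF i(2) j(2)])
    finally show "(\<Sum>s<n. \<Sum>t<n. ?g a s a' t) = \<dots>" .
  qed
  also have "\<dots> = mtensor (proj_vec v) (compress n d v \<rho>) $$ (i,j)"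
    unfolding index_tensor[OF compress_carrier ij] using i j
    by (simp add: compress_def sum_distrib_left)
  finally show "(P0 * \<rho> * P0) $$ (i,j) = mtensor (proj_vec v) (compress n d v \<rho>) $$ (i,j)" .
qed

text \<open>With P1 = 1 - P0, conjugation by P0 - P1 reverses the sign of the cross terms P0 \<rho>
  P1 and P1 \<rho> P0, so they cancel in the average with \<rho>.\<close>

lemma dephasing:
  assumes \<rho>: "\<rho> \<in> carrier_mat N N"
  shows "(1 / 2) \<cdot>\<^sub>m ((P0 - (1\<^sub>m N - P0)) * \<rho> * mat_adjoint (P0 - (1\<^sub>m N - P0)) + \<rho>)
    = P0 * \<rho> * P0 + Q * (Qa * \<rho> * Q) * Qa"
proof -
  define P1 where "P1 = 1\<^sub>m N - P0"
  let ?V = "P0 - P1"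
  have P1: "P1 \<in> carrier_mat N N" unfolding P1_def by (rule minus_carrier_mat[OF P0_carrier])
  have V: "?V \<in> carrier_mat N N" by (rule minus_carrier_mat[OF P1])
  have P1a: "cnj (P1 $$ (i,j)) = P1 $$ (j,i)" if "i < N" "j < N" for i j
    using that P0_carrier by (auto simp: P1_def index_P0)
  have P0a: "cnj (P0 $$ (i,j)) = P0 $$ (j,i)" if "i < N" "j < N" for i j
    using that by (auto simp: index_P0)
  have Va: "mat_adjoint ?V = ?V"
    by (rule eq_matI) (use P0_carrier P1 in \<open>auto simp: P0a P1a\<close>)
  have P1Q: "P1 * \<rho> * P1 = Q * (Qa * \<rho> * Q) * Qa"
  proof -
    note QR = mult_carrier_mat[OF Qa_carrier \<rho>]
    have "P1 * \<rho> * P1 = Q * Qa * \<rho> * (Q * Qa)" unfolding P1_def QQa ..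
    also have "\<dots> = Q * (Qa * \<rho>) * (Q * Qa)"
      by (simp only: assoc_mult_mat[OF Q_carrier Qa_carrier \<rho>])
    also have "\<dots> = Q * (Qa * \<rho>) * Q * Qa"
      by (simp only: assoc_mult_mat[OF mult_carrier_mat[OF Q_carrier QR] Q_carrier Qa_carrier])
    also have "\<dots> = Q * (Qa * \<rho> * Q) * Qa"
      by (simp only: assoc_mult_mat[OF Q_carrier QR Q_carrier])
    finally show ?thesis .
  qed
  have one: "P0 + P1 = 1\<^sub>m N" unfolding P1_def by (rule eq_matI) (use P0_carrier in auto)
  have S: "P0 + P1 \<in> carrier_mat N N" by (rule add_carrier_mat[OF P1])
  \<comment> \<open>Sandwiching \<rho> by P0 + P1 = 1 gives it the same shape as the term with P0 -
    P1, so that the cancellation can be checked summand by summand.\<close>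
  have \<rho>1: "\<rho> = (P0 + P1) * \<rho> * (P0 + P1)"
    unfolding one using left_mult_one_mat[OF \<rho>] right_mult_one_mat[OF \<rho>] by simp
  have c1: "P1 * \<rho> * P1 \<in> carrier_mat N N" and cV: "?V * \<rho> * ?V \<in> carrier_mat N N"
    using mult_carrier_mat[OF mult_carrier_mat[OF P1 \<rho>] P1] mult_carrier_mat[OF mult_carrier_mat[OF V \<rho>] V] by auto
  have "(1 / 2) \<cdot>\<^sub>m (?V * \<rho> * ?V + \<rho>) = P0 * \<rho> * P0 + P1 * \<rho> * P1" (is "?L = ?R")
  proof (rule eq_matI)
    show "dim_row ?L = dim_row ?R" "dim_col ?L = dim_col ?R" using c1 \<rho> by auto
    fix i j assume "i < dim_row ?R" "j < dim_col ?R"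
    hence ij: "i < N" "j < N" using c1 by auto
    note dV = carrier_matD[OF cV] and d0 = carrier_matD[OF P0_conj_carrier[OF \<rho>]] and d1 = carrier_matD[OF c1]
    have "?L $$ (i,j) = 1 / 2 * ((?V * \<rho> * ?V) $$ (i,j) + ((P0 + P1) * \<rho> * (P0 + P1)) $$ (i,j))"
      using ij dV carrier_matD[OF \<rho>] by (simp flip: \<rho>1 del: index_mult_mat(1))
    also have "\<dots> = (\<Sum>k<N. \<Sum>l<N. 1 / 2 * (?V $$ (i,k) * \<rho> $$ (k,l) * ?V $$ (l,j)
        + (P0 + P1) $$ (i,k) * \<rho> $$ (k,l) * (P0 + P1) $$ (l,j)))"
      unfolding index_mult3_sum[OF V \<rho> V ij] index_mult3_sum[OF S \<rho> S ij]
      by (simp only: sum.distrib sum_distrib_left[symmetric])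
    also have "\<dots> = (\<Sum>k<N. \<Sum>l<N. P0 $$ (i,k) * \<rho> $$ (k,l) * P0 $$ (l,j) + P1 $$ (i,k) * \<rho> $$ (k,l) * P1 $$ (l,j))"
    proof (intro sum.cong refl)
      fix k l assume "k \<in> {..<N}" "l \<in> {..<N}"
      hence "?V $$ (i,k) = P0 $$ (i,k) - P1 $$ (i,k)" "(P0 + P1) $$ (i,k) = P0 $$ (i,k) + P1 $$ (i,k)"
        "?V $$ (l,j) = P0 $$ (l,j) - P1 $$ (l,j)" "(P0 + P1) $$ (l,j) = P0 $$ (l,j) + P1 $$ (l,j)"
        using ij carrier_matD[OF P0_carrier] carrier_matD[OF P1] by auto
      thus "1 / 2 * (?V $$ (i,k) * \<rho> $$ (k,l) * ?V $$ (l,j)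
        + (P0 + P1) $$ (i,k) * \<rho> $$ (k,l) * (P0 + P1) $$ (l,j))
        = P0 $$ (i,k) * \<rho> $$ (k,l) * P0 $$ (l,j) + P1 $$ (i,k) * \<rho> $$ (k,l) * P1 $$ (l,j)"
        by (simp only:) (simp add: field_simps)
    qed
    also have "\<dots> = (P0 * \<rho> * P0) $$ (i,j) + (P1 * \<rho> * P1) $$ (i,j)"
      unfolding index_mult3_sum[OF P0_carrier \<rho> P0_carrier ij] index_mult3_sum[OF P1 \<rho> P1 ij]
      by (simp add: sum.distrib)
    also have "\<dots> = ?R $$ (i,j)" using ij d0 d1 by (simp del: index_mult_mat(1))
    finally show "?L $$ (i,j) = ?R $$ (i,j)" .
  qed
  thus ?thesis unfolding P1Q[symmetric] P1_def[symmetric] Va .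
qed

text \<open>Cyclicity of the trace turns the left side into the trace of \<rho> against Q Q^* = 1 -
  P0.\<close>

lemma mtrace_complement:
  assumes \<rho>: "\<rho> \<in> carrier_mat N N"
  shows "mtrace (Qa * \<rho> * Q) = mtrace \<rho> - mtrace (compress n d v \<rho>)"
proof -
  have "mtrace (Qa * \<rho> * Q) = (\<Sum>k<e. \<Sum>i<N. \<Sum>j<N. \<rho> $$ (i,j) * (Q $$ (j,k) * Qa $$ (k,i)))"
    unfolding mtrace_def carrier_matD(1)[OF mult_carrier_mat[OF mult_carrier_mat[OF Qa_carrier \<rho>] Q_carrier]]
  proof (intro sum.cong refl)
    fix k assume "k \<in> {..<e}"
    hence k: "k < e" by simp
    show "(Qa * \<rho> * Q) $$ (k,k) = (\<Sum>i<N. \<Sum>j<N. \<rho> $$ (i,j) * (Q $$ (j,k) * Qa $$ (k,i)))"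
      unfolding index_mult3_sum[OF Qa_carrier \<rho> Q_carrier k k] by (simp add: mult_ac)
  qed
  also have "\<dots> = (\<Sum>i<N. \<Sum>k<e. \<Sum>j<N. \<rho> $$ (i,j) * (Q $$ (j,k) * Qa $$ (k,i)))"
    by (rule sum.swap)
  also have "\<dots> = (\<Sum>i<N. \<Sum>j<N. \<Sum>k<e. \<rho> $$ (i,j) * (Q $$ (j,k) * Qa $$ (k,i)))"
    by (intro sum.cong refl sum.swap)
  also have "\<dots> = (\<Sum>i<N. \<Sum>j<N. (if j = i then \<rho> $$ (i,j) else 0) - P0 $$ (j,i) * \<rho> $$ (i,j))"
  proof (intro sum.cong refl)
    fix i j assume "i \<in> {..<N}" "j \<in> {..<N}"
    hence ij: "j < N" "i < N" by auto
    have "(\<Sum>k<e. \<rho> $$ (i,j) * (Q $$ (j,k) * Qa $$ (k,i))) = \<rho> $$ (i,j) * (Q * Qa) $$ (j,i)"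
      unfolding index_mult_sum[OF Q_carrier Qa_carrier ij] sum_distrib_left ..
    also have "(Q * Qa) $$ (j,i) = (if j = i then 1 else 0) - P0 $$ (j,i)"
      unfolding QQa using ij P0_carrier by simp
    finally show "(\<Sum>k<e. \<rho> $$ (i,j) * (Q $$ (j,k) * Qa $$ (k,i)))
        = (if j = i then \<rho> $$ (i,j) else 0) - P0 $$ (j,i) * \<rho> $$ (i,j)"
      by (simp add: algebra_simps)
  qed
  also have "\<dots> = mtrace \<rho> - (\<Sum>i<N. \<Sum>j<N. P0 $$ (j,i) * \<rho> $$ (i,j))"
    using \<rho> by (simp add: sum_subtractf mtrace_def)
  also have "(\<Sum>i<N. \<Sum>j<N. P0 $$ (j,i) * \<rho> $$ (i,j)) = mtrace (compress n d v \<rho>)"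
  proof -
    let ?g = "\<lambda>a s a' t. if t = s then cnj (v $ a) * \<rho> $$ (a * n + s, a' * n + t) * v $ a' else 0"
    have "(\<Sum>i<N. \<Sum>j<N. P0 $$ (j,i) * \<rho> $$ (i,j)) = (\<Sum>i<N. \<Sum>j<N. ?g (i div n) (i mod n) (j div n) (j mod n))"
    proof (intro sum.cong refl)
      fix i j assume "i \<in> {..<N}" "j \<in> {..<N}"
      moreover have "j mod n = i mod n \<Longrightarrow> j div n * n + i mod n = j" by (metis div_mult_mod_eq)
      ultimately show "P0 $$ (j,i) * \<rho> $$ (i,j) = ?g (i div n) (i mod n) (j div n) (j mod n)"
        by (simp add: index_P0)
    qed
    also have "\<dots> = (\<Sum>i<N. \<Sum>a'<d. \<Sum>t<n. ?g (i div n) (i mod n) a' t)"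
      by (intro sum.cong refl sum_index_pair)
    also have "\<dots> = (\<Sum>a<d. \<Sum>s<n. \<Sum>a'<d. \<Sum>t<n. ?g a s a' t)" by (rule sum_index_pair)
    also have "\<dots> = (\<Sum>a<d. \<Sum>s<n. \<Sum>a'<d. cnj (v $ a) * \<rho> $$ (a * n + s, a' * n + s) * v $ a')"
      by (intro sum.cong refl) simp
    also have "\<dots> = (\<Sum>s<n. \<Sum>a<d. \<Sum>a'<d. cnj (v $ a) * \<rho> $$ (a * n + s, a' * n + s) * v $ a')"
      by (rule sum.swap)
    finally show ?thesis by (simp add: mtrace_def compress_def)
  qed
  finally show ?thesis .
qed

text \<open>After dephasing the state is block diagonal. Each G fixes the S_0 block, which thus
  appears e^2 times, while the Weyl sum turns the other block into e times its trace times the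
  identity; dividing by e^2 gives the result.\<close>

lemma twirling:
  assumes \<rho>: "\<rho> \<in> carrier_mat N N" and e: "0 < e" and ij: "i < N" "j < N"
    and G: "\<And>a c. G a c = P0 + Q * weyl e a c * Qa"
  shows "1 / (of_nat e)\<^sup>2 * (\<Sum>a<e. \<Sum>c<e.
      (G a c * (P0 * \<rho> * P0 + Q * (Qa * \<rho> * Q) * Qa) * mat_adjoint (G a c)) $$ (i,j))
    = (P0 * \<rho> * P0) $$ (i,j) + mtrace (Qa * \<rho> * Q) / of_nat e * (Q * Qa) $$ (i,j)"
proof -
  let ?Y = "Qa * \<rho> * Q"
  have Y: "?Y \<in> carrier_mat e e" by (rule mult_carrier_mat[OF mult_carrier_mat[OF Qa_carrier \<rho>] Q_carrier])
  note R = P0_conj_carrier[OF \<rho>]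
  have PR: "P0 * (P0 * \<rho> * P0) = P0 * \<rho> * P0"
  proof -
    have "P0 * (P0 * \<rho> * P0) = P0 * P0 * \<rho> * P0"
      by (simp only: assoc_mult_mat[of _ N N _ N _ N] mult_carrier_mat[of _ N N _ N] P0_carrier \<rho>)
    thus ?thesis unfolding P0_idem .
  qed
  have RP: "P0 * \<rho> * P0 * P0 = P0 * \<rho> * P0"
    unfolding assoc_mult_mat[OF mult_carrier_mat[OF P0_carrier \<rho>] P0_carrier P0_carrier] P0_idem ..
  have QR: "Qa * (P0 * \<rho> * P0) = 0\<^sub>m e N"
  proof -
    have "Qa * (P0 * \<rho> * P0) = Qa * P0 * (\<rho> * P0)"
      by (simp only: assoc_mult_mat[OF P0_carrier \<rho> P0_carrier]
        assoc_mult_mat[OF Qa_carrier P0_carrier mult_carrier_mat[OF \<rho> P0_carrier]])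
    thus ?thesis unfolding Qa_P0 using left_mult_zero_mat[OF mult_carrier_mat[OF \<rho> P0_carrier]] by simp
  qed
  have RQ: "P0 * \<rho> * P0 * Q = 0\<^sub>m N e"
    unfolding assoc_mult_mat[OF mult_carrier_mat[OF P0_carrier \<rho>] P0_carrier Q_carrier] P0_Q
    by (rule right_mult_zero_mat[OF mult_carrier_mat[OF P0_carrier \<rho>]])
  have entry: "(G a c * (P0 * \<rho> * P0 + Q * ?Y * Qa) * mat_adjoint (G a c)) $$ (i,j)
      = (P0 * \<rho> * P0) $$ (i,j) + (\<Sum>k<e. \<Sum>l<e. Q $$ (i,k) *
          (weyl e a c * ?Y * mat_adjoint (weyl e a c)) $$ (k,l) * Qa $$ (l,j))" for a c
  proof -
    let ?W = "weyl e a c" and ?Wa = "mat_adjoint (weyl e a c)"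
    have Wa: "?Wa \<in> carrier_mat e e" by (rule mat_adjoint_carrier[OF weyl_carrier])
    have WY: "?W * ?Y \<in> carrier_mat e e" by (rule mult_carrier_mat[OF weyl_carrier Y])
    have WYW: "?W * ?Y * ?Wa \<in> carrier_mat e e" by (rule mult_carrier_mat[OF WY Wa])
    have QW: "Q * ?W \<in> carrier_mat N e" by (rule mult_carrier_mat[OF Q_carrier weyl_carrier])
    have QWQ: "Q * ?W * Qa \<in> carrier_mat N N" by (rule mult_carrier_mat[OF QW Qa_carrier])
    have QZQ: "Q * (?W * ?Y * ?Wa) * Qa \<in> carrier_mat N N"
      by (rule mult_carrier_mat[OF mult_carrier_mat[OF Q_carrier WYW] Qa_carrier])
    have "mat_adjoint (Q * ?W * Qa) = Q * ?Wa * Qa"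
      unfolding mat_adjoint_mult[OF QW Qa_carrier] mat_adjoint_mult[OF Q_carrier weyl_carrier] mat_adjoint_adjoint
      by (rule assoc_mult_mat[OF Q_carrier Wa Qa_carrier, symmetric])
    moreover have "mat_adjoint (P0 + Q * ?W * Qa) = mat_adjoint P0 + mat_adjoint (Q * ?W * Qa)"
      by (rule eq_matI) (use carrier_matD[OF P0_carrier] carrier_matD[OF QWQ] in \<open>auto simp del: index_mult_mat(1)\<close>)
    ultimately have Ga: "mat_adjoint (G a c) = P0 + Q * ?Wa * Qa"
      unfolding G P0_adjoint by simp
    have "G a c * (P0 * \<rho> * P0 + Q * ?Y * Qa) * mat_adjoint (G a c)
        = (P0 * \<rho> * P0 + Q * (?W * ?Y) * Qa) * (P0 + Q * ?Wa * Qa)"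
      unfolding G Ga[unfolded G]
        block_mult[OF Q_carrier QaQ P0_carrier P0_Q R QR weyl_carrier Y] PR ..
    also have "\<dots> = P0 * \<rho> * P0 + Q * (?W * ?Y * ?Wa) * Qa"
      unfolding block_mult[OF Q_carrier QaQ R RQ P0_carrier Qa_P0 WY Wa] RP ..
    finally show ?thesis
      using ij carrier_matD[OF R] carrier_matD[OF QZQ] index_mult3_sum[OF Q_carrier WYW Qa_carrier ij]
      by (simp del: index_mult_mat(1))
  qed
  have "(\<Sum>a<e. \<Sum>c<e. (G a c * (P0 * \<rho> * P0 + Q * ?Y * Qa) * mat_adjoint (G a c)) $$ (i,j))
      = (of_nat e)\<^sup>2 * (P0 * \<rho> * P0) $$ (i,j) + (\<Sum>a<e. \<Sum>c<e. \<Sum>k<e. \<Sum>l<e. Q $$ (i,k) *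
          (weyl e a c * ?Y * mat_adjoint (weyl e a c)) $$ (k,l) * Qa $$ (l,j))"
    unfolding entry sum.distrib by (simp add: power2_eq_square del: index_mult_mat(1))
  also have "(\<Sum>a<e. \<Sum>c<e. \<Sum>k<e. \<Sum>l<e. Q $$ (i,k) *
          (weyl e a c * ?Y * mat_adjoint (weyl e a c)) $$ (k,l) * Qa $$ (l,j))
      = (\<Sum>k<e. \<Sum>l<e. \<Sum>a<e. \<Sum>c<e. Q $$ (i,k) *
          (weyl e a c * ?Y * mat_adjoint (weyl e a c)) $$ (k,l) * Qa $$ (l,j))"
    unfolding sum.cartesian_product by (rule sum.reindex_bij_witness[where
      i = "\<lambda>(k,l,a,c). (a,c,k,l)" and j = "\<lambda>(a,c,k,l). (k,l,a,c)"]) auto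
  also have "\<dots> = (\<Sum>k<e. \<Sum>l<e. if l = k then of_nat e * mtrace ?Y * (Q $$ (i,k) * Qa $$ (k,j)) else 0)"
  proof (intro sum.cong refl)
    fix k l assume "k \<in> {..<e}" "l \<in> {..<e}"
    hence kl: "k < e" "l < e" by auto
    have "(\<Sum>a<e. \<Sum>c<e. Q $$ (i,k) * (weyl e a c * ?Y * mat_adjoint (weyl e a c)) $$ (k,l) * Qa $$ (l,j))
        = Q $$ (i,k) * Qa $$ (l,j) * (\<Sum>a<e. \<Sum>c<e. (weyl e a c * ?Y * mat_adjoint (weyl e a c)) $$ (k,l))"
      unfolding sum_distrib_left by (intro sum.cong refl) (simp only: mult_ac)
    thus "(\<Sum>a<e. \<Sum>c<e. Q $$ (i,k) * (weyl e a c * ?Y * mat_adjoint (weyl e a c)) $$ (k,l) * Qa $$ (l,j))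
        = (if l = k then of_nat e * mtrace ?Y * (Q $$ (i,k) * Qa $$ (k,j)) else 0)"
      unfolding weyl_twirl[OF Y kl] by auto
  qed
  also have "\<dots> = of_nat e * mtrace ?Y * (Q * Qa) $$ (i,j)"
    unfolding index_mult_sum[OF Q_carrier Qa_carrier ij] sum_distrib_left by simp
  finally have sum: "(\<Sum>a<e. \<Sum>c<e. (G a c * (P0 * \<rho> * P0 + Q * ?Y * Qa) * mat_adjoint (G a c)) $$ (i,j))
      = (of_nat e)\<^sup>2 * (P0 * \<rho> * P0) $$ (i,j) + of_nat e * mtrace ?Y * (Q * Qa) $$ (i,j)" .
  have scale: "1 / K\<^sup>2 * (K\<^sup>2 * x + K * y * z) = x + y / K * z" if "K \<noteq> 0" for K x y z :: complex
    using that by (simp add: power2_eq_square field_simps)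
  show ?thesis unfolding sum by (rule scale) (use e in \<open>simp only: of_nat_eq_0_iff\<close>)
qed

text \<open>This is the partial trace over B of U (1 - P0) U^*: the identity on the whole space
  contributes b times the identity, and P0 contributes \<Phi>(1) by the dilation. Dividing by e
  yields \<sigma>.\<close>

definition residual :: "complex mat" where
  "residual = of_nat b \<cdot>\<^sub>m 1\<^sub>m m - \<Phi> (1\<^sub>m n)"

lemma residual_carrier [simp]: "residual \<in> carrier_mat m m"
  unfolding residual_def using minus_carrier_mat[OF channelD(1)[OF channel one_carrier_mat]] by blast

text \<open>As Q Q^* = 1 - |v><v| \<otimes> 1, linearity reduces the claim to the dilation formula
  at X and at the identity, plus the partial trace of U U^* = 1.\<close>

lemma ptrace_combination:
  assumes X: "X \<in> carrier_mat n n" and M: "M \<in> carrier_mat N N"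
    and MX: "\<And>i j. i < N \<Longrightarrow> j < N \<Longrightarrow>
      M $$ (i,j) = mtensor (proj_vec v) X $$ (i,j) + c * (Q * Qa) $$ (i,j)"
  shows "ptrace_B m b (U * M * mat_adjoint U) = \<Phi> X + c \<cdot>\<^sub>m residual"
proof (rule eq_matI)
  let ?Ua = "mat_adjoint U" and ?T = "mtensor (proj_vec v)"
  have Ua: "?Ua \<in> carrier_mat N N" using U_carrier by simp
  note \<Phi>c = channelD(1)[OF channel X] channelD(1)[OF channel one_carrier_mat]
  show "dim_row (ptrace_B m b (U * M * ?Ua)) = dim_row (\<Phi> X + c \<cdot>\<^sub>m residual)"
    "dim_col (ptrace_B m b (U * M * ?Ua)) = dim_col (\<Phi> X + c \<cdot>\<^sub>m residual)"
    using carrier_matD[OF residual_carrier] by (auto simp: ptrace_B_def)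
  fix p q assume "p < dim_row (\<Phi> X + c \<cdot>\<^sub>m residual)" "q < dim_col (\<Phi> X + c \<cdot>\<^sub>m residual)"
  hence pq: "p < m" "q < m" using carrier_matD[OF residual_carrier] by auto
  have entry: "(U * M * ?Ua) $$ (x,y) = (U * ?T X * ?Ua) $$ (x,y)
      + c * ((if x = y then 1 else 0) - (U * ?T (1\<^sub>m n) * ?Ua) $$ (x,y))" if xy: "x < N" "y < N" for x y
  proof -
    have rows: "(\<Sum>k<N. U $$ (x,k) * ?Ua $$ (k,y)) = (if x = y then 1 else 0)"
      using index_mult_sum[OF U_carrier Ua xy] unitary_matD(2)[OF U_unitary] xy by simp
    have "(\<Sum>k<N. \<Sum>l<N. U $$ (x,k) * (if k = l then 1 else 0) * ?Ua $$ (l,y))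
        = (\<Sum>k<N. \<Sum>l<N. if l = k then U $$ (x,k) * ?Ua $$ (k,y) else 0)"
      by (intro sum.cong refl) auto
    hence id: "(\<Sum>k<N. \<Sum>l<N. U $$ (x,k) * (if k = l then 1 else 0) * ?Ua $$ (l,y)) = (if x = y then 1 else 0)"
      using rows by simp
    have "(U * M * ?Ua) $$ (x,y) = (\<Sum>k<N. \<Sum>l<N. U $$ (x,k) * M $$ (k,l) * ?Ua $$ (l,y))"
      by (rule index_mult3_sum[OF U_carrier M Ua xy])
    also have "\<dots> = (\<Sum>k<N. \<Sum>l<N. U $$ (x,k) * ?T X $$ (k,l) * ?Ua $$ (l,y)
        + c * (U $$ (x,k) * (if k = l then 1 else 0) * ?Ua $$ (l,y)
          - U $$ (x,k) * ?T (1\<^sub>m n) $$ (k,l) * ?Ua $$ (l,y)))"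
    proof (intro sum.cong refl)
      fix k l assume "k \<in> {..<N}" "l \<in> {..<N}"
      hence kl: "k < N" "l < N" by auto
      have "M $$ (k,l) = ?T X $$ (k,l) + c * ((if k = l then 1 else 0) - ?T (1\<^sub>m n) $$ (k,l))"
        unfolding MX[OF kl] QQa using kl P0_carrier unfolding S0_proj_def by simp
      thus "U $$ (x,k) * M $$ (k,l) * ?Ua $$ (l,y) = U $$ (x,k) * ?T X $$ (k,l) * ?Ua $$ (l,y)
        + c * (U $$ (x,k) * (if k = l then 1 else 0) * ?Ua $$ (l,y)
          - U $$ (x,k) * ?T (1\<^sub>m n) $$ (k,l) * ?Ua $$ (l,y))"
        by (simp only:) (simp add: algebra_simps)
    qed
    also have "\<dots> = (\<Sum>k<N. \<Sum>l<N. U $$ (x,k) * ?T X $$ (k,l) * ?Ua $$ (l,y))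
        + c * ((\<Sum>k<N. \<Sum>l<N. U $$ (x,k) * (if k = l then 1 else 0) * ?Ua $$ (l,y))
          - (\<Sum>k<N. \<Sum>l<N. U $$ (x,k) * ?T (1\<^sub>m n) $$ (k,l) * ?Ua $$ (l,y)))"
      by (simp only: sum.distrib sum_distrib_left[symmetric] sum_subtractf)
    also have "\<dots> = (U * ?T X * ?Ua) $$ (x,y) + c * ((if x = y then 1 else 0) - (U * ?T (1\<^sub>m n) * ?Ua) $$ (x,y))"
      unfolding id index_mult3_sum[OF U_carrier tensor_carrier[OF X] Ua xy]
        index_mult3_sum[OF U_carrier tensor_carrier[OF one_carrier_mat] Ua xy] ..
    finally show ?thesis .
  qed
  have pt: "\<Phi> Z $$ (p,q) = (\<Sum>\<beta><b. (U * ?T Z * ?Ua) $$ (p * b + \<beta>, q * b + \<beta>))"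
    if "Z \<in> carrier_mat n n" for Z
    unfolding \<Phi>_eq[OF that] ptrace_B_def using pq by simp
  have lt: "p * b + \<beta> < N" "q * b + \<beta> < N" if "\<beta> < b" for \<beta>
    using index_pair_less[OF pq(1) that] index_pair_less[OF pq(2) that] unfolding N_eq by auto
  have eqpq: "p * b + \<beta> = q * b + \<beta> \<longleftrightarrow> p = q" for \<beta> using b_pos by simp
  have "ptrace_B m b (U * M * ?Ua) $$ (p,q) = (\<Sum>\<beta><b. (U * M * ?Ua) $$ (p * b + \<beta>, q * b + \<beta>))"
    unfolding ptrace_B_def using pq by simp
  also have "\<dots> = (\<Sum>\<beta><b. (U * ?T X * ?Ua) $$ (p * b + \<beta>, q * b + \<beta>)
      + c * ((if p = q then 1 else 0) - (U * ?T (1\<^sub>m n) * ?Ua) $$ (p * b + \<beta>, q * b + \<beta>)))"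
    using entry[OF lt] eqpq by (intro sum.cong refl) simp
  also have "\<dots> = \<Phi> X $$ (p,q) + c * ((if p = q then of_nat b else 0) - \<Phi> (1\<^sub>m n) $$ (p,q))"
    unfolding pt[OF X] pt[OF one_carrier_mat] sum.distrib sum_distrib_left[symmetric] sum_subtractf by simp
  also have "\<dots> = (\<Phi> X + c \<cdot>\<^sub>m residual) $$ (p,q)"
    using pq \<Phi>c carrier_matD[OF residual_carrier] by (simp add: residual_def)
  finally show "ptrace_B m b (U * M * ?Ua) $$ (p,q) = (\<Phi> X + c \<cdot>\<^sub>m residual) $$ (p,q)" .
qed

text \<open>Stated for all matrices rather than states, because \<open>chan_tensor\<close> evaluates
  the approximation on matrix units.\<close>

theorem mixed_unitary_approx_eq:
  assumes \<rho>: "\<rho> \<in> carrier_mat N N" and e: "0 < e"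
  shows "mixed_unitary_approx n m d (b, v, U, Q) \<rho>
    = mtensor (\<Phi> (compress n d v \<rho>) + ((mtrace \<rho> - mtrace (compress n d v \<rho>)) / of_nat e) \<cdot>\<^sub>m residual)
        ((1 / of_nat b) \<cdot>\<^sub>m 1\<^sub>m b)"
proof -
  let ?c = "(mtrace \<rho> - mtrace (compress n d v \<rho>)) / of_nat e"
  define M where "M = mat N N (\<lambda>(i,j). 1 / (of_nat e)\<^sup>2 * (\<Sum>a<e. \<Sum>c<e. ((P0 + Q * weyl e a c * Qa) *
      (P0 * \<rho> * P0 + Q * (Qa * \<rho> * Q) * Qa) * mat_adjoint (P0 + Q * weyl e a c * Qa)) $$ (i,j)))"
  have MX: "M $$ (i,j) = mtensor (proj_vec v) (compress n d v \<rho>) $$ (i,j) + ?c * (Q * Qa) $$ (i,j)"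
    if ij: "i < N" "j < N" for i j
    using twirling[OF \<rho> e ij refl] ij
    unfolding M_def P0_conj[OF \<rho>, symmetric] mtrace_complement[OF \<rho>, symmetric] by (simp only: index_mat prod.case)
  have "ptrace_B m b (U * M * mat_adjoint U) = \<Phi> (compress n d v \<rho>) + ?c \<cdot>\<^sub>m residual"
    by (rule ptrace_combination[OF compress_carrier _ MX]) (simp_all add: M_def)
  thus ?thesis unfolding mixed_unitary_approx_def prod.case Let_def dephasing[OF \<rho>] M_def by (simp only:)
qed

end

section \<open>Minimum output entropies of the approximation\<close>

lemma div_mod_index_pair:
  assumes "j < (m::nat)"
  shows "(i * m + j) div m = i" "(i * m + j) mod m = j"
  using assms by auto

lemma psd_trace:
  assumes "psd n X"
  shows "\<exists>s\<ge>0. mtrace X = of_real s"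
proof -
  obtain U f where S: "spectral n X U f" "\<forall>k<n. 0 \<le> f k" using psd_spectral[OF assms] by blast
  thus ?thesis using spectral_trace[OF S(1)] by (intro exI[of _ "\<Sum>k<n. f k"]) (auto intro!: sum_nonneg)
qed

text \<open>Lets the S_0 block be read as a weight times a state. If the weight is 0 then X = 0, and
  any state will do.\<close>

lemma psd_normalize:
  assumes X: "psd n X" and tr: "mtrace X = of_real s" and n: "0 < n"
  shows "\<exists>Y. density n Y \<and> X = of_real s \<cdot>\<^sub>m Y"
proof -
  note Xc = psdD(1)[OF X]
  obtain U f where S: "spectral n X U f" and f: "\<forall>k<n. 0 \<le> f k" using psd_spectral[OF X] by blast
  have s: "s = (\<Sum>k<n. f k)" using spectral_trace[OF S] tr by (simp only: of_real_eq_iff)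
  show ?thesis
  proof (cases "s = 0")
    case True
    hence "\<forall>k\<in>{..<n}. f k = 0" unfolding s using f by (subst (asm) sum_nonneg_eq_0_iff) auto
    hence "X $$ (i,j) = 0" if "i < n" "j < n" for i j
      using spectralD(3)[OF S that] by simp
    hence "X = of_real s \<cdot>\<^sub>m unit_mat n 0 0"
      using Xc True carrier_matD[OF unit_mat_carrier[of n 0 0]] by (intro eq_matI) auto
    thus ?thesis using density_unit_mat[OF n] by blast
  next
    case False
    hence s0: "0 < s" using s f sum_nonneg[of "{..<n}" f] by fastforce
    \<comment> \<open>The zero summand only brings Y into the shape required by
      \<open>psd_combination\<close>.\<close>
    define Y where "Y = of_real (1 / s) \<cdot>\<^sub>m X + of_real 0 \<cdot>\<^sub>m X"
    have "psd n Y" unfolding Y_def using s0 by (intro psd_combination[OF X X]) auto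
    moreover have "mtrace Y = 1"
    proof -
      have "mtrace Y = of_real (1 / s) * mtrace X"
        unfolding mtrace_def Y_def using Xc by (simp add: sum_divide_distrib)
      thus ?thesis unfolding tr using s0 by (simp flip: of_real_mult)
    qed
    moreover have "X = of_real s \<cdot>\<^sub>m Y"
      unfolding Y_def using Xc s0 by (intro eq_matI) auto
    ultimately show ?thesis unfolding density_def by blast
  qed
qed

text \<open>On composite indices this map is the permutation of factors \<open>K \<otimes> B \<otimes> K' \<rightarrow> K \<otimes> K' \<otimes> B\<close>.\<close>

lemma bij_betw_move_last:
  fixes m b :: nat
  shows "bij_betw (\<lambda>x. ((x div m) div b * m + x mod m) * b + (x div m) mod b) {..<m * m * b} {..<m * m * b}"
proof -
  let ?\<pi> = "\<lambda>x. ((x div m) div b * m + x mod m) * b + (x div m) mod b"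
  have bounds: "(x div m) div b < m" "x mod m < m" "(x div m) mod b < b" if "x < m * m * b" for x
  proof -
    have x: "x < m * b * m" using that by (simp add: mult_ac)
    show "(x div m) div b < m" "x mod m < m" "(x div m) mod b < b"
      using index_pair_div_mod[OF x] index_pair_div_mod[OF index_pair_div_mod(1)[OF x]] by auto
  qed
  have inj: "inj_on ?\<pi> {..<m * m * b}"
  proof (rule inj_onI)
    fix x y assume "x \<in> {..<m * m * b}" "y \<in> {..<m * m * b}" and eq: "?\<pi> x = ?\<pi> y"
    hence xy: "x < m * m * b" "y < m * m * b" by auto
    note x = bounds[OF xy(1)] and y = bounds[OF xy(2)]
    have rec: "?\<pi> z mod b = (z div m) mod b" "(?\<pi> z div b) mod m = z mod m" "(?\<pi> z div b) div m = (z div m) div b"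
      if "z mod m < m" "(z div m) mod b < b" for z
      using that by auto
    have "(x div m) mod b = (y div m) mod b" "x mod m = y mod m" "(x div m) div b = (y div m) div b"
      using rec[OF x(2,3)] rec[OF y(2,3)] eq by metis+
    thus "x = y" by (metis div_mult_mod_eq)
  qed
  moreover have "?\<pi> ` {..<m * m * b} \<subseteq> {..<m * m * b}"
    using index_pair_less[OF index_pair_less[OF bounds(1,2)] bounds(3)] by auto
  ultimately have "?\<pi> ` {..<m * m * b} = {..<m * m * b}" by (intro endo_inj_surj) auto
  thus ?thesis using inj unfolding bij_betw_def by blast
qed

section \<open>Inputs supported on S_0, and the upper bound for the tensor product\<close>

context dilated_channel
begin

abbreviation "approx \<equiv> mixed_unitary_approx n m d (b, v, U, Q)"

lemma compress_unit_mat: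
  assumes "a < d" "a' < d" "s < n" "t < n"
  shows "compress n d v (unit_mat N (a * n + s) (a' * n + t)) = (cnj (v $ a) * v $ a') \<cdot>\<^sub>m unit_mat n s t"
proof (rule eq_matI)
  fix p q assume "p < dim_row ((cnj (v $ a) * v $ a') \<cdot>\<^sub>m unit_mat n s t)"
    "q < dim_col ((cnj (v $ a) * v $ a') \<cdot>\<^sub>m unit_mat n s t)"
  hence pq: "p < n" "q < n" by (auto simp: unit_mat_def)
  have idx: "c * n + p = a * n + s \<longleftrightarrow> c = a \<and> p = s" if "p < n" "s < n" for c a p s
  proof
    assume e: "c * n + p = a * n + s"
    have "(c * n + p) div n = c" "(c * n + p) mod n = p" "(a * n + s) div n = a" "(a * n + s) mod n = s"
      using that by auto
    thus "c = a \<and> p = s" using e by metis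
  qed simp
  have "compress n d v (unit_mat N (a * n + s) (a' * n + t)) $$ (p,q)
      = (\<Sum>c<d. \<Sum>c'<d. if c = a \<and> c' = a' then (if p = s \<and> q = t then cnj (v $ c) * v $ c' else 0) else 0)"
    unfolding compress_def using pq assms
    by (auto simp: index_pair_less idx intro!: sum.cong)
  also have "\<dots> = (if p = s \<and> q = t then cnj (v $ a) * v $ a' else 0)"
    by (rule sum_sum_delta[OF assms(1,2)])
  finally show "compress n d v (unit_mat N (a * n + s) (a' * n + t)) $$ (p,q)
      = ((cnj (v $ a) * v $ a') \<cdot>\<^sub>m unit_mat n s t) $$ (p,q)"
    using pq carrier_matD[OF unit_mat_carrier[of n s t]] by simp
qed (auto simp: compress_def unit_mat_def)

lemma v_norm_weighted: "(\<Sum>a<d. \<Sum>a'<d. v $ a * cnj (v $ a') * (cnj (v $ a) * v $ a')) = 1"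
proof -
  have "(\<Sum>a<d. \<Sum>a'<d. v $ a * cnj (v $ a') * (cnj (v $ a) * v $ a'))
      = (\<Sum>a<d. cnj (v $ a) * v $ a) * (\<Sum>a'<d. cnj (v $ a') * v $ a')"
    unfolding sum_product by (intro sum.cong refl) (simp add: mult_ac)
  thus ?thesis unfolding v_norm by simp
qed

lemma index_maximally_mixed:
  "i < b \<Longrightarrow> j < b \<Longrightarrow> ((1 / of_nat b) \<cdot>\<^sub>m 1\<^sub>m b) $$ (i,j) = (if i = j then 1 / of_nat b else 0 :: complex)"
  by simp

text \<open>The left side is the expansion in matrix units of the approximation at |v><v| \<otimes>
  E_st, in the form in which \<open>chan_tensor\<close> produces it. Such an input has no weight
  outside S_0, so only \<Phi> tensored with the maximally mixed state survives.\<close>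

lemma approx_S0_unit:
  assumes e: "0 < e" and st: "s < n" "t < n" and xy: "x < m * b" "y < m * b"
  shows "(\<Sum>a<d. \<Sum>a'<d. v $ a * cnj (v $ a') * approx (unit_mat N (a * n + s) (a' * n + t)) $$ (x,y))
    = \<Phi> (unit_mat n s t) $$ (x div b, y div b) * (if x mod b = y mod b then 1 / of_nat b else 0)"
proof -
  note x = index_pair_div_mod[OF xy(1)] and y = index_pair_div_mod[OF xy(2)]
  define \<delta> where "\<delta> = (if x mod b = y mod b then 1 / of_nat b else 0 :: complex)"
  define F where "F = \<Phi> (unit_mat n s t) $$ (x div b, y div b)"
  define r where "r = residual $$ (x div b, y div b)"
  define z where "z = (if s = t then 1 else 0 :: complex)"
  have entry: "approx (unit_mat N (a * n + s) (a' * n + t)) $$ (x,y)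
      = (cnj (v $ a) * v $ a' * F + ((if a = a' then 1 else 0) - cnj (v $ a) * v $ a') * z / of_nat e * r) * \<delta>"
    if a: "a < d" "a' < d" for a a'
  proof -
    let ?E = "unit_mat N (a * n + s) (a' * n + t)"
    let ?k = "cnj (v $ a) * v $ a'"
    let ?c = "(mtrace ?E - mtrace (compress n d v ?E)) / of_nat e"
    have trE: "mtrace ?E = (if a = a' then 1 else 0) * z"
    proof -
      have "a * n + s = a' * n + t \<longleftrightarrow> a = a' \<and> s = t"
      proof
        assume eq: "a * n + s = a' * n + t"
        have "(a * n + s) div n = a" "(a * n + s) mod n = s" "(a' * n + t) div n = a'" "(a' * n + t) mod n = t"
          using st by auto
        thus "a = a' \<and> s = t" using eq by metis
      qed simp
      thus ?thesis unfolding z_def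
        using mtrace_unit_mat[OF index_pair_less[OF a(1) st(1)] index_pair_less[OF a(2) st(2)]] by simp
    qed
    have trC: "mtrace (compress n d v ?E) = ?k * z"
    proof -
      have "mtrace (?k \<cdot>\<^sub>m unit_mat n s t) = ?k * mtrace (unit_mat n s t)"
        unfolding mtrace_def using carrier_matD[OF unit_mat_carrier[of n s t]] by (simp add: sum_distrib_left)
      thus ?thesis unfolding compress_unit_mat[OF a st] z_def using mtrace_unit_mat[OF st] by simp
    qed
    have \<Phi>c: "\<Phi> (compress n d v ?E) = ?k \<cdot>\<^sub>m \<Phi> (unit_mat n s t)"
      unfolding compress_unit_mat[OF a st] by (rule channelD(3)[OF channel unit_mat_carrier])
    note c1 = channelD(1)[OF channel unit_mat_carrier[of n s t]]
    have c2: "\<Phi> (compress n d v ?E) + ?c \<cdot>\<^sub>m residual \<in> carrier_mat m m"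
      by (rule add_carrier_mat) simp
    have c3: "(1 / of_nat b) \<cdot>\<^sub>m 1\<^sub>m b \<in> carrier_mat b b" by simp
    have "approx ?E $$ (x,y) = (\<Phi> (compress n d v ?E) + ?c \<cdot>\<^sub>m residual) $$ (x div b, y div b) * \<delta>"
      unfolding mixed_unitary_approx_eq[OF unit_mat_carrier e] index_mtensor[OF c2 c3 xy]
        index_maximally_mixed[OF x(2) y(2)] \<delta>_def ..
    also have "(\<Phi> (compress n d v ?E) + ?c \<cdot>\<^sub>m residual) $$ (x div b, y div b) = ?k * F + ?c * r"
      unfolding \<Phi>c using x y carrier_matD[OF residual_carrier] carrier_matD[OF c1] by (simp add: F_def r_def)
    finally show ?thesis unfolding trE trC by (simp add: left_diff_distrib)
  qed
  have "(\<Sum>a<d. \<Sum>a'<d. v $ a * cnj (v $ a') * approx (unit_mat N (a * n + s) (a' * n + t)) $$ (x,y))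
      = (\<Sum>a<d. \<Sum>a'<d. (v $ a * cnj (v $ a') * (cnj (v $ a) * v $ a')) * ((F - z / of_nat e * r) * \<delta>)
          + (if a' = a then v $ a * cnj (v $ a) * (z / of_nat e * r * \<delta>) else 0))"
  proof (intro sum.cong refl)
    fix a a' assume "a \<in> {..<d}" "a' \<in> {..<d}"
    hence a: "a < d" "a' < d" by auto
    have alg: "V * ((K * F + (g - K) * z / E * r) * \<delta>) = V * K * ((F - z / E * r) * \<delta>) + g * (V * (z / E * r * \<delta>))"
      for V K g E :: complex
      by (simp add: algebra_simps diff_divide_distrib)
    show "v $ a * cnj (v $ a') * approx (unit_mat N (a * n + s) (a' * n + t)) $$ (x,y)
      = (v $ a * cnj (v $ a') * (cnj (v $ a) * v $ a')) * ((F - z / of_nat e * r) * \<delta>)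
          + (if a' = a then v $ a * cnj (v $ a) * (z / of_nat e * r * \<delta>) else 0)"
      unfolding entry[OF a] alg by (cases "a = a'") simp_all
  qed
  also have "\<dots> = (\<Sum>a<d. \<Sum>a'<d. v $ a * cnj (v $ a') * (cnj (v $ a) * v $ a')) * ((F - z / of_nat e * r) * \<delta>)
      + (\<Sum>a<d. cnj (v $ a) * v $ a) * (z / of_nat e * r * \<delta>)"
    unfolding sum.distrib sum_distrib_right by (simp add: mult.commute)
  \<comment> \<open>The residual enters once through the trace of the input and once, with opposite
    sign, through the trace of its compression; both weights sum to 1.\<close>
  also have "\<dots> = F * \<delta>" unfolding v_norm_weighted v_norm by (simp add: algebra_simps)
  finally show ?thesis unfolding F_def \<delta>_def .
qed

text \<open>The approximation places B between the two output spaces, whereas the right side has B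
  last; \<pi> translates the indices.\<close>

lemma chan_tensor_approx_S0:
  assumes e: "0 < e" and \<rho>: "\<rho> \<in> carrier_mat (n * n) (n * n)" and xy: "x < m * m * b" "y < m * m * b"
  defines "\<pi> \<equiv> \<lambda>x. ((x div m) div b * m + x mod m) * b + (x div m) mod b"
  shows "chan_tensor N (m * b) n m approx \<Psi> (mtensor (proj_vec v) \<rho>) $$ (x,y)
    = mtensor (chan_tensor n m n m \<Phi> \<Psi> \<rho>) ((1 / of_nat b) \<cdot>\<^sub>m 1\<^sub>m b) $$ (\<pi> x, \<pi> y)"
proof -
  let ?R = "mtensor (proj_vec v) \<rho>" and ?nn = "n * n"
  let ?\<Phi> = "\<lambda>s t. \<Phi> (unit_mat n (s div n) (t div n)) $$ (x div m div b, y div m div b)"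
  let ?\<Psi> = "\<lambda>i j. \<Psi> (unit_mat n (i mod n) (j mod n)) $$ (x mod m, y mod m)"
  let ?\<delta> = "if x div m mod b = y div m mod b then 1 / of_nat b else 0 :: complex"
  have xy': "x < m * b * m" "y < m * b * m" using xy by (simp_all add: mult_ac)
  note x = index_pair_div_mod[OF xy'(1)] and y = index_pair_div_mod[OF xy'(2)]
  note x1 = index_pair_div_mod[OF x(1)] and y1 = index_pair_div_mod[OF y(1)]
  have Nn: "N * n = d * ?nn" by simp
  \<comment> \<open>The input is indexed by A \<otimes> (H \<otimes> H) on the state side and by (A
    \<otimes> H) \<otimes> H on the map side; these identities regroup the factors.\<close>
  have idx: "(a * ?nn + s) div n = a * n + s div n" "(a * ?nn + s) mod n = s mod n" for a s
  proof -
    have eq: "a * ?nn + s = s + (a * n) * n" by (simp add: mult_ac)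
    show "(a * ?nn + s) div n = a * n + s div n" unfolding eq using npos by (subst div_mult_self1) auto
    show "(a * ?nn + s) mod n = s mod n" unfolding eq by (rule mod_mult_self1)
  qed
  have "chan_tensor N (m * b) n m approx \<Psi> ?R $$ (x,y)
      = (\<Sum>i<d * ?nn. \<Sum>j<d * ?nn. ?R $$ (i,j) * approx (unit_mat N (i div n) (j div n)) $$ (x div m, y div m) * ?\<Psi> i j)"
    unfolding chan_tensor_def Nn using xy' by simp
  also have "\<dots> = (\<Sum>a<d. \<Sum>s<?nn. \<Sum>a'<d. \<Sum>t<?nn. v $ a * cnj (v $ a') * \<rho> $$ (s,t)
      * approx (unit_mat N (a * n + s div n) (a' * n + t div n)) $$ (x div m, y div m) * ?\<Psi> s t)"
    unfolding sum_mult_split[of _ d ?nn]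
  proof (intro sum.cong refl)
    fix a s a' t assume "a \<in> {..<d}" "s \<in> {..<?nn}" "a' \<in> {..<d}" "t \<in> {..<?nn}"
    hence lt: "a < d" "s < ?nn" "a' < d" "t < ?nn" by auto
    have "?R $$ (a * ?nn + s, a' * ?nn + t) = v $ a * cnj (v $ a') * \<rho> $$ (s,t)"
      unfolding index_mtensor[OF proj_carrier \<rho> index_pair_less[OF lt(1,2)] index_pair_less[OF lt(3,4)]]
        div_mod_index_pair[OF lt(2)] div_mod_index_pair[OF lt(4)]
      using lt v_carrier by (simp add: proj_vec_def)
    thus "?R $$ (a * ?nn + s, a' * ?nn + t) * approx (unit_mat N ((a * ?nn + s) div n) ((a' * ?nn + t) div n)) $$ (x div m, y div m)
        * ?\<Psi> (a * ?nn + s) (a' * ?nn + t)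
      = v $ a * cnj (v $ a') * \<rho> $$ (s,t)
      * approx (unit_mat N (a * n + s div n) (a' * n + t div n)) $$ (x div m, y div m) * ?\<Psi> s t"
      unfolding idx by simp
  qed
  also have "\<dots> = (\<Sum>s<?nn. \<Sum>t<?nn. \<Sum>a<d. \<Sum>a'<d. v $ a * cnj (v $ a') * \<rho> $$ (s,t)
      * approx (unit_mat N (a * n + s div n) (a' * n + t div n)) $$ (x div m, y div m) * ?\<Psi> s t)"
    unfolding sum.cartesian_product by (rule sum.reindex_bij_witness[where
      i = "\<lambda>(s,t,a,a'). (a,s,a',t)" and j = "\<lambda>(a,s,a',t). (s,t,a,a')"]) auto
  also have "\<dots> = (\<Sum>s<?nn. \<Sum>t<?nn. (\<rho> $$ (s,t) * ?\<Phi> s t * ?\<Psi> s t) * ?\<delta>)"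
  proof (intro sum.cong refl)
    fix s t assume "s \<in> {..<?nn}" "t \<in> {..<?nn}"
    hence st: "s div n < n" "t div n < n" by (auto simp: less_mult_imp_div_less)
    have "(\<Sum>a<d. \<Sum>a'<d. v $ a * cnj (v $ a') * \<rho> $$ (s,t)
        * approx (unit_mat N (a * n + s div n) (a' * n + t div n)) $$ (x div m, y div m) * ?\<Psi> s t)
      = \<rho> $$ (s,t) * ?\<Psi> s t * (\<Sum>a<d. \<Sum>a'<d. v $ a * cnj (v $ a')
        * approx (unit_mat N (a * n + s div n) (a' * n + t div n)) $$ (x div m, y div m))"
      unfolding sum_distrib_left by (intro sum.cong refl) (simp only: mult_ac)
    thus "(\<Sum>a<d. \<Sum>a'<d. v $ a * cnj (v $ a') * \<rho> $$ (s,t)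
        * approx (unit_mat N (a * n + s div n) (a' * n + t div n)) $$ (x div m, y div m) * ?\<Psi> s t)
      = (\<rho> $$ (s,t) * ?\<Phi> s t * ?\<Psi> s t) * ?\<delta>"
      unfolding approx_S0_unit[OF e st x(1) y(1)] by (simp only: mult_ac)
  qed
  also have "\<dots> = (\<Sum>s<?nn. \<Sum>t<?nn. \<rho> $$ (s,t) * ?\<Phi> s t * ?\<Psi> s t) * ?\<delta>"
    by (simp only: sum_distrib_right)
  also have "\<dots> = mtensor (chan_tensor n m n m \<Phi> \<Psi> \<rho>) ((1 / of_nat b) \<cdot>\<^sub>m 1\<^sub>m b) $$ (\<pi> x, \<pi> y)"
  proof -
    have c3: "(1 / of_nat b) \<cdot>\<^sub>m 1\<^sub>m b \<in> carrier_mat b b" by simp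
    have lt: "x div m div b * m + x mod m < m * m" "y div m div b * m + y mod m < m * m"
      by (rule index_pair_less[OF x1(1) x(2)], rule index_pair_less[OF y1(1) y(2)])
    have \<pi>: "\<pi> x < m * m * b" "\<pi> y < m * m * b"
      unfolding \<pi>_def by (rule index_pair_less[OF lt(1) x1(2)], rule index_pair_less[OF lt(2) y1(2)])
    have "\<pi> x div b = x div m div b * m + x mod m" "\<pi> x mod b = x div m mod b"
        "\<pi> y div b = y div m div b * m + y mod m" "\<pi> y mod b = y div m mod b"
      unfolding \<pi>_def using x1(2) y1(2) by simp_all
    hence "mtensor (chan_tensor n m n m \<Phi> \<Psi> \<rho>) ((1 / of_nat b) \<cdot>\<^sub>m 1\<^sub>m b) $$ (\<pi> x, \<pi> y)
        = chan_tensor n m n m \<Phi> \<Psi> \<rho> $$ (x div m div b * m + x mod m, y div m div b * m + y mod m) * ?\<delta>"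
      unfolding index_mtensor[OF chan_tensor_carrier c3 \<pi>] using index_maximally_mixed[OF x1(2) y1(2)] by simp
    also have "chan_tensor n m n m \<Phi> \<Psi> \<rho> $$ (x div m div b * m + x mod m, y div m div b * m + y mod m)
        = (\<Sum>s<?nn. \<Sum>t<?nn. \<rho> $$ (s,t) * ?\<Phi> s t * ?\<Psi> s t)"
      unfolding chan_tensor_def using lt x(2) y(2) by simp
    finally show ?thesis by simp
  qed
  finally show ?thesis .
qed

lemma density_proj: "density d (proj_vec v)"
proof -
  have "qform d (proj_vec v) w = cnj (\<Sum>i<d. cnj (v $ i) * w i) * (\<Sum>i<d. cnj (v $ i) * w i)" for w
    unfolding qform_def cnj_sum sum_product
    using v_carrier by (intro sum.cong refl) (simp add: proj_vec_def)
  moreover have "0 \<le> cnj z * z" for z :: complex by (simp add: less_eq_complex_def)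
  ultimately have "psd d (proj_vec v)"
    unfolding psd_qform_iff using proj_carrier by metis
  moreover have "mtrace (proj_vec v) = 1"
    using v_norm v_carrier by (simp add: mtrace_def proj_vec_def mult.commute)
  ultimately show ?thesis unfolding density_def by blast
qed

lemma maximally_mixed_b:
  "density b ((1 / of_nat b) \<cdot>\<^sub>m 1\<^sub>m b)" "vn_entropy ((1 / of_nat b) \<cdot>\<^sub>m 1\<^sub>m b) = log 2 b"
  using maximally_mixed[OF b_pos] by simp_all

text \<open>Reordering the factors preserves the spectrum, and the maximally mixed factor on B adds
  log b.\<close>

lemma vn_entropy_approx_S0:
  assumes e: "0 < e" and \<Psi>: "is_channel n m \<Psi>" and \<rho>: "density (n * n) \<rho>"
  shows "vn_entropy (chan_tensor N (m * b) n m approx \<Psi> (mtensor (proj_vec v) \<rho>))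
    = vn_entropy (chan_tensor n m n m \<Phi> \<Psi> \<rho>) + log 2 b"
proof -
  let ?C = "mtensor (chan_tensor n m n m \<Phi> \<Psi> \<rho>) ((1 / of_nat b) \<cdot>\<^sub>m 1\<^sub>m b)"
  let ?\<pi> = "\<lambda>x. ((x div m) div b * m + x mod m) * b + (x div m) mod b"
  let ?L = "chan_tensor N (m * b) n m approx \<Psi> (mtensor (proj_vec v) \<rho>)"
  note dC = chan_tensor_density[OF channel \<Psi> \<rho>]
  obtain W f where S: "spectral (m * m * b) ?C W f"
    using density_spectral[OF density_mtensor[OF dC maximally_mixed_b(1)]] by blast
  have "?L \<in> carrier_mat (m * m * b) (m * m * b)"
    using chan_tensor_carrier[of N "m * b" n m approx \<Psi> "mtensor (proj_vec v) \<rho>"] by (simp add: mult_ac)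
  hence "?L = mat (m * m * b) (m * m * b) (\<lambda>(i,j). ?C $$ (?\<pi> i, ?\<pi> j))"
    using chan_tensor_approx_S0[OF e density_carrier[OF \<rho>]] by (intro eq_matI) auto
  hence "vn_entropy ?L = vn_entropy ?C"
    using vn_entropy_spectral[OF spectral_reindex[OF S bij_betw_move_last]] vn_entropy_spectral[OF S] by simp
  thus ?thesis using vn_entropy_mtensor[OF dC maximally_mixed_b(1)] maximally_mixed_b(2) by simp
qed

lemma S_min_chan_tensor_approx_le:
  assumes e: "0 < e" and \<Psi>: "is_channel n m \<Psi>"
  shows "S_min (d * n * n) (chan_tensor N (m * b) n m approx \<Psi>)
    \<le> S_min (n * n) (chan_tensor n m n m \<Phi> \<Psi>) + log 2 b"
proof -
  let ?T = "chan_tensor N (m * b) n m approx \<Psi>"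
  have "S_min (d * n * n) ?T - log 2 b \<le> vn_entropy (chan_tensor n m n m \<Phi> \<Psi> \<rho>)" if \<rho>: "density (n * n) \<rho>" for \<rho>
  proof -
    have "density (d * n * n) (mtensor (proj_vec v) \<rho>)"
      using density_mtensor[OF density_proj \<rho>] by (simp add: mult.assoc)
    \<comment> \<open>The general lower bound enters here: it makes the infimum for the tensored
      approximation a genuine lower bound of its values.\<close>
    from S_min_le[OF bdd_below_vn_entropy_chan_tensor this, of "m * b" m approx \<Psi>]
    show ?thesis using vn_entropy_approx_S0[OF e \<Psi> \<rho>] by simp
  qed
  hence "S_min (d * n * n) ?T - log 2 b \<le> S_min (n * n) (chan_tensor n m n m \<Phi> \<Psi>)"
    using npos by (intro S_min_greatest) auto
  thus ?thesis by simp
qed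

section \<open>Arbitrary inputs, and the lower bound for the approximation\<close>

lemma compress_psd:
  assumes \<rho>: "psd N \<rho>"
  shows "psd n (compress n d v \<rho>)"
  unfolding psd_qform_iff
proof (intro conjI allI)
  fix w :: "nat \<Rightarrow> complex"
  \<comment> \<open>The composite vector v \<otimes> w: the form of the compression at w is the form
    of \<rho> at this vector.\<close>
  let ?u = "\<lambda>k. v $ (k div n) * w (k mod n)"
  have "qform n (compress n d v \<rho>) w = (\<Sum>s<n. \<Sum>t<n. \<Sum>a<d. \<Sum>a'<d.
      cnj (v $ a * w s) * \<rho> $$ (a * n + s, a' * n + t) * (v $ a' * w t))"
    unfolding qform_def compress_def
    by (intro sum.cong refl) (simp add: sum_distrib_left sum_distrib_right mult_ac)
  also have "\<dots> = (\<Sum>a<d. \<Sum>s<n. \<Sum>a'<d. \<Sum>t<n.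
      cnj (v $ a * w s) * \<rho> $$ (a * n + s, a' * n + t) * (v $ a' * w t))"
    unfolding sum.cartesian_product by (rule sum.reindex_bij_witness[where
      i = "\<lambda>(a,s,a',t). (s,t,a,a')" and j = "\<lambda>(s,t,a,a'). (a,s,a',t)"]) auto
  also have "\<dots> = qform N \<rho> ?u"
    unfolding qform_def sum_mult_split[of _ d n] by (intro sum.cong refl) simp
  finally show "0 \<le> qform n (compress n d v \<rho>) w" using psdD(2)[OF \<rho>] by simp
qed simp

text \<open>The difference is the trace of the block on the complement of S_0, hence a sum of values
  of the form of \<rho> at the columns of Q.\<close>

lemma complement_weight_nonneg:
  assumes \<rho>: "psd N \<rho>"
  shows "0 \<le> mtrace \<rho> - mtrace (compress n d v \<rho>)"
proof -
  note \<rho>c = psdD(1)[OF \<rho>]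
  have "mtrace (Qa * \<rho> * Q) = (\<Sum>k<e. qform N \<rho> (\<lambda>i. Q $$ (i,k)))"
    unfolding mtrace_def carrier_matD(1)[OF mult_carrier_mat[OF mult_carrier_mat[OF Qa_carrier \<rho>c] Q_carrier]]
  proof (intro sum.cong refl)
    fix k assume "k \<in> {..<e}"
    hence k: "k < e" by simp
    show "(Qa * \<rho> * Q) $$ (k,k) = qform N \<rho> (\<lambda>i. Q $$ (i,k))"
      unfolding index_mult3_sum[OF Qa_carrier \<rho>c Q_carrier k k] qform_def
      using k carrier_matD[OF Q_carrier] by (intro sum.cong refl) simp
  qed
  thus ?thesis unfolding mtrace_complement[OF \<rho>c] using psdD(2)[OF \<rho>] by (simp add: sum_nonneg)
qed

text \<open>With s the weight of \<rho> on S_0 and Y its normalised S_0 block, the output on K is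
  the convex combination s \<Phi>(Y) + (1 - s) \<sigma>. Both entropies are at least the minimum,
  hence so is that of the mixture.\<close>

lemma vn_entropy_approx_ge:
  assumes e: "0 < e" and \<sigma>: "density m ((1 / of_nat e) \<cdot>\<^sub>m residual)" and \<rho>: "density N \<rho>"
  shows "min (S_min n \<Phi>) (vn_entropy ((1 / of_nat e) \<cdot>\<^sub>m residual)) + log 2 b \<le> vn_entropy (approx \<rho>)"
proof -
  let ?\<sigma> = "(1 / of_nat e) \<cdot>\<^sub>m residual" and ?X = "compress n d v \<rho>"
  note p\<rho> = density_psd[OF \<rho>]
  obtain s where s: "0 \<le> s" "mtrace ?X = of_real s" using psd_trace[OF compress_psd[OF p\<rho>]] by blast
  have tr: "mtrace \<rho> = 1" using \<rho> unfolding density_def by blast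
  have s1: "s \<le> 1" using complement_weight_nonneg[OF p\<rho>] unfolding tr s(2) by (simp add: less_eq_complex_def)
  obtain Y where Y: "density n Y" and XY: "?X = of_real s \<cdot>\<^sub>m Y"
    using psd_normalize[OF compress_psd[OF p\<rho>] s(2) npos] by blast
  note \<Phi>Y = channel_density[OF channel Y]
  let ?Z = "of_real s \<cdot>\<^sub>m \<Phi> Y + of_real (1 - s) \<cdot>\<^sub>m ?\<sigma>"
  have "\<Phi> ?X + ((mtrace \<rho> - mtrace ?X) / of_nat e) \<cdot>\<^sub>m residual = ?Z"
    unfolding XY channelD(3)[OF channel density_carrier[OF Y]]
    unfolding XY[symmetric] tr s(2)
    using carrier_matD[OF residual_carrier] carrier_matD[OF density_carrier[OF \<Phi>Y]]
    by (intro eq_matI) auto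
  hence eq: "approx \<rho> = mtensor ?Z ((1 / of_nat b) \<cdot>\<^sub>m 1\<^sub>m b)"
    unfolding mixed_unitary_approx_eq[OF density_carrier[OF \<rho>] e] by simp
  have "density m ?Z"
  proof -
    have "psd m ?Z"
      by (rule psd_combination[OF density_psd[OF \<Phi>Y] density_psd[OF \<sigma>] s(1)]) (use s1 in simp)
    moreover have "mtrace ?Z = of_real s * mtrace (\<Phi> Y) + of_real (1 - s) * mtrace ?\<sigma>"
      unfolding mtrace_def using carrier_matD[OF residual_carrier] carrier_matD[OF density_carrier[OF \<Phi>Y]]
      by (simp add: sum.distrib sum_distrib_left)
    ultimately show ?thesis using \<Phi>Y \<sigma> unfolding density_def by simp
  qed
  hence ent: "vn_entropy (approx \<rho>) = vn_entropy ?Z + log 2 b"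
    unfolding eq using vn_entropy_mtensor[OF _ maximally_mixed_b(1)] maximally_mixed_b(2) by simp
  define \<mu> where "\<mu> = min (S_min n \<Phi>) (vn_entropy ?\<sigma>)"
  have "\<mu> = s * \<mu> + (1 - s) * \<mu>" by (simp add: algebra_simps)
  also have "\<dots> \<le> s * vn_entropy (\<Phi> Y) + (1 - s) * vn_entropy ?\<sigma>"
    using s s1 S_min_le_channel[OF channel Y] unfolding \<mu>_def
    by (intro add_mono mult_left_mono) auto
  also have "\<dots> \<le> vn_entropy ?Z"
    by (rule vn_entropy_concave[OF density_psd[OF \<Phi>Y] density_psd[OF \<sigma>] s(1)]) (use s1 in simp_all)
  finally show ?thesis unfolding ent \<mu>_def by simp
qed

lemma S_min_approx_ge:
  assumes "0 < e" "density m ((1 / of_nat e) \<cdot>\<^sub>m residual)"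
  shows "min (S_min n \<Phi>) (vn_entropy ((1 / of_nat e) \<cdot>\<^sub>m residual)) + log 2 b \<le> S_min N approx"
  using vn_entropy_approx_ge[OF assms] npos d_pos by (intro S_min_greatest) auto

text \<open>Subtracting from a multiple of the identity keeps the eigenvectors of \<Phi>(1), so the
  spectrum of \<sigma> is explicit in that of \<Phi>(1).\<close>

lemma residual_spectral:
  assumes S: "spectral m (\<Phi> (1\<^sub>m n)) W \<mu>"
  shows "spectral m ((1 / of_nat e) \<cdot>\<^sub>m residual) W (\<lambda>k. (real b - \<mu> k) / real e)"
  unfolding spectral_def
proof (intro conjI allI impI)
  show "unitary_mat m W" by (rule spectralD(1)[OF S])
  show "(1 / of_nat e) \<cdot>\<^sub>m residual \<in> carrier_mat m m" by simp
  fix i j assume ij: "i < m" "j < m"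
  have "((1 / of_nat e) \<cdot>\<^sub>m residual) $$ (i,j) = 1 / of_nat e * (of_nat b * (if i = j then 1 else 0) - \<Phi> (1\<^sub>m n) $$ (i,j))"
    using ij carrier_matD[OF residual_carrier] carrier_matD[OF spectralD(2)[OF S]] by (simp add: residual_def)
  also have "\<dots> = 1 / of_nat e * (\<Sum>k<m. of_nat b * (W $$ (i,k) * cnj (W $$ (j,k))) - W $$ (i,k) * of_real (\<mu> k) * cnj (W $$ (j,k)))"
    unfolding spectralD(3)[OF S ij] sum_subtractf sum_distrib_left[symmetric]
      unitary_mat_rows[OF spectralD(1)[OF S] ij] ..
  also have "\<dots> = (\<Sum>k<m. W $$ (i,k) * of_real ((real b - \<mu> k) / real e) * cnj (W $$ (j,k)))"
    unfolding sum_distrib_left by (intro sum.cong refl) (simp add: diff_divide_distrib algebra_simps)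
  finally show "((1 / of_nat e) \<cdot>\<^sub>m residual) $$ (i,j) = (\<Sum>k<m. W $$ (i,k) * of_real ((real b - \<mu> k) / real e) * cnj (W $$ (j,k)))" .
qed

end

section \<open>The limit of large dilations\<close>

lemma tendsto_eta:
  assumes f: "(f \<longlongrightarrow> L) F" and L: "0 < L"
  shows "((\<lambda>x. eta (f x)) \<longlongrightarrow> eta L) F"
proof -
  have "((\<lambda>x. - f x * log 2 (f x)) \<longlongrightarrow> - L * log 2 L) F"
    using L by (intro tendsto_intros f) auto
  \<comment> \<open>A positive limit keeps the arguments eventually positive, away from the case
    split in \<open>eta\<close>.\<close>
  moreover have "\<forall>\<^sub>F x in F. - f x * log 2 (f x) = eta (f x)"
    using order_tendstoD(1)[OF f L] by eventually_elim (simp add: eta_def)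
  ultimately show ?thesis using L by (auto simp: eta_def intro: Lim_transform_eventually)
qed

theorem theorem7p12:
  fixes n m :: nat
    and \<Phi> \<Psi> :: "complex mat \<Rightarrow> complex mat"
    and dil :: "nat \<Rightarrow> dil_data"
  assumes "0 < n"
    and "is_channel n m \<Phi>" and "is_channel n m \<Psi>"
    and "\<forall>d. (\<exists>D. is_dilation n m \<Phi> d D) \<longrightarrow> is_dilation n m \<Phi> d (dil d)"
    and "\<exists>d0. \<forall>d \<ge> d0. (\<exists>D. is_dilation n m \<Phi> d D) \<longrightarrow>
           (let b = fst (dil d); \<Phi>' = mixed_unitary_approx n m d (dil d) in
             S_min (d * n * n) (chan_tensor (d * n) (m * b) n m \<Phi>' \<Psi>)
               = S_min (d * n) \<Phi>' + S_min n \<Psi>)"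
  shows "S_min (n * n) (chan_tensor n m n m \<Phi> \<Psi>) = S_min n \<Phi> + S_min n \<Psi>"
proof (rule antisym)
  note n = assms(1) and \<Phi> = assms(2) and \<Psi> = assms(3)
  note \<rho>0 = channel_density[OF \<Phi> density_unit_mat[OF n]]
  show "S_min (n * n) (chan_tensor n m n m \<Phi> \<Psi>) \<le> S_min n \<Phi> + S_min n \<Psi>"
    by (rule S_min_chan_tensor_le[OF n n \<Phi> \<Psi>])
  \<comment> \<open>A state is sent to a matrix of trace 1, which cannot have size 0.\<close>
  have m: "0 < m"
  proof (rule ccontr)
    assume "\<not> 0 < m"
    hence "mtrace (\<Phi> (unit_mat n 0 0)) = 0"
      unfolding mtrace_def using density_carrier[OF \<rho>0] by simp
    thus False using \<rho>0 unfolding density_def by simp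
  qed
  have "complex_of_real 1 \<cdot>\<^sub>m 1\<^sub>m n = 1\<^sub>m n" by (intro eq_matI) auto
  hence one_psd: "psd n (1\<^sub>m n)" using spectral_psd[OF spectral_smult_one[of n 1]] by (metis zero_le_one)
  \<comment> \<open>The eigenvalues \<mu> are fixed before k is chosen and so do not vary with the
    dilation.\<close>
  obtain W \<mu> where W: "spectral m (\<Phi> (1\<^sub>m n)) W \<mu>" using psd_spectral[OF channel_psd[OF \<Phi> one_psd]] by blast
  have \<mu>sum: "(\<Sum>k<m. \<mu> k) = real n"
  proof -
    have "complex_of_real (\<Sum>k<m. \<mu> k) = of_real (real n)"
      using spectral_trace[OF W] channelD(4)[OF \<Phi> one_carrier_mat] by (simp add: mtrace_def)
    thus ?thesis by (simp only: of_real_eq_iff)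
  qed
  \<comment> \<open>The entropy of \<sigma> at d = m k, with b = n k and e = m k n - n inserted.
    Being a function of k alone, it is independent of the dilation picked by
    \<open>dil\<close>.\<close>
  define h where "h k = (\<Sum>l<m. eta ((real (n * k) - \<mu> l) / real (m * k * n - n)))" for k
  define gap where "gap = S_min (n * n) (chan_tensor n m n m \<Phi> \<Psi>) - S_min n \<Psi>"
  obtain d0 where d0: "\<And>d. d \<ge> d0 \<Longrightarrow> \<exists>D. is_dilation n m \<Phi> d D \<Longrightarrow>
      S_min (d * n * n) (chan_tensor (d * n) (m * fst (dil d)) n m (mixed_unitary_approx n m d (dil d)) \<Psi>)
        = S_min (d * n) (mixed_unitary_approx n m d (dil d)) + S_min n \<Psi>"
    using assms(5) unfolding Let_def by blast
  \<comment> \<open>The bound 2 makes e positive even for m = 1, m guarantees that a dilation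
    exists, d0 activates the additivity hypothesis, and the last term makes b dominate the
    eigenvalues of \<Phi>(1), so that \<sigma> is positive.\<close>
  define k0 where "k0 = max (max 2 m) (max d0 (nat \<lceil>\<Sum>l<m. \<bar>\<mu> l\<bar>\<rceil>))"
  have bound: "min (S_min n \<Phi>) (h k) \<le> gap" if k: "k0 \<le> k" for k
  proof -
    have k': "2 \<le> k" "m \<le> k" "d0 \<le> k" "nat \<lceil>\<Sum>l<m. \<bar>\<mu> l\<bar>\<rceil> \<le> k" using k unfolding k0_def by auto
    let ?d = "m * k"
    have ex: "\<exists>D. is_dilation n m \<Phi> ?d D" by (rule dilation_exists[OF n m \<Phi> k'(2)])
    hence dil: "is_dilation n m \<Phi> ?d (dil ?d)" using assms(4) by blast
    obtain b v U Q where D: "dil ?d = (b, v, U, Q)" by (cases "dil ?d") auto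
    interpret dilated_channel n m ?d b \<Phi> v U Q
      using n \<Phi> dil unfolding D by unfold_locales
    \<comment> \<open>Cancelling m in d n = m b; this holds for whichever dilation
      \<open>dil\<close> returns.\<close>
    have b: "b = n * k" using N_eq m by (simp add: mult_ac)
    have kd: "k \<le> ?d" using m by simp
    have e: "0 < ?d * n - n" using kd k'(1) n
      by (metis One_nat_def Suc_1 Suc_le_lessD less_le_trans mult_less_cancel2 mult_1 zero_less_diff)
    have S: "spectral m ((1 / of_nat (?d * n - n)) \<cdot>\<^sub>m residual) W (\<lambda>l. (real b - \<mu> l) / real (?d * n - n))"
      by (rule residual_spectral[OF W])
    have le: "\<mu> l \<le> real b" if "l < m" for l
    proof -
      have "\<mu> l \<le> (\<Sum>l<m. \<bar>\<mu> l\<bar>)" using member_le_sum[of l "{..<m}" "\<lambda>l. \<bar>\<mu> l\<bar>"] that by fastforce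
      also have "\<dots> \<le> real k" using k'(4) by linarith
      also have "k \<le> n * k" using n by (cases n) auto
      hence "real k \<le> real b" unfolding b by (simp only: of_nat_le_iff)
      finally show ?thesis .
    qed
    have \<sigma>: "density m ((1 / of_nat (?d * n - n)) \<cdot>\<^sub>m residual)"
    proof -
      have "psd m ((1 / of_nat (?d * n - n)) \<cdot>\<^sub>m residual)"
        using le by (intro spectral_psd[OF S]) simp
      \<comment> \<open>The trace of \<sigma> is 1 because m b - n = d n - n = e.\<close>
      moreover have "(\<Sum>l<m. (real b - \<mu> l) / real (?d * n - n)) = 1"
      proof -
        have "(\<Sum>l<m. (real b - \<mu> l) / real (?d * n - n)) = (real m * real b - real n) / real (?d * n - n)"
          unfolding sum_divide_distrib[symmetric] sum_subtractf \<mu>sum by simp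
        also have "real m * real b - real n = real (?d * n - n)"
        proof -
          have "n \<le> ?d * n" using e by linarith
          hence "real (?d * n - n) = real (?d * n) - real n" by (rule of_nat_diff)
          thus ?thesis unfolding b by (simp add: mult_ac)
        qed
        finally show ?thesis using e by simp
      qed
      ultimately show ?thesis unfolding density_def using spectral_trace[OF S] by simp
    qed
    have ent: "vn_entropy ((1 / of_nat (?d * n - n)) \<cdot>\<^sub>m residual) = h k"
      unfolding vn_entropy_spectral[OF S] unfolding h_def b ..
    have "min (S_min n \<Phi>) (h k) + log 2 b + S_min n \<Psi> \<le> S_min (?d * n) approx + S_min n \<Psi>"
      using S_min_approx_ge[OF e \<sigma>] unfolding ent by simp
    also have "\<dots> = S_min (?d * n * n) (chan_tensor (?d * n) (m * b) n m approx \<Psi>)"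
      using d0[OF _ ex] k'(3) kd unfolding D by simp
    also have "\<dots> \<le> S_min (n * n) (chan_tensor n m n m \<Phi> \<Psi>) + log 2 b"
      by (rule S_min_chan_tensor_approx_le[OF e \<Psi>])
    finally show ?thesis unfolding gap_def by simp
  qed
  have "(\<lambda>k. (real (n * k) - \<mu> l) / real (m * k * n - n)) \<longlonglongrightarrow> 1 / real m" for l
  proof -
    have lim0: "(\<lambda>k. c / real k) \<longlonglongrightarrow> 0" for c :: real by (rule lim_const_over_n)
    have "(\<lambda>k. (real n - \<mu> l / real k) / (real m * real n - real n / real k)) \<longlonglongrightarrow> (real n - 0) / (real m * real n - 0)"
      using n m by (intro tendsto_intros lim0) auto
    \<comment> \<open>Divide numerator and denominator by k. For k > 0 the subtraction of natural
      numbers in the denominator is not truncated, since m k n \<ge> n.\<close>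
    moreover have "\<forall>\<^sub>F k in sequentially. (real n - \<mu> l / real k) / (real m * real n - real n / real k)
        = (real (n * k) - \<mu> l) / real (m * k * n - n)"
      using eventually_gt_at_top[of 0]
    proof eventually_elim
      case (elim k)
      have "n \<le> m * k * n" using m elim by simp
      hence r: "real (m * k * n - n) = real m * real k * real n - real n" by (simp add: of_nat_diff)
      have "(real n - \<mu> l / real k) = (real (n * k) - \<mu> l) / real k"
        "real m * real n - real n / real k = real (m * k * n - n) / real k"
        unfolding r using elim by (simp_all add: field_simps)
      thus ?case using elim by simp
    qed
    ultimately have "(\<lambda>k. (real (n * k) - \<mu> l) / real (m * k * n - n)) \<longlonglongrightarrow> (real n - 0) / (real m * real n - 0)"
      by (rule Lim_transform_eventually)
    thus ?thesis using n by simp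
  qed
  hence "h \<longlonglongrightarrow> (\<Sum>l<m. eta (1 / real m))"
    unfolding h_def using m by (intro tendsto_sum tendsto_eta) auto
  also have "(\<Sum>l<m. eta (1 / real m)) = log 2 m" using m by (simp add: eta_def log_divide)
  finally have "(\<lambda>k. min (S_min n \<Phi>) (h k)) \<longlonglongrightarrow> min (S_min n \<Phi>) (log 2 m)"
    by (intro tendsto_min tendsto_const)
  hence "min (S_min n \<Phi>) (log 2 m) \<le> gap"
    by (rule LIMSEQ_le_const2) (use bound in blast)
  \<comment> \<open>Every output entropy is at most log m, so the limiting minimum is
    \<open>S_min n \<Phi>\<close> itself.\<close>
  moreover have "S_min n \<Phi> \<le> log 2 m"
    using S_min_le_channel[OF \<Phi> density_unit_mat[OF n]] vn_entropy_density_le[OF \<rho>0] by linarith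
  ultimately show "S_min n \<Phi> + S_min n \<Psi> \<le> S_min (n * n) (chan_tensor n m n m \<Phi> \<Psi>)"
    unfolding gap_def by simp
qed

end
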